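(* For every integer $k\ge 0$, as $n\to\infty$, $$v_{2k}(n) \sim (-1)^k\, 2^{2k-2}\, 3^{k-\frac74}\, B_{2k}\!\left(\tfrac12\right) n^{k-\frac54} e^{2\pi\sqrt{\frac n3}},$$ where $v_{2k}(n):=\sum_{m\in\mathbb Z} m^{2k}v(m,n)$.
   Context: A Durfee unimodal sequence of size $n$ is a sequence of positive integers $a_1\le a_2\le\cdots\le a_r\le \overline{c}\ge b_s\ge\cdots\ge b_1$ with total sum $n$ and a designated peak $c$ (so if the largest part is repeated, the choice of which copy is the peak distinguishes sequences), which additionally satisfies $s\le c-k$, where $k$ is the size of the Durfee square of the partition $(a_1,\dots,a_r)$, i.e. the largest $k$ with $a_{r-k+1}\ge k$ ($k=0$ if there is no such positive $k$). Its rank is $s-r$ (number of parts after the peak minus number of parts before the peak). $v(m,n)$ is the number of Durfee unimodal sequences of size $n$ with rank $m$; equivalently $\sum_{n\ge0,m\in\mathbb Z} v(m,n)\zeta^mq^n=\sum_{n\ge0}\frac{(q^{n+1};q)_nq^n}{(\zeta q;q)_n(\zeta^{-1}q;q)_n}$, with $(a;q)_n=\prod_{j=0}^{n-1}(1-aq^j)$. $B_\ell(x)$ denotes the $\ell$-th Bernoulli polynomial.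
   Formalization: The Durfee condition is read as b_s ≤ c−k (largest part after the peak; void if s=0), not s ≤ c−k as printed: the latter contradicts the stated generating function, e.g. the peak 1 followed by 1,1 (size 3, rank 2) is counted there but has s=2 > c−k=1. *)

theory Defs
  imports "HOL-Analysis.Analysis" "HOL-Computational_Algebra.Formal_Power_Series"
begin

text \<open>
  The list \<open>a\<close> is \<open>[a\<^sub>1, \<dots>, a\<^sub>r]\<close> in nondecreasing order, so \<open>a ! (length a - k)\<close> is the
  \<open>k\<close>-th largest part \<open>a\<^bsub>r-k+1\<^esub>\<close>.
\<close>
definition durfee_size :: "nat list \<Rightarrow> nat" where
  "durfee_size a = Max {k. k = 0 \<or> (k \<le> length a \<and> k \<le> a ! (length a - k))}"

text \<open>
  The triple \<open>(a, c, b)\<close> with \<open>a = [a\<^sub>1, \<dots>, a\<^sub>r]\<close> and \<open>b = [b\<^sub>1, \<dots>, b\<^sub>s]\<close> stands for the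
  sequence \<open>a\<^sub>1 \<le> \<dots> \<le> a\<^sub>r \<le> c \<ge> b\<^sub>s \<ge> \<dots> \<ge> b\<^sub>1\<close> with designated peak \<open>c\<close>; keeping \<open>c\<close>
  separate distinguishes different choices of the peak in the same sequence.
\<close>
definition unimodal_seq :: "nat list \<times> nat \<times> nat list \<Rightarrow> bool" where
  "unimodal_seq = (\<lambda>(a, c, b).
     sorted (a @ [c]) \<and> sorted (b @ [c]) \<and> 0 < c \<and> (\<forall>x\<in>set a \<union> set b. 0 < x))"

definition seq_size :: "nat list \<times> nat \<times> nat list \<Rightarrow> nat" where
  "seq_size = (\<lambda>(a, c, b). sum_list a + c + sum_list b)"

definition seq_rank :: "nat list \<times> nat \<times> nat list \<Rightarrow> int" where
  "seq_rank = (\<lambda>(a, c, b). int (length b) - int (length a))"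

text \<open>
  The Durfee condition bounds the largest part after the peak: \<open>b\<^sub>s \<le> c - k\<close>, where \<open>k\<close> is
  the size of the Durfee square of \<open>a\<close>; it is void if \<open>s = 0\<close> (note \<open>k \<le> a\<^sub>r \<le> c\<close>).
  It is this condition, not one on the number \<open>s\<close> of parts, that yields the generating function
  \<open>\<Sum>\<^sub>n (q\<^bsup>n+1\<^esup>; q)\<^sub>n q\<^sup>n / ((\<zeta>q; q)\<^sub>n (\<zeta>\<^sup>-\<^sup>1q; q)\<^sub>n)\<close>: the summand with index \<open>n\<close> enumerates the
  sequences with peak \<open>c = n\<close> (apart from the summand \<open>1\<close> for \<open>n = 0\<close>, since here \<open>c > 0\<close>).
\<close>
definition durfee_unimodal :: "nat list \<times> nat \<times> nat list \<Rightarrow> bool" where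
  "durfee_unimodal = (\<lambda>(a, c, b).
     unimodal_seq (a, c, b) \<and> (b \<noteq> [] \<longrightarrow> last b + durfee_size a \<le> c))"

definition durfee_count :: "int \<Rightarrow> nat \<Rightarrow> nat" where
  "durfee_count m n = card {S. durfee_unimodal S \<and> seq_size S = n \<and> seq_rank S = m}"

definition durfee_moment :: "nat \<Rightarrow> nat \<Rightarrow> real" where
  "durfee_moment l n = (\<Sum>\<^sub>\<infinity>m::int. real_of_int m ^ l * real (durfee_count m n))"

text \<open>
  Bernoulli polynomials: \<open>t e\<^bsup>xt\<^esup> / (e\<^sup>t - 1) = \<Sum>\<^sub>l B\<^sub>l(x) t\<^sup>l / l!\<close>.
\<close>
definition bernoulli_poly :: "nat \<Rightarrow> real \<Rightarrow> real" where
  "bernoulli_poly l x = fact l * fps_nth (fps_X * fps_exp x / (fps_exp 1 - 1)) l"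

text \<open>
  The sets counted by \<open>durfee_count\<close> are finite and the sum in \<open>durfee_moment\<close> has finite
  support, so neither definition falls back to a default value.
\<close>
lemma length_le_sum_list_pos:
  fixes xs :: "nat list"
  assumes "\<forall>x\<in>set xs. 0 < x"
  shows "length xs \<le> sum_list xs"
  using assms by (induction xs) auto

lemma finite_unimodal_of_size: "finite {S. unimodal_seq S \<and> seq_size S = n}"
proof -
  let ?L = "{xs :: nat list. set xs \<subseteq> {..n} \<and> length xs \<le> n}"
  have "{S. unimodal_seq S \<and> seq_size S = n} \<subseteq> ?L \<times> {..n} \<times> ?L"
  proof
    fix S assume "S \<in> {S. unimodal_seq S \<and> seq_size S = n}"
    moreover obtain a c b where S: "S = (a, c, b)" by (cases S)
    ultimately have pos: "\<forall>x\<in>set a. 0 < x" "\<forall>x\<in>set b. 0 < x"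
      and sz: "sum_list a + c + sum_list b = n"
      by (auto simp: unimodal_seq_def seq_size_def)
    have "length a \<le> n" "length b \<le> n"
      using length_le_sum_list_pos[OF pos(1)] length_le_sum_list_pos[OF pos(2)] sz by auto
    moreover have "x \<le> n" if "x \<in> set a \<union> set b" for x
      using that member_le_sum_list[of x a] member_le_sum_list[of x b] sz by auto
    ultimately show "S \<in> ?L \<times> {..n} \<times> ?L"
      using sz by (auto simp: S)
  qed
  moreover have "finite (?L \<times> {..n} \<times> ?L)"
    by (intro finite_cartesian_product finite_lists_length_le) auto
  ultimately show ?thesis
    by (rule finite_subset)
qed

lemma finite_durfee_unimodal:
  "finite {S. durfee_unimodal S \<and> seq_size S = n \<and> seq_rank S = m}"
  by (rule finite_subset[OF _ finite_unimodal_of_size[of n]]) (auto simp: durfee_unimodal_def)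

lemma finite_durfee_count_support: "finite {m. durfee_count m n \<noteq> 0}"
proof (rule finite_subset)
  show "{m. durfee_count m n \<noteq> 0} \<subseteq> seq_rank ` {S. unimodal_seq S \<and> seq_size S = n}"
    by (auto simp: durfee_count_def durfee_unimodal_def image_iff card_eq_0_iff)
  show "finite (seq_rank ` {S. unimodal_seq S \<and> seq_size S = n})"
    by (intro finite_imageI finite_unimodal_of_size)
qed

lemma durfee_moment_eq_sum:
  "durfee_moment l n =
     (\<Sum>m | durfee_count m n \<noteq> 0. real_of_int m ^ l * real (durfee_count m n))"
  unfolding durfee_moment_def
  by (subst infsum_finite[OF finite_durfee_count_support, symmetric],
      rule infsum_cong_neutral) auto

lemma finite_durfee_size: "finite {k. k = 0 \<or> (k \<le> length a \<and> k \<le> a ! (length a - k))}"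
  by (rule finite_subset[of _ "{..length a}"]) auto

end

theory Submission
  imports
    Defs
    "HOL-Probability.Probability"
    "HOL-Complex_Analysis.Complex_Analysis"
    "HOL-Real_Asymp.Real_Asymp"
begin

text \<open>
  Splitting the parts before the peak \<open>n\<close> at their Durfee square and summing by the
  \<open>q\<close>-Vandermonde identity, the sequences with peak \<open>n\<close> have the generating function
  \<open>q\<^sup>n (q\<^bsup>n+1\<^esup>)\<^sub>n / ((\<zeta>q)\<^sub>n (q/\<zeta>)\<^sub>n)\<close>. Since
  \<open>(1 - \<zeta>q\<^sup>j)(1 - q\<^sup>j/\<zeta>) = (1 - q\<^sup>j)\<^sup>2 - s q\<^sup>j\<close> with \<open>s = \<zeta> + 1/\<zeta> - 2\<close>, it is a power series in
  \<open>s\<close> whose coefficients are \<open>q\<^sup>n (q)\<^bsub>2n\<^esub> (q)\<^sub>n\<^sup>-\<^sup>3 h\<^sub>r(X\<^sub>1, \<dots>, X\<^sub>n)\<close>, where \<open>h\<^sub>r\<close> is the complete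
  homogeneous symmetric polynomial and \<open>X\<^sub>j = q\<^sup>j / (1 - q\<^sup>j)\<^sup>2\<close>. As \<open>s = z\<^sup>2 + O(z\<^sup>4)\<close> for
  \<open>\<zeta> = e\<^sup>z\<close>, the moment of order \<open>2k\<close> is \<open>(2k)!\<close> times the coefficient for \<open>r = k\<close>, up to
  terms with \<open>r < k\<close>, which are of lower order.

  The circle method is applied directly to the sum over \<open>n\<close>. For \<open>q = e\<^bsup>-t\<^esup>\<close> with
  \<open>\<bar>Im t\<bar> \<le> (Re t)\<^bsup>4/3\<^esup>\<close> only \<open>n\<close> with \<open>q\<^sup>n \<approx> t\<close> contribute; there
  \<open>q\<^sup>n (q\<^bsup>n+1\<^esup>)\<^sub>n (q\<^bsup>n+1\<^esup>)\<^sub>\<infinity>\<^sup>2\<close> is close to \<open>q\<^sup>n (q\<^bsup>n+1\<^esup>)\<^sub>\<infinity>\<^sup>3\<close>, which telescopes up to a small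
  error to \<open>1/3\<close>, while \<open>t\<^bsup>2r\<^esup> h\<^sub>r\<close> tends to \<open>h\<^sub>r(1, 1/4, 1/9, \<dots>)\<close>, the coefficient of
  \<open>w\<^bsup>2r\<^esup>\<close> in \<open>\<pi>w / sin \<pi>w\<close>. On the rest of the circle, the Gaussian binomial
  coefficient \<open>(q)\<^bsub>2n\<^esub> / (q)\<^sub>n\<^sup>2\<close> is largest at \<open>\<bar>q\<bar>\<close>, its coefficients being nonnegative, and
  the remaining factor \<open>1 / (q)\<^sub>n\<close> decays away from the positive real axis.
\<close>

text \<open>Every summand contains \<open>1 / (q)_inf^2\<close>, which is
  \<open>t exp (pi^2/(3t)) / (2 pi)\<close> to leading order; balanced against \<open>q^(-N)\<close>
  it puts the saddle at \<open>t = pi / sqrt (3N)\<close>, with width \<open>t^(3/2)\<close>. Only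
  the square of the Euler product has to be known asymptotically, so no branch of
  \<open>sqrt t\<close> is chosen. The telescoping rests on
  \<open>1 - (1 - y)^3 = 3y (1 - y + y^2/3)\<close> with \<open>y = q^n\<close>: up to a relative
  error of order \<open>y\<close>, the summand is a third of a difference of consecutive cubes. The
  obstacle is the numerator \<open>(q)_2n\<close>, which away from the positive axis can be
  exponentially larger than at \<open>|q|\<close>, so that numerator and denominator cannot be
  bounded separately. Hence the thin major arc, and the passage to \<open>gauss_binom\<close>
  elsewhere. \<open>gauss_binom\<close> is defined by the q-Pascal recurrence, so that one
  polynomial serves formal series, complex and real \<open>q\<close>, and its coefficients are
  visibly nonnegative.\<close>

fun gauss_binom :: "'a::comm_ring_1 \<Rightarrow> nat \<Rightarrow> nat \<Rightarrow> 'a" where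
  "gauss_binom q n 0 = 1"
| "gauss_binom q 0 (Suc k) = 0"
| "gauss_binom q (Suc n) (Suc k) = gauss_binom q n k + q ^ Suc k * gauss_binom q n (Suc k)"

definition qpoch :: "nat \<Rightarrow> 'a::comm_ring_1 \<Rightarrow> 'a" where
  "qpoch n q = (\<Prod>j=1..n. 1 - q ^ j)"

text \<open>Recursion on the largest index: \<open>j\<close> is the largest index in a monomial of
  degree \<open>Suc r\<close>, and the remaining factor uses only \<open>X 1\<close>, ...,
  \<open>X j\<close>.\<close>

fun hsym :: "(nat \<Rightarrow> 'a::comm_ring_1) \<Rightarrow> nat \<Rightarrow> nat \<Rightarrow> 'a" where
  "hsym X 0 n = 1"
| "hsym X (Suc r) n = (\<Sum>j=1..n. X j * hsym X r j)"

lemma hsym_Suc_Suc: "hsym X (Suc r) (Suc n) = hsym X (Suc r) n + X (Suc n) * hsym X r (Suc n)"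
  by simp

section \<open>Generating functions of Durfee unimodal sequences\<close>

lemma gauss_binom_eq_0: "n < k \<Longrightarrow> gauss_binom q n k = 0"
  by (induction q n k rule: gauss_binom.induct) auto

text \<open>Applied at \<open>M = n\<close>; a separate \<open>M\<close> keeps the factors of both
  products unchanged while \<open>n\<close> grows. In the induction step the new factor on the right
  is split into the two factors that lengthen the product in \<open>y\<close> and the product in
  \<open>x\<close>; collecting terms is then a q-Pascal rule for the weights.\<close>

lemma q_vandermonde:
  fixes q x y :: "'a::comm_ring_1"
  assumes "n \<le> M"
  shows "(\<Sum>k\<le>n. gauss_binom q n k * q ^ (k * (M - n + k)) * y ^ k *
            (\<Prod>i<k. 1 - x * q ^ (M - i)) * (\<Prod>i<n-k. 1 - y * q ^ (M - i)))
         = (\<Prod>i<n. 1 - x * y * q ^ (2 * M - i))"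
  using assms
proof (induction n)
  case 0
  then show ?case by simp
next
  case (Suc n)
  define a where "a k = (\<Prod>i<k. 1 - x * q ^ (M - i))" for k
  define b where "b k = (\<Prod>i<k. 1 - y * q ^ (M - i))" for k
  define w where "w n k = gauss_binom q n k * q ^ (k * (M - n + k)) * y ^ k" for n k
  have M: "Suc n \<le> M" by fact
  have split: "1 - x * y * q ^ (2 * M - n) =
     (1 - y * q ^ (M - (n - k))) + y * q ^ (M - (n - k)) * (1 - x * q ^ (M - k))" if "k \<le> n" for k
  proof -
    have "2 * M - n = (M - (n - k)) + (M - k)" using that M by auto
    then show ?thesis by (simp add: algebra_simps power_add)
  qed
  \<comment> \<open>Passing from \<open>n\<close> to \<open>Suc n\<close> lowers the exponent at
    index \<open>Suc k\<close> by \<open>Suc k\<close>; the factor \<open>q ^ Suc k\<close> of the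
    recurrence makes up for it.\<close>
  have pascal: "w (Suc n) (Suc k) = w n (Suc k) + y * q ^ (M - (n - k)) * w n k" if "k \<le> n" for k
  proof -
    obtain D where D: "M = Suc n + D" using M le_Suc_ex by blast
    have e1: "Suc k * (M - Suc n + Suc k) + Suc k = Suc k * (M - n + Suc k)"
      using D by (simp add: algebra_simps)
    have e2: "Suc k * (M - Suc n + Suc k) = (M - (n - k)) + k * (M - n + k)"
      using D that by (simp add: algebra_simps)
    have "w (Suc n) (Suc k) = gauss_binom q n k * q ^ (Suc k * (M - Suc n + Suc k)) * y ^ Suc k
      + gauss_binom q n (Suc k) * q ^ (Suc k * (M - Suc n + Suc k) + Suc k) * y ^ Suc k"
      by (simp only: w_def gauss_binom.simps power_add) (simp add: algebra_simps)
    also have "\<dots> = gauss_binom q n k * q ^ (M - (n - k) + k * (M - n + k)) * y ^ Suc k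
      + gauss_binom q n (Suc k) * q ^ (Suc k * (M - n + Suc k)) * y ^ Suc k"
      unfolding e1 unfolding e2 ..
    also have "\<dots> = w n (Suc k) + y * q ^ (M - (n - k)) * w n k"
      by (simp only: w_def power_add power_Suc) (simp add: algebra_simps)
    finally show ?thesis .
  qed
  have a_Suc: "a (Suc k) = a k * (1 - x * q ^ (M - k))" for k
    by (simp add: a_def)
  have b_Suc: "b (Suc k) = b k * (1 - y * q ^ (M - k))" for k
    by (simp add: b_def)
  have IH: "(\<Sum>k\<le>n. w n k * a k * b (n - k)) = (\<Prod>i<n. 1 - x * y * q ^ (2 * M - i))"
    using Suc by (simp add: w_def a_def b_def)
  have w0: "w n (Suc n) = 0" "w (Suc n) 0 = 1" "w n 0 = 1"
    by (simp_all add: w_def gauss_binom_eq_0)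
  have "(\<Prod>i<Suc n. 1 - x * y * q ^ (2 * M - i))
      = (\<Sum>k\<le>n. w n k * a k * b (n - k) * (1 - x * y * q ^ (2 * M - n)))"
    by (simp add: IH[symmetric] sum_distrib_right)
  also have "\<dots> = (\<Sum>k\<le>n. w n k * a k * b (Suc n - k)) +
      (\<Sum>k\<le>n. (y * q ^ (M - (n - k)) * w n k) * a (Suc k) * b (n - k))"
    unfolding sum.distrib[symmetric]
  proof (intro sum.cong refl)
    fix k assume "k \<in> {..n}"
    then have k: "k \<le> n" "Suc n - k = Suc (n - k)" by auto
    show "w n k * a k * b (n - k) * (1 - x * y * q ^ (2 * M - n)) =
      w n k * a k * b (Suc n - k) + (y * q ^ (M - (n - k)) * w n k) * a (Suc k) * b (n - k)"
      unfolding split[OF k(1)] k(2) a_Suc b_Suc by (simp add: algebra_simps)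
  qed
  also have "(\<Sum>k\<le>n. w n k * a k * b (Suc n - k)) = (\<Sum>k\<le>Suc n. w n k * a k * b (Suc n - k))"
    using w0 by simp
  also have "\<dots> = a 0 * b (Suc n) + (\<Sum>k\<le>n. w n (Suc k) * a (Suc k) * b (n - k))"
    unfolding sum.atMost_Suc_shift by (simp add: w0)
  also have "a 0 * b (Suc n) + (\<Sum>k\<le>n. w n (Suc k) * a (Suc k) * b (n - k)) +
      (\<Sum>k\<le>n. (y * q ^ (M - (n - k)) * w n k) * a (Suc k) * b (n - k)) =
      a 0 * b (Suc n) + (\<Sum>k\<le>n. w (Suc n) (Suc k) * a (Suc k) * b (n - k))"
    unfolding add.assoc sum.distrib[symmetric]
    by (intro arg_cong2[of _ _ _ _ "(+)"] refl sum.cong) (simp add: pascal algebra_simps)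
  also have "\<dots> = (\<Sum>k\<le>Suc n. w (Suc n) k * a k * b (Suc n - k))"
    unfolding sum.atMost_Suc_shift by (simp add: w0)
  finally show ?case by (simp add: w_def a_def b_def)
qed

section \<open>Partitions with bounded parts, and partitions in a box\<close>

definition part_lists :: "nat \<Rightarrow> nat \<Rightarrow> nat list set" where
  "part_lists n N = {xs. sorted xs \<and> set xs \<subseteq> {1..n} \<and> sum_list xs = N}"

definition part_gf :: "'a::comm_ring_1 \<Rightarrow> nat \<Rightarrow> 'a fps" where
  "part_gf z n = Abs_fps (\<lambda>N. \<Sum>xs\<in>part_lists n N. z ^ length xs)"

lemma finite_part_lists: "finite (part_lists n N)"
proof (rule finite_subset)
  show "part_lists n N \<subseteq> {xs. set xs \<subseteq> {1..n} \<and> length xs \<le> N}"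
    using length_le_sum_list_pos by (fastforce simp: part_lists_def)
  show "finite {xs. set xs \<subseteq> {1..n} \<and> length xs \<le> N}"
    by (rule finite_lists_length_le) auto
qed

lemma part_lists_0: "part_lists 0 N = (if N = 0 then {[]} else {})"
  by (auto simp: part_lists_def)

lemma part_gf_0: "part_gf z 0 = 1"
  by (rule fps_ext) (simp add: part_gf_def part_lists_0)

text \<open>Sortedness puts a part \<open>Suc n\<close>, if there is one, at the end of the list,
  and removing it leaves a list of the same kind.\<close>

lemma part_lists_Suc:
  "part_lists (Suc n) N = part_lists n N \<union>
     (if Suc n \<le> N then (\<lambda>xs. xs @ [Suc n]) ` part_lists (Suc n) (N - Suc n) else {})"
  (is "?L = ?R")
proof (intro set_eqI iffI)
  fix xs assume xs: "xs \<in> ?L"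
  show "xs \<in> ?R"
  proof (cases "Suc n \<in> set xs")
    case False
    then have "set xs \<subseteq> {1..n}" using xs by (fastforce simp: part_lists_def le_Suc_eq)
    then show ?thesis using xs by (auto simp: part_lists_def)
  next
    case True
    then obtain ys y where ys: "xs = ys @ [y]" by (metis empty_iff empty_set rev_exhaust)
    have "y = Suc n" using xs True by (fastforce simp: part_lists_def ys sorted_append)
    then show ?thesis using xs ys by (auto simp: part_lists_def sorted_append)
  qed
next
  fix xs assume "xs \<in> ?R"
  then consider "xs \<in> part_lists n N"
    | ys where "Suc n \<le> N" "xs = ys @ [Suc n]" "ys \<in> part_lists (Suc n) (N - Suc n)"
    by (auto split: if_splits)
  then show "xs \<in> ?L"
  proof cases
    case 1
    then show ?thesis by (force simp: part_lists_def)
  next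
    case 2
    then have "set ys \<subseteq> {1..Suc n}" "sorted ys" "sum_list ys = N - Suc n"
      by (simp_all add: part_lists_def)
    moreover from this have "\<forall>x\<in>set ys. x \<le> Suc n" by auto
    ultimately show ?thesis using 2(1,2) by (simp add: part_lists_def sorted_append)
  qed
qed

lemma part_gf_Suc: "(1 - fps_const z * fps_X ^ Suc n) * part_gf z (Suc n) = part_gf z n"
proof (rule fps_ext)
  fix N
  have "(\<Sum>xs\<in>part_lists (Suc n) N. z ^ length xs) = (\<Sum>xs\<in>part_lists n N. z ^ length xs) +
     (if Suc n \<le> N then z * (\<Sum>xs\<in>part_lists (Suc n) (N - Suc n). z ^ length xs) else 0)"
  proof (cases "Suc n \<le> N")
    case True
    have disj: "part_lists n N \<inter> (\<lambda>xs. xs @ [Suc n]) ` part_lists (Suc n) (N - Suc n) = {}"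
    proof -
      have "Suc n \<notin> set xs" if "xs \<in> part_lists n N" for xs
        using that by (auto simp: part_lists_def)
      then show ?thesis by force
    qed
    have inj: "inj_on (\<lambda>xs. xs @ [Suc n]) (part_lists (Suc n) (N - Suc n))"
      by (auto simp: inj_on_def)
    show ?thesis
      by (subst part_lists_Suc)
         (use True disj in \<open>simp add: sum.union_disjoint finite_part_lists sum.reindex[OF inj] sum_distrib_left\<close>)
  qed (subst part_lists_Suc, simp)
  then show "fps_nth ((1 - fps_const z * fps_X ^ Suc n) * part_gf z (Suc n)) N = fps_nth (part_gf z n) N"
    by (simp add: part_gf_def left_diff_distrib mult.assoc fps_X_power_mult_nth del: power_Suc)
qed

text \<open>\<open>part_gf z m\<close> inverts the first \<open>m\<close> factors, so the others
  survive. They are listed downwards from \<open>n\<close>, as in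
  \<open>q_vandermonde\<close>.\<close>

lemma part_gf_prod:
  "m \<le> n \<Longrightarrow> part_gf z m * (\<Prod>j=1..n. 1 - fps_const z * fps_X ^ j) =
     (\<Prod>i<n-m. 1 - fps_const z * fps_X ^ (n - i))"
proof (induction n)
  case 0
  then show ?case by (simp add: part_gf_0)
next
  case (Suc n)
  have inv: "part_gf z n * (\<Prod>j=1..n. 1 - fps_const z * fps_X ^ j) = 1" for n
  proof (induction n)
    case (Suc n)
    have "part_gf z (Suc n) * (\<Prod>j=1..Suc n. 1 - fps_const z * fps_X ^ j) =
       ((1 - fps_const z * fps_X ^ Suc n) * part_gf z (Suc n)) * (\<Prod>j=1..n. 1 - fps_const z * fps_X ^ j)"
      by (simp add: algebra_simps)
    then show ?case by (simp only: part_gf_Suc Suc)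
  qed (simp add: part_gf_0)
  show ?case
  proof (cases "m = Suc n")
    case False
    then have *: "m \<le> n" "Suc n - m = Suc (n - m)" using Suc by auto
    show ?thesis
      using Suc.IH[OF *(1)] unfolding *(2) prod.lessThan_Suc_shift
      by (simp add: mult.assoc[symmetric] del: power_Suc)
  qed (simp only: inv, simp)
qed

definition box_lists :: "nat \<Rightarrow> nat \<Rightarrow> nat \<Rightarrow> nat \<Rightarrow> nat list set" where
  "box_lists lo hi k N = {u. sorted u \<and> length u = k \<and> set u \<subseteq> {lo..hi} \<and> sum_list u = N}"

definition box_gf :: "nat \<Rightarrow> nat \<Rightarrow> nat \<Rightarrow> 'a::comm_ring_1 fps" where
  "box_gf lo hi k = Abs_fps (\<lambda>N. of_nat (card (box_lists lo hi k N)))"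

lemma finite_box_lists: "finite (box_lists lo hi k N)"
  by (rule finite_subset[OF _ finite_lists_length_eq[of "{lo..hi}" k]]) (auto simp: box_lists_def)

lemma box_gf_0: "box_gf lo hi 0 = 1"
proof (rule fps_ext)
  fix N
  have "box_lists lo hi 0 N = (if N = 0 then {[]} else {})" by (auto simp: box_lists_def)
  then show "fps_nth (box_gf lo hi 0) N = fps_nth (1 :: 'a fps) N" by (simp add: box_gf_def)
qed

lemma box_lists_Suc:
  assumes "lo \<le> hi"
  shows "box_lists lo hi (Suc k) N = (if lo \<le> N then (#) lo ` box_lists lo hi k (N - lo) else {})
           \<union> box_lists (Suc lo) hi (Suc k) N" (is "?L = ?R")
proof (intro set_eqI iffI)
  fix u assume u: "u \<in> ?L"
  then obtain x xs where x: "u = x # xs" by (auto simp: box_lists_def length_Suc_conv)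
  show "u \<in> ?R"
  proof (cases "x = lo")
    case True
    then show ?thesis using u x by (auto simp: box_lists_def)
  next
    case False
    then have "\<forall>y\<in>set u. Suc lo \<le> y" using u x by (fastforce simp: box_lists_def)
    then show ?thesis using u by (fastforce simp: box_lists_def)
  qed
next
  fix u assume "u \<in> ?R"
  then show "u \<in> ?L" using assms by (fastforce simp: box_lists_def split: if_splits)
qed

lemma box_gf_Suc:
  assumes "lo \<le> hi"
  shows "box_gf lo hi (Suc k) = fps_X ^ lo * box_gf lo hi k + box_gf (Suc lo) hi (Suc k)"
proof (rule fps_ext)
  fix N
  have "card (box_lists lo hi (Suc k) N) =
    (if lo \<le> N then card (box_lists lo hi k (N - lo)) else 0) + card (box_lists (Suc lo) hi (Suc k) N)"
    by (subst box_lists_Suc[OF assms], subst card_Un_disjoint)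
       (auto simp: finite_box_lists card_image inj_on_def, auto simp: box_lists_def)
  then show "fps_nth (box_gf lo hi (Suc k)) N =
     fps_nth (fps_X ^ lo * box_gf lo hi k + box_gf (Suc lo) hi (Suc k) :: 'a fps) N"
    by (simp add: box_gf_def fps_X_power_mult_nth)
qed

text \<open>Whether the smallest admissible part \<open>lo\<close> occurs gives the q-Pascal
  recurrence; the induction measure is the number of admissible sizes plus the number of parts. The
  boundary value \<open>lo = Suc hi\<close> stands for an empty range of sizes.\<close>

lemma box_gf_eq:
  "lo \<le> Suc hi \<Longrightarrow> box_gf lo hi k = fps_X ^ (lo * k) * gauss_binom fps_X (hi + k - lo) k"
proof (induction "(Suc hi - lo) + k" arbitrary: lo k rule: less_induct)
  case less
  show ?case
  proof (cases k)
    case 0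
    then show ?thesis by (simp add: box_gf_0)
  next
    case (Suc j)
    show ?thesis
    proof (cases "lo = Suc hi")
      case True
      have "box_lists lo hi (Suc j) N = {}" for N
        using True by (auto simp: box_lists_def length_Suc_conv)
      then have "box_gf lo hi k = (0 :: 'a fps)"
        by (intro fps_ext) (simp add: box_gf_def Suc)
      moreover have "gauss_binom (fps_X :: 'a fps) (hi + k - lo) k = 0"
        using True Suc by (intro gauss_binom_eq_0) auto
      ultimately show ?thesis by simp
    next
      case False
      then have lo: "lo \<le> hi" using less.prems by simp
      have *: "box_gf lo hi j = fps_X ^ (lo * j) * gauss_binom (fps_X :: 'a fps) (hi + j - lo) j"
        using lo Suc by (intro less.hyps) auto
      have **: "box_gf (Suc lo) hi (Suc j) = fps_X ^ (Suc lo * Suc j) *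
          gauss_binom (fps_X :: 'a fps) (hi + Suc j - Suc lo) (Suc j)"
        using lo Suc by (intro less.hyps) auto
      have ***: "hi + Suc j - lo = Suc (hi + j - lo)" "hi + Suc j - Suc lo = hi + j - lo"
        using lo by auto
      show ?thesis
        unfolding Suc box_gf_Suc[OF lo] * ** *** gauss_binom.simps
        by (simp add: algebra_simps power_add)
    qed
  qed
qed

section \<open>Splitting a partition at its Durfee square\<close>

lemma durfee_size_append:
  assumes "length u = k" "\<forall>x\<in>set u. k \<le> x" "\<forall>x\<in>set l. x \<le> k"
  shows "durfee_size (l @ u) = k"
  unfolding durfee_size_def
proof (rule Max_eqI)
  show "finite {i. i = 0 \<or> i \<le> length (l @ u) \<and> i \<le> (l @ u) ! (length (l @ u) - i)}"
    by (rule finite_durfee_size)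
  show "k \<in> {i. i = 0 \<or> i \<le> length (l @ u) \<and> i \<le> (l @ u) ! (length (l @ u) - i)}"
    using assms by (cases u) (auto simp: nth_append)
  fix i assume i: "i \<in> {i. i = 0 \<or> i \<le> length (l @ u) \<and> i \<le> (l @ u) ! (length (l @ u) - i)}"
  show "i \<le> k"
  proof (rule ccontr)
    assume "\<not> i \<le> k"
    then have *: "i \<le> length l + k" "i \<le> (l @ u) ! (length l + k - i)" "length l + k - i < length l"
      using i assms(1) by auto
    then have "i \<le> l ! (length l + k - i)" by (simp add: nth_append)
    also have "\<dots> \<le> k" using assms(3) *(3) by simp
    finally show False using \<open>\<not> i \<le> k\<close> by simp
  qed
qed

lemma durfee_size_split:
  assumes "sorted a"
  shows "durfee_size a \<le> length a"
    and "\<forall>x\<in>set (drop (length a - durfee_size a) a). durfee_size a \<le> x"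
    and "\<forall>x\<in>set (take (length a - durfee_size a) a). x \<le> durfee_size a"
proof -
  define k where "k = durfee_size a"
  let ?A = "{i. i = 0 \<or> i \<le> length a \<and> i \<le> a ! (length a - i)}"
  have "k \<in> ?A" unfolding k_def durfee_size_def
    by (rule Max_in[OF finite_durfee_size]) auto
  then have k: "k \<le> length a" "k = 0 \<or> k \<le> a ! (length a - k)" by auto
  have k_max: "i \<le> k" if "i \<in> ?A" for i
    using that unfolding k_def durfee_size_def by (rule Max_ge[OF finite_durfee_size])
  show "durfee_size a \<le> length a" using k by (simp add: k_def)
  show "\<forall>x\<in>set (drop (length a - durfee_size a) a). durfee_size a \<le> x"
    unfolding k_def[symmetric]
  proof
    fix x assume "x \<in> set (drop (length a - k) a)"
    then obtain i where i: "i < k" "x = a ! (length a - k + i)"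
      using k by (auto simp: in_set_conv_nth)
    have "k \<le> a ! (length a - k)" using i k by auto
    also have "\<dots> \<le> x" unfolding i using i k by (intro sorted_nth_mono[OF assms]) auto
    finally show "k \<le> x" .
  qed
  show "\<forall>x\<in>set (take (length a - durfee_size a) a). x \<le> durfee_size a"
    unfolding k_def[symmetric]
  proof
    fix x assume "x \<in> set (take (length a - k) a)"
    then obtain i where i: "i < length a - k" "x = a ! i"
      by (auto simp: in_set_conv_nth)
    then have "x \<le> a ! (length a - Suc k)" by (auto intro!: sorted_nth_mono[OF assms])
    also have "\<dots> \<le> k"
    proof (rule ccontr)
      assume "\<not> a ! (length a - Suc k) \<le> k"
      then have "Suc k \<in> ?A" using i by auto
      then show False using k_max by fastforce
    qed
    finally show "x \<le> k" .
  qed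
qed

lemma durfee_size_le: "a \<in> part_lists n N \<Longrightarrow> durfee_size a \<le> n"
proof -
  assume a: "a \<in> part_lists n N"
  then have *: "sorted a" "set a \<subseteq> {1..n}" by (auto simp: part_lists_def)
  show ?thesis
  proof (cases "durfee_size a = 0")
    case False
    define u where "u = drop (length a - durfee_size a) a"
    have "length u = durfee_size a" using durfee_size_split(1)[OF *(1)] by (simp add: u_def)
    then obtain x where x: "x \<in> set u" using False by (cases u) auto
    then have "durfee_size a \<le> x" using durfee_size_split(2)[OF *(1)] by (simp add: u_def)
    also have "x \<le> n" using x *(2) by (auto simp: u_def dest: in_set_dropD)
    finally show ?thesis .
  qed simp
qed

definition durfee_gf :: "'a::comm_ring_1 \<Rightarrow> nat \<Rightarrow> nat \<Rightarrow> 'a fps" where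
  "durfee_gf z n k = Abs_fps (\<lambda>N. \<Sum>a | a \<in> part_lists n N \<and> durfee_size a = k. z ^ length a)"

text \<open>\<open>u\<close> consists of the \<open>k\<close> rows that meet the Durfee square,
  \<open>l\<close> of the rows below it. Parts at most \<open>k\<close> in \<open>l\<close> and at
  least \<open>k\<close> in \<open>u\<close> already force the Durfee size, so both can be chosen
  freely.\<close>

lemma bij_betw_durfee_split:
  assumes "k \<le> n"
  shows "bij_betw (\<lambda>(M, l, u). l @ u)
     (SIGMA M:{0..N}. part_lists k M \<times> box_lists k n k (N - M))
     {a. a \<in> part_lists n N \<and> durfee_size a = k}"
  unfolding bij_betw_def
proof
  let ?T = "SIGMA M:{0..N}. part_lists k M \<times> box_lists k n k (N - M)"
  show "inj_on (\<lambda>(M, l, u). l @ u) ?T"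
  proof (rule inj_onI)
    fix p p' assume p: "p \<in> ?T" "p' \<in> ?T" "(case p of (M, l, u) \<Rightarrow> l @ u) = (case p' of (M, l, u) \<Rightarrow> l @ u)"
    obtain M l u M' l' u' where pp: "p = (M, l, u)" "p' = (M', l', u')"
      by (metis prod_cases3)
    have "length u = length u'" "sum_list l = M" "sum_list l' = M'" "l @ u = l' @ u'"
      using p by (simp_all add: pp part_lists_def box_lists_def)
    then show "p = p'" by (simp add: pp)
  qed
  show "(\<lambda>(M, l, u). l @ u) ` ?T = {a. a \<in> part_lists n N \<and> durfee_size a = k}"
  proof (intro set_eqI iffI)
    fix a assume "a \<in> (\<lambda>(M, l, u). l @ u) ` ?T"
    then obtain M l u where *: "a = l @ u" "M \<le> N" "l \<in> part_lists k M" "u \<in> box_lists k n k (N - M)"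
      by auto
    then have l: "sorted l" "set l \<subseteq> {1..k}" "sum_list l = M"
      and u: "sorted u" "length u = k" "set u \<subseteq> {k..n}" "sum_list u = N - M"
      by (auto simp: part_lists_def box_lists_def)
    have "durfee_size a = k"
      unfolding *(1) using l(2) u(2,3) by (intro durfee_size_append) auto
    moreover have "set a \<subseteq> {1..n}"
    proof
      fix x assume "x \<in> set a"
      then consider "x \<in> set l" | "x \<in> set u" using *(1) by auto
      then show "x \<in> {1..n}"
      proof cases
        case 1 then show ?thesis using l(2) assms by auto
      next
        case 2
        \<comment> \<open>The box admits parts from \<open>k\<close> on, hence a part 0 if
          \<open>k = 0\<close>; but then \<open>u\<close> is empty.\<close>
        then have "k \<noteq> 0" using u(2) by (cases u) auto
        then show ?thesis using 2 u(3) by auto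
      qed
    qed
    moreover have "sorted a"
    proof -
      have "x \<le> y" if "x \<in> set l" "y \<in> set u" for x y
        using that l(2) u(3) by (meson atLeastAtMost_iff order_trans subsetD)
      then show ?thesis unfolding *(1) using l(1) u(1) by (simp add: sorted_append)
    qed
    ultimately show "a \<in> {a. a \<in> part_lists n N \<and> durfee_size a = k}"
      using *(1,2) l(3) u(4) by (simp add: part_lists_def)
  next
    fix a assume "a \<in> {a. a \<in> part_lists n N \<and> durfee_size a = k}"
    then have a: "sorted a" "set a \<subseteq> {1..n}" "sum_list a = N" "durfee_size a = k"
      by (auto simp: part_lists_def)
    define l where "l = take (length a - k) a"
    define u where "u = drop (length a - k) a"
    have lu: "a = l @ u" by (simp add: l_def u_def)
    note d = durfee_size_split[OF a(1), unfolded a(4), folded l_def u_def]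
    have ss: "set l \<subseteq> {1..n}" "set u \<subseteq> {1..n}" "sum_list l + sum_list u = N"
      using a(2,3) unfolding lu by auto
    have "l \<in> part_lists k (sum_list l)"
    proof -
      have "sorted l" using a(1) by (simp add: l_def sorted_wrt_take)
      moreover have "set l \<subseteq> {1..k}" using d(3) ss(1) by (simp add: subset_iff)
      ultimately show ?thesis by (simp add: part_lists_def)
    qed
    moreover have "u \<in> box_lists k n k (N - sum_list l)"
    proof -
      have "sorted u" "length u = k" using a(1) d(1) by (simp_all add: u_def sorted_wrt_drop)
      moreover have "set u \<subseteq> {k..n}" using d(2) ss(2) by (simp add: subset_iff)
      ultimately show ?thesis using ss(3) by (simp add: box_lists_def)
    qed
    ultimately have "(sum_list l, l, u) \<in> ?T" using ss(3) by auto
    then show "a \<in> (\<lambda>(M, l, u). l @ u) ` ?T" using lu by force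
  qed
qed

lemma durfee_gf_eq:
  assumes "k \<le> n"
  shows "durfee_gf z n k = fps_const (z ^ k) * part_gf z k * box_gf k n k"
proof (rule fps_ext)
  fix N
  have "fps_nth (durfee_gf z n k) N =
     (\<Sum>x\<in>(SIGMA M:{0..N}. part_lists k M \<times> box_lists k n k (N - M)). z ^ length (case x of (M, l, u) \<Rightarrow> l @ u))"
    unfolding durfee_gf_def fps_nth_Abs_fps
    by (rule sum.reindex_bij_betw[OF bij_betw_durfee_split[OF assms], symmetric])
  also have "\<dots> = (\<Sum>M=0..N. \<Sum>x\<in>part_lists k M \<times> box_lists k n k (N - M). z ^ length (fst x @ snd x))"
    by (subst sum.Sigma) (auto simp: finite_part_lists finite_box_lists intro!: sum.cong)
  also have "\<dots> = (\<Sum>M=0..N. \<Sum>l\<in>part_lists k M. \<Sum>u\<in>box_lists k n k (N - M). z ^ length l * z ^ k)"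
    unfolding sum.cartesian_product
    by (intro sum.cong refl) (auto simp: box_lists_def power_add)
  also have "\<dots> = (\<Sum>M=0..N. z ^ k * ((\<Sum>l\<in>part_lists k M. z ^ length l) * of_nat (card (box_lists k n k (N - M)))))"
    by (intro sum.cong refl) (simp add: sum_distrib_left sum_distrib_right mult_ac)
  also have "\<dots> = fps_nth (fps_const (z ^ k) * (part_gf z k * box_gf k n k)) N"
    unfolding fps_mult_left_const_nth fps_mult_nth[of "part_gf z k"]
    by (simp add: part_gf_def box_gf_def sum_distrib_left)
  finally show "fps_nth (durfee_gf z n k) N = fps_nth (fps_const (z ^ k) * part_gf z k * box_gf k n k) N"
    by (simp add: mult.assoc)
qed

section \<open>Sequences with a fixed peak\<close>

definition peak_pairs :: "nat \<Rightarrow> nat \<Rightarrow> (nat list \<times> nat list) set" where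
  "peak_pairs n N = {(a, b). durfee_unimodal (a, n, b) \<and> sum_list a + sum_list b = N}"

text \<open>As \<open>b\<close> is sorted, the condition on its last element bounds all its parts by
  \<open>n - k\<close>. Once the Durfee size \<open>k\<close> of \<open>a\<close> is fixed,
  \<open>a\<close> and \<open>b\<close> are therefore independent.\<close>

lemma bij_betw_peak_pairs:
  assumes "0 < n"
  shows "bij_betw (\<lambda>(k, M, a, b). (a, b))
     (SIGMA k:{..n}. SIGMA M:{0..N}. {a. a \<in> part_lists n M \<and> durfee_size a = k} \<times> part_lists (n - k) (N - M))
     (peak_pairs n N)"
  unfolding bij_betw_def
proof
  let ?T = "SIGMA k:{..n}. SIGMA M:{0..N}. {a. a \<in> part_lists n M \<and> durfee_size a = k} \<times> part_lists (n - k) (N - M)"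
  show "inj_on (\<lambda>(k, M, a, b). (a, b)) ?T"
    by (rule inj_onI) (auto simp: part_lists_def)
  show "(\<lambda>(k, M, a, b). (a, b)) ` ?T = peak_pairs n N"
  proof (intro set_eqI iffI)
    fix p assume "p \<in> (\<lambda>(k, M, a, b). (a, b)) ` ?T"
    then obtain M a b where p: "p = (a, b)" "M \<le> N" "a \<in> part_lists n M" "b \<in> part_lists (n - durfee_size a) (N - M)"
      by auto
    have d: "durfee_size a \<le> n" using p(3) by (rule durfee_size_le)
    have a: "sorted a" "set a \<subseteq> {1..n}" "sum_list a = M" using p(3) by (auto simp: part_lists_def)
    have b: "sorted b" "set b \<subseteq> {1..n - durfee_size a}" "sum_list b = N - M"
      using p(4) by (auto simp: part_lists_def)
    have "last b + durfee_size a \<le> n" if "b \<noteq> []"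
      using last_in_set[OF that] b(2) d by (auto simp: subset_iff)
    moreover have "\<forall>x\<in>set a \<union> set b. 0 < x \<and> x \<le> n" using a(2) b(2) d by fastforce
    ultimately show "p \<in> peak_pairs n N"
      using assms a b p(1,2)
      by (auto simp: peak_pairs_def durfee_unimodal_def unimodal_seq_def sorted_append)
  next
    fix p assume "p \<in> peak_pairs n N"
    then obtain a b where p: "p = (a, b)" and 1: "sorted (a @ [n])" "sorted (b @ [n])"
       "\<forall>x\<in>set a \<union> set b. 0 < x" "b \<noteq> [] \<longrightarrow> last b + durfee_size a \<le> n" "sum_list a + sum_list b = N"
      by (auto simp: peak_pairs_def durfee_unimodal_def unimodal_seq_def)
    have a: "a \<in> part_lists n (sum_list a)"
      using 1(1,3) by (auto simp: part_lists_def sorted_append Suc_le_eq)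
    have "x \<le> n - durfee_size a" if "x \<in> set b" for x
    proof -
      have "x \<le> last b" using that 1(2)
        by (cases b rule: rev_cases) (auto simp: sorted_append)
      moreover have "last b + durfee_size a \<le> n" using 1(4) that by (cases b) auto
      ultimately show ?thesis by simp
    qed
    then have "set b \<subseteq> {1..n - durfee_size a}" using 1(3) by (simp add: subset_iff Suc_le_eq)
    moreover have "sum_list b = N - sum_list a" using 1(5) by simp
    ultimately have b: "b \<in> part_lists (n - durfee_size a) (N - sum_list a)"
      using 1(2) by (simp add: part_lists_def sorted_append)
    have "(durfee_size a, sum_list a, a, b) \<in> ?T"
      using a b durfee_size_le[OF a] 1(5) by auto
    then show "p \<in> (\<lambda>(k, M, a, b). (a, b)) ` ?T" unfolding p by force
  qed
qed

text \<open>\<open>z\<close> marks the parts after the peak and \<open>z'\<close> those before it,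
  so that \<open>z' = 1/z\<close> records the rank.\<close>

definition peak_gf :: "'a::comm_ring_1 \<Rightarrow> 'a \<Rightarrow> nat \<Rightarrow> 'a fps" where
  "peak_gf z z' n = Abs_fps (\<lambda>N. \<Sum>(a, b)\<in>peak_pairs n N. z' ^ length a * z ^ length b)"

lemma peak_gf_eq_sum:
  assumes "0 < n"
  shows "peak_gf z z' n = (\<Sum>k\<le>n. durfee_gf z' n k * part_gf z (n - k))"
proof (rule fps_ext)
  fix N
  let ?A = "\<lambda>k M. {a. a \<in> part_lists n M \<and> durfee_size a = k}"
  have fin: "finite (?A k M)" for k M by (rule finite_subset[OF _ finite_part_lists]) auto
  have "fps_nth (peak_gf z z' n) N =
     (\<Sum>x\<in>(SIGMA k:{..n}. SIGMA M:{0..N}. ?A k M \<times> part_lists (n - k) (N - M)).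
        case (case x of (k, M, a, b) \<Rightarrow> (a, b)) of (a, b) \<Rightarrow> z' ^ length a * z ^ length b)"
    unfolding peak_gf_def fps_nth_Abs_fps
    by (rule sum.reindex_bij_betw[OF bij_betw_peak_pairs[OF assms], symmetric])
  also have "\<dots> = (\<Sum>k\<le>n. \<Sum>x\<in>(SIGMA M:{0..N}. ?A k M \<times> part_lists (n - k) (N - M)).
        case x of (M, a, b) \<Rightarrow> z' ^ length a * z ^ length b)"
    unfolding sum.Sigma[OF finite_atMost ballI[OF finite_SigmaI[OF finite_atLeastAtMost finite_cartesian_product[OF fin finite_part_lists]]]]
    by (rule sum.cong) auto
  also have "\<dots> = (\<Sum>k\<le>n. \<Sum>M=0..N. \<Sum>x\<in>?A k M \<times> part_lists (n - k) (N - M).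
        case x of (a, b) \<Rightarrow> z' ^ length a * z ^ length b)"
    unfolding sum.Sigma[OF finite_atLeastAtMost ballI[OF finite_cartesian_product[OF fin finite_part_lists]]]
    by (intro sum.cong refl)
  also have "\<dots> = (\<Sum>k\<le>n. \<Sum>M=0..N. (\<Sum>a\<in>?A k M. z' ^ length a) * (\<Sum>b\<in>part_lists (n - k) (N - M). z ^ length b))"
    unfolding sum.cartesian_product[symmetric] by (simp add: sum_product)
  also have "\<dots> = fps_nth (\<Sum>k\<le>n. durfee_gf z' n k * part_gf z (n - k)) N"
    by (simp add: fps_sum_nth fps_mult_nth durfee_gf_def part_gf_def)
  finally show "fps_nth (peak_gf z z' n) N = fps_nth (\<Sum>k\<le>n. durfee_gf z' n k * part_gf z (n - k)) N" .
qed

text \<open>Multiplying by both products turns each summand of \<open>peak_gf_eq_sum\<close> into a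
  summand of \<open>q_vandermonde\<close> with \<open>M = n\<close>, \<open>x = z\<close>,
  \<open>y = z'\<close>. Clearing denominators keeps the argument valid in any commutative ring; it
  is used with coefficients that are themselves power series.\<close>

lemma peak_gf_prod:
  fixes z z' :: "'a::comm_ring_1"
  assumes "0 < n" "z * z' = 1"
  shows "peak_gf z z' n * (\<Prod>j=1..n. (1 - fps_const z * fps_X ^ j) * (1 - fps_const z' * fps_X ^ j))
    = (\<Prod>i<n. 1 - fps_X ^ (2 * n - i))"
proof -
  let ?P = "\<lambda>z. (\<Prod>j=1..n. 1 - fps_const z * fps_X ^ j) :: 'a fps"
  have "peak_gf z z' n * (?P z * ?P z') = (\<Sum>k\<le>n. durfee_gf z' n k * part_gf z (n - k) * (?P z * ?P z'))"
    by (simp add: peak_gf_eq_sum[OF assms(1)] sum_distrib_right)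
  also have "\<dots> = (\<Sum>k\<le>n. gauss_binom fps_X n k * fps_X ^ (k * (n - n + k)) * fps_const z' ^ k *
            (\<Prod>i<k. 1 - fps_const z * fps_X ^ (n - i)) * (\<Prod>i<n-k. 1 - fps_const z' * fps_X ^ (n - i)))"
  proof (intro sum.cong refl)
    fix k assume "k \<in> {..n}"
    then have k: "k \<le> n" "n - k \<le> n" "n - (n - k) = k" "k \<le> Suc n" by auto
    have "durfee_gf z' n k * part_gf z (n - k) * (?P z * ?P z') =
      fps_const z' ^ k * box_gf k n k * (part_gf z (n - k) * ?P z) * (part_gf z' k * ?P z')"
      unfolding durfee_gf_eq[OF k(1)] by (simp add: fps_const_power mult_ac)
    also have "\<dots> = fps_const z' ^ k * (fps_X ^ (k * k) * gauss_binom fps_X n k) *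
         (\<Prod>i<k. 1 - fps_const z * fps_X ^ (n - i)) * (\<Prod>i<n-k. 1 - fps_const z' * fps_X ^ (n - i))"
      unfolding part_gf_prod[OF k(1)] part_gf_prod[OF k(2)] k(3) box_gf_eq[OF k(4)] by simp
    finally show "durfee_gf z' n k * part_gf z (n - k) * (?P z * ?P z') = gauss_binom fps_X n k * fps_X ^ (k * (n - n + k)) * fps_const z' ^ k *
            (\<Prod>i<k. 1 - fps_const z * fps_X ^ (n - i)) * (\<Prod>i<n-k. 1 - fps_const z' * fps_X ^ (n - i))"
      by (simp add: mult_ac)
  qed
  also have "\<dots> = (\<Prod>i<n. 1 - fps_const z * fps_const z' * fps_X ^ (2 * n - i))"
    by (rule q_vandermonde) simp
  finally show ?thesis using assms(2) by (simp add: prod.distrib)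
qed

section \<open>Expansion in powers of \<open>s\<close>\<close>

text \<open>
  \<open>weight_fps Q n r\<close> is the expansion of \<open>Q (q)\<^sub>n\<^sup>-\<^sup>2 h\<^sub>r(X\<^sub>1, \<dots>, X\<^sub>n)\<close> with
  \<open>X\<^sub>j = q\<^sup>j / (1 - q\<^sup>j)\<^sup>2\<close>.
\<close>
fun weight_fps :: "complex fps \<Rightarrow> nat \<Rightarrow> nat \<Rightarrow> complex fps" where
  "weight_fps Q 0 0 = Q"
| "weight_fps Q 0 (Suc r) = 0"
| "weight_fps Q (Suc n) 0 = inverse ((1 - fps_X ^ Suc n)\<^sup>2) * weight_fps Q n 0"
| "weight_fps Q (Suc n) (Suc r) =
     inverse ((1 - fps_X ^ Suc n)\<^sup>2) * (weight_fps Q n (Suc r) + fps_X ^ Suc n * weight_fps Q (Suc n) r)"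

text \<open>Each step in \<open>r\<close> contributes a factor \<open>fps_X ^ Suc n\<close>, so the
  series of index \<open>r\<close> is divisible by \<open>fps_X ^ r\<close>; this is what makes the
  truncation in \<open>s_emb\<close> harmless.\<close>

lemma weight_fps_low: "M < r \<Longrightarrow> fps_nth (weight_fps Q n r) M = 0"
proof (induction Q n r arbitrary: M rule: weight_fps.induct)
  case (4 Q n r)
  have "fps_nth (weight_fps Q n (Suc r) + fps_X ^ Suc n * weight_fps Q (Suc n) r) i = 0" if "i \<le> M" for i
    using 4 that by (auto simp: fps_X_power_mult_nth simp del: power_Suc)
  then show ?case
    by (simp only: weight_fps.simps fps_mult_nth) (simp del: power_Suc)
qed auto

text \<open>
  The sum of \<open>s\<^sup>r f\<^sub>r\<close> over all \<open>r\<close>, truncated to a finite sum in every coefficient: this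
  loses nothing as long as \<open>f\<^sub>r\<close> is divisible by \<open>q\<^sup>r\<close>.
\<close>
definition s_emb :: "complex fps \<Rightarrow> (nat \<Rightarrow> complex fps) \<Rightarrow> complex fps fps" where
  "s_emb s f = Abs_fps (\<lambda>M. \<Sum>r\<le>M. s ^ r * fps_const (fps_nth (f r) M))"

text \<open>The shift lowers the truncation bound from \<open>M\<close> to \<open>M - j\<close>; the
  indices in between contribute nothing by divisibility.\<close>

lemma s_emb_mult_X_power:
  assumes "\<And>r M. M < r \<Longrightarrow> fps_nth (f r) M = 0"
  shows "s_emb s f * fps_X ^ j = s_emb s (\<lambda>r. f r * fps_X ^ j)"
proof (rule fps_ext)
  fix M
  have "(\<Sum>r\<le>M - j. s ^ r * fps_const (fps_nth (f r) (M - j))) =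
        (\<Sum>r\<le>M. s ^ r * fps_const (fps_nth (f r) (M - j)))"
    using assms by (intro sum.mono_neutral_left) auto
  then show "fps_nth (s_emb s f * fps_X ^ j) M = fps_nth (s_emb s (\<lambda>r. f r * fps_X ^ j)) M"
    by (auto simp: s_emb_def fps_X_power_mult_right_nth)
qed

text \<open>Multiplication by \<open>s\<close> raises the index by one, so a term of index
  \<open>Suc M\<close> appears beyond the truncation; a positive \<open>j\<close> makes it
  vanish.\<close>

lemma s_emb_mult_s_X_power:
  assumes "\<And>r M. M < r \<Longrightarrow> fps_nth (f r) M = 0" "0 < j"
  shows "s_emb s f * (fps_const s * fps_X ^ j) =
    s_emb s (\<lambda>r. case r of 0 \<Rightarrow> 0 | Suc r' \<Rightarrow> f r' * fps_X ^ j)"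
proof (rule fps_ext)
  fix M
  let ?g = "\<lambda>r. fps_nth (f r * fps_X ^ j) M"
  have 0: "?g M = 0" using assms by (auto simp: fps_X_power_mult_right_nth)
  have "(\<Sum>r\<le>Suc M. s ^ r * fps_const (fps_nth (case r of 0 \<Rightarrow> 0 | Suc r' \<Rightarrow> f r' * fps_X ^ j) M)) =
    s * (\<Sum>r\<le>M. s ^ r * fps_const (?g r))"
    unfolding sum.atMost_Suc_shift by (simp add: sum_distrib_left mult_ac)
  then have "(\<Sum>r\<le>M. s ^ r * fps_const (fps_nth (case r of 0 \<Rightarrow> 0 | Suc r' \<Rightarrow> f r' * fps_X ^ j) M)) =
    s * (\<Sum>r\<le>M. s ^ r * fps_const (?g r))"
    using 0 by simp
  moreover have "s_emb s f * fps_X ^ j = s_emb s (\<lambda>r. f r * fps_X ^ j)"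
    by (rule s_emb_mult_X_power) (rule assms(1))
  then have "s_emb s f * (fps_const s * fps_X ^ j) = fps_const s * s_emb s (\<lambda>r. f r * fps_X ^ j)"
    by (simp only: mult.left_commute)
  then have "fps_nth (s_emb s f * (fps_const s * fps_X ^ j)) M = s * (\<Sum>r\<le>M. s ^ r * fps_const (?g r))"
    by (simp only: fps_mult_left_const_nth) (simp add: s_emb_def)
  ultimately show "fps_nth (s_emb s f * (fps_const s * fps_X ^ j)) M =
     fps_nth (s_emb s (\<lambda>r. case r of 0 \<Rightarrow> 0 | Suc r' \<Rightarrow> f r' * fps_X ^ j)) M"
    by (simp add: s_emb_def)
qed

lemma s_emb_add: "s_emb s f + s_emb s g = s_emb s (\<lambda>r. f r + g r)"
  by (rule fps_ext) (simp add: s_emb_def sum.distrib algebra_simps flip: fps_const_add)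

lemma s_emb_diff: "s_emb s f - s_emb s g = s_emb s (\<lambda>r. f r - g r)"
  by (rule fps_ext) (simp add: s_emb_def sum_subtractf algebra_simps flip: fps_const_sub)

text \<open>Compared power by power in \<open>s\<close>, the claim is the recursion of
  \<open>weight_fps\<close> multiplied by \<open>(1 - fps_X ^ Suc n)^2\<close>.\<close>

lemma s_emb_weight_fps_Suc:
  "s_emb s (weight_fps Q (Suc n)) * ((1 - fps_X ^ Suc n)\<^sup>2 - fps_const s * fps_X ^ Suc n) = s_emb s (weight_fps Q n)"
proof -
  let ?F = "weight_fps Q (Suc n)"
  define j where "j = Suc n"
  note low = weight_fps_low[of _ _ Q "Suc n"]
  have "s_emb s ?F * ((1 - fps_X ^ j)\<^sup>2 - fps_const s * fps_X ^ j) =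
      s_emb s ?F - (s_emb s ?F * fps_X ^ j + s_emb s ?F * fps_X ^ j) + s_emb s ?F * fps_X ^ (2 * j)
        - s_emb s ?F * (fps_const s * fps_X ^ j)"
    by (simp add: power2_eq_square algebra_simps flip: power_add)
  also have "\<dots> = s_emb s (\<lambda>r. ?F r - (?F r * fps_X ^ j + ?F r * fps_X ^ j) + ?F r * fps_X ^ (2 * j)
        - (case r of 0 \<Rightarrow> 0 | Suc r' \<Rightarrow> ?F r' * fps_X ^ j))"
    by (subst (1 2 3) s_emb_mult_X_power[OF low], assumption,
        subst s_emb_mult_s_X_power[OF low], assumption)
       (simp_all only: s_emb_add s_emb_diff, simp_all add: j_def)
  also have "(\<lambda>r. ?F r - (?F r * fps_X ^ j + ?F r * fps_X ^ j) + ?F r * fps_X ^ (2 * j)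
        - (case r of 0 \<Rightarrow> 0 | Suc r' \<Rightarrow> ?F r' * fps_X ^ j)) = weight_fps Q n"
  proof
    fix r
    have inv: "inverse ((1 - fps_X ^ j)\<^sup>2 :: complex fps) * (1 - fps_X ^ j)\<^sup>2 = 1"
      by (rule inverse_mult_eq_1) (simp add: j_def fps_nth_power_0)
    have "?F r - (?F r * fps_X ^ j + ?F r * fps_X ^ j) + ?F r * fps_X ^ (2 * j) = ?F r * (1 - fps_X ^ j)\<^sup>2"
      by (simp add: power2_eq_square algebra_simps flip: power_add)
    also have "\<dots> = weight_fps Q n r + (case r of 0 \<Rightarrow> 0 | Suc r' \<Rightarrow> ?F r' * fps_X ^ j)"
    proof (cases r)
      case 0
      have "?F 0 * (1 - fps_X ^ j)\<^sup>2 = (inverse ((1 - fps_X ^ j)\<^sup>2) * (1 - fps_X ^ j)\<^sup>2) * weight_fps Q n 0"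
        unfolding weight_fps.simps j_def by (simp only: mult_ac)
      then show ?thesis unfolding 0 nat.case inv by (simp only: mult_1_left add_0_right)
    next
      case (Suc r')
      have "?F (Suc r') * (1 - fps_X ^ j)\<^sup>2 = (inverse ((1 - fps_X ^ j)\<^sup>2) * (1 - fps_X ^ j)\<^sup>2) *
          (weight_fps Q n (Suc r') + fps_X ^ j * ?F r')"
        unfolding weight_fps.simps j_def by (simp only: mult_ac)
      then show ?thesis unfolding Suc nat.case inv by (simp only: mult_1_left mult.commute[of "fps_X ^ j"])
    qed
    finally show "?F r - (?F r * fps_X ^ j + ?F r * fps_X ^ j) + ?F r * fps_X ^ (2 * j)
        - (case r of 0 \<Rightarrow> 0 | Suc r' \<Rightarrow> ?F r' * fps_X ^ j) = weight_fps Q n r" by simp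
  qed
  finally show ?thesis by (simp add: j_def del: power_Suc)
qed

definition fps_emb :: "complex fps \<Rightarrow> complex fps fps" where
  "fps_emb f = Abs_fps (\<lambda>M. fps_const (fps_nth f M))"

lemma fps_emb_mult: "fps_emb (f * g) = fps_emb f * fps_emb g"
proof (rule fps_ext)
  fix M
  have "fps_const (\<Sum>i=0..M. fps_nth f i * fps_nth g (M - i)) =
     (\<Sum>i=0..M. fps_const (fps_nth f i * fps_nth g (M - i)))"
    by (rule fps_ext) (simp add: fps_sum_nth)
  then show "fps_nth (fps_emb (f * g)) M = fps_nth (fps_emb f * fps_emb g) M"
    by (simp add: fps_emb_def fps_mult_nth)
qed

lemma fps_emb_prod: "fps_emb (\<Prod>i<(n::nat). 1 - fps_X ^ m i) = (\<Prod>i<n. 1 - fps_X ^ m i)"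
proof (induction n)
  case 0
  show ?case by (rule fps_ext) (simp add: fps_emb_def)
next
  case (Suc n)
  have "fps_emb (1 - fps_X ^ j) = 1 - fps_X ^ j" for j
    by (rule fps_ext) (simp add: fps_emb_def fps_X_power_nth flip: fps_const_sub)
  then show ?case using Suc by (simp add: fps_emb_mult)
qed

lemma s_emb_weight_fps_prod:
  "s_emb s (weight_fps Q n) * (\<Prod>j=1..n. (1 - fps_X ^ j)\<^sup>2 - fps_const s * fps_X ^ j) = fps_emb Q"
proof (induction n)
  case 0
  have "(\<Sum>r\<le>M. s ^ r * fps_const (fps_nth (weight_fps Q 0 r) M)) = fps_const (fps_nth Q M)" for M
  proof -
    have "(\<Sum>r\<le>M. s ^ r * fps_const (fps_nth (weight_fps Q 0 r) M)) =
       (\<Sum>r\<in>{0}. s ^ r * fps_const (fps_nth (weight_fps Q 0 r) M))"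
    proof (rule sum.mono_neutral_right)
      have "weight_fps Q 0 r = 0" if "r \<noteq> 0" for r using that by (cases r) auto
      then show "\<forall>r\<in>{..M} - {0}. s ^ r * fps_const (fps_nth (weight_fps Q 0 r) M) = 0" by simp
    qed auto
    then show ?thesis by simp
  qed
  then show ?case by (simp add: s_emb_def fps_emb_def)
next
  case (Suc n)
  have "s_emb s (weight_fps Q (Suc n)) * (\<Prod>j=1..Suc n. (1 - fps_X ^ j)\<^sup>2 - fps_const s * fps_X ^ j) =
    (s_emb s (weight_fps Q (Suc n)) * ((1 - fps_X ^ Suc n)\<^sup>2 - fps_const s * fps_X ^ Suc n)) *
      (\<Prod>j=1..n. (1 - fps_X ^ j)\<^sup>2 - fps_const s * fps_X ^ j)"
    by (simp add: mult_ac)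
  then show ?case by (simp only: s_emb_weight_fps_Suc Suc)
qed

text \<open>Both sides agree after multiplication by the product of the denominators, rewritten in
  terms of \<open>s\<close>. That product is not zero and can be cancelled in the integral domain of
  iterated power series.\<close>

lemma peak_gf_eq_s_emb:
  assumes "0 < n" "z * z' = 1"
  shows "peak_gf z z' n = s_emb (z + z' - 2) (weight_fps (\<Prod>i<n. 1 - fps_X ^ (2 * n - i)) n)"
proof -
  let ?s = "z + z' - 2"
  let ?P = "\<Prod>j=1..n. (1 - fps_X ^ j)\<^sup>2 - fps_const ?s * fps_X ^ j"
  have ring: "(1 - a * x) * (1 - b * x) = (1 - x)\<^sup>2 - (a + b - 2) * x" if "a * b = 1"
    for a b x :: "complex fps fps"
  proof -
    have "(1 - a * x) * (1 - b * x) = 1 - (a + b) * x + (a * b) * x\<^sup>2"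
      by (simp add: power2_eq_square algebra_simps)
    then show ?thesis by (simp add: that power2_eq_square algebra_simps)
  qed
  have "fps_const ?s = fps_const z + fps_const z' - 2"
    by (simp add: fps_numeral_fps_const)
  then have "(1 - fps_const z * fps_X ^ j) * (1 - fps_const z' * fps_X ^ j) =
     (1 - fps_X ^ j)\<^sup>2 - fps_const ?s * fps_X ^ j" for j
    using ring[of "fps_const z" "fps_const z'" "fps_X ^ j"] assms(2) by simp
  then have "peak_gf z z' n * ?P = s_emb ?s (weight_fps (\<Prod>i<n. 1 - fps_X ^ (2 * n - i)) n) * ?P"
    using peak_gf_prod[OF assms] by (simp only: s_emb_weight_fps_prod fps_emb_prod)
  moreover have "?P \<noteq> 0"
  proof -
    have "fps_nth ((1 - fps_X ^ j)\<^sup>2 - fps_const ?s * fps_X ^ j) 0 \<noteq> 0" if "1 \<le> j" for j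
      using that by (simp add: fps_nth_power_0 power_0_left)
    then show ?thesis by (metis (no_types, lifting) atLeastAtMost_iff fps_zero_nth prod_zero_iff finite_atLeastAtMost)
  qed
  ultimately show ?thesis by simp
qed

section \<open>Rank moments as coefficients of powers of \<open>s\<close>\<close>

definition mcoeff :: "nat \<Rightarrow> nat \<Rightarrow> complex" where
  "mcoeff r N = (\<Sum>n=1..N. fps_nth (weight_fps (\<Prod>i<n. 1 - fps_X ^ (2 * n - i)) n r) (N - n))"

lemma bij_betw_durfee_peak:
  "bij_betw (\<lambda>(c, a, b). (a, c, b)) (SIGMA c:{1..N}. peak_pairs c (N - c))
     {S. durfee_unimodal S \<and> seq_size S = N}"
  unfolding bij_betw_def
proof
  show "inj_on (\<lambda>(c, a, b). (a, c, b)) (SIGMA c:{1..N}. peak_pairs c (N - c))"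
    by (auto simp: inj_on_def)
  show "(\<lambda>(c, a, b). (a, c, b)) ` (SIGMA c:{1..N}. peak_pairs c (N - c)) = {S. durfee_unimodal S \<and> seq_size S = N}"
  proof (intro set_eqI iffI)
    fix S assume "S \<in> (\<lambda>(c, a, b). (a, c, b)) ` (SIGMA c:{1..N}. peak_pairs c (N - c))"
    then show "S \<in> {S. durfee_unimodal S \<and> seq_size S = N}"
      by (auto simp: peak_pairs_def seq_size_def)
  next
    fix S assume S: "S \<in> {S. durfee_unimodal S \<and> seq_size S = N}"
    obtain a c b where abc: "S = (a, c, b)" by (cases S)
    have "(c, a, b) \<in> (SIGMA c:{1..N}. peak_pairs c (N - c))"
      using S by (auto simp: abc peak_pairs_def seq_size_def durfee_unimodal_def unimodal_seq_def)
    then show "S \<in> (\<lambda>(c, a, b). (a, c, b)) ` (SIGMA c:{1..N}. peak_pairs c (N - c))"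
      unfolding abc by force
  qed
qed

lemma durfee_moment_eq_sum_rank:
  "durfee_moment l N = (\<Sum>S | durfee_unimodal S \<and> seq_size S = N. real_of_int (seq_rank S) ^ l)"
proof -
  let ?A = "{S. durfee_unimodal S \<and> seq_size S = N}"
  let ?B = "{m. durfee_count m N \<noteq> 0}"
  have fin: "finite ?A"
    by (rule finite_subset[OF _ finite_unimodal_of_size[of N]]) (auto simp: durfee_unimodal_def)
  have sub: "seq_rank ` ?A \<subseteq> ?B"
    using finite_durfee_unimodal by (auto simp: durfee_count_def card_eq_0_iff)
  have "(\<Sum>S\<in>?A. real_of_int (seq_rank S) ^ l) =
     (\<Sum>m\<in>?B. \<Sum>S\<in>{S\<in>?A. seq_rank S = m}. real_of_int (seq_rank S) ^ l)"
    by (rule sum.group[OF fin finite_durfee_count_support sub, symmetric])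
  also have "\<dots> = (\<Sum>m\<in>?B. real_of_int m ^ l * real (durfee_count m N))"
    by (intro sum.cong refl) (simp add: durfee_count_def conj_assoc)
  finally show ?thesis by (simp add: durfee_moment_eq_sum)
qed

text \<open>This is \<open>\<zeta> + 1/\<zeta> - 2\<close> at \<open>\<zeta> = e\<^sup>z\<close>, as a power series in \<open>z\<close>.\<close>
abbreviation (input) sz :: "complex fps" where "sz \<equiv> fps_exp 1 + fps_exp (-1) - 2"

text \<open>At \<open>zeta = exp z\<close> the power \<open>zeta ^ m\<close> has the coefficient
  \<open>m ^ l / fact l\<close> at \<open>z ^ l\<close>, so the rank generating function becomes an
  exponential generating function of the moments. The number \<open>mcoeff r N\<close> is the
  coefficient of \<open>s ^ r q ^ N\<close> in it.\<close>

lemma durfee_moment_fps: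
  "complex_of_real (durfee_moment l N) / fact l = (\<Sum>r\<le>N. fps_nth (sz ^ r) l * mcoeff r N)"
proof -
  let ?z = "fps_exp 1 :: complex fps" and ?z' = "fps_exp (-1) :: complex fps"
  let ?Q = "\<lambda>n. (\<Prod>i<n. 1 - fps_X ^ (2 * n - i)) :: complex fps"
  have zz: "?z * ?z' = 1" by (simp add: fps_exp_add_mult[symmetric])
  have fin: "finite (peak_pairs c M)" if "c \<ge> 1" for c M
    using bij_betw_finite[OF bij_betw_peak_pairs[of c M]] that
    by (auto simp: finite_part_lists intro!: finite_SigmaI)
  have "(\<Sum>S | durfee_unimodal S \<and> seq_size S = N. fps_exp (of_int (seq_rank S)) :: complex fps) =
     (\<Sum>x\<in>(SIGMA c:{1..N}. peak_pairs c (N - c)). fps_exp (of_int (seq_rank (case x of (c, a, b) \<Rightarrow> (a, c, b)))))"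
    by (rule sum.reindex_bij_betw[OF bij_betw_durfee_peak, symmetric])
  also have "\<dots> = (\<Sum>c=1..N. \<Sum>(a, b)\<in>peak_pairs c (N - c). ?z' ^ length a * ?z ^ length b)"
    by (subst sum.Sigma)
       (auto simp: fin fps_exp_power_mult fps_exp_add_mult[symmetric] seq_rank_def intro!: sum.cong)
  also have "\<dots> = (\<Sum>c=1..N. fps_nth (peak_gf ?z ?z' c) (N - c))"
    by (simp add: peak_gf_def)
  also have "\<dots> = (\<Sum>c=1..N. \<Sum>r\<le>N-c. sz ^ r * fps_const (fps_nth (weight_fps (?Q c) c r) (N - c)))"
    by (intro sum.cong refl) (simp add: peak_gf_eq_s_emb zz s_emb_def)
  \<comment> \<open>Extending the range of \<open>r\<close> to \<open>N\<close> makes it independent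
    of the peak, so that the two sums can be exchanged.\<close>
  also have "\<dots> = (\<Sum>c=1..N. \<Sum>r\<le>N. sz ^ r * fps_const (fps_nth (weight_fps (?Q c) c r) (N - c)))"
    by (intro sum.cong refl sum.mono_neutral_left) (auto simp: weight_fps_low)
  finally have *: "(\<Sum>S | durfee_unimodal S \<and> seq_size S = N. fps_exp (of_int (seq_rank S)) :: complex fps) = \<dots>" .
  have "complex_of_real (durfee_moment l N) / fact l =
     fps_nth (\<Sum>S | durfee_unimodal S \<and> seq_size S = N. fps_exp (of_int (seq_rank S))) l"
    by (simp add: durfee_moment_eq_sum_rank fps_sum_nth sum_divide_distrib)
  also have "\<dots> = (\<Sum>c=1..N. \<Sum>r\<le>N. fps_nth (sz ^ r) l * fps_nth (weight_fps (?Q c) c r) (N - c))"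
    unfolding * by (simp add: fps_sum_nth)
  also have "\<dots> = (\<Sum>r\<le>N. fps_nth (sz ^ r) l * mcoeff r N)"
    unfolding mcoeff_def sum_distrib_left by (rule sum.swap)
  finally show ?thesis .
qed

text \<open>Hence \<open>sz ^ r\<close> starts with \<open>z ^ (2 * r)\<close> and coefficient 1. At
  \<open>z ^ (2 * k)\<close> the index \<open>r = k\<close> has weight exactly 1, and larger indices
  do not occur.\<close>

lemma sz_factor: "\<exists>g. sz = fps_X ^ 2 * g \<and> fps_nth g 0 = 1"
proof (intro exI conjI)
  show "sz = fps_X ^ 2 * fps_shift 2 sz"
  proof (rule fps_ext)
    fix n
    show "fps_nth sz n = fps_nth (fps_X ^ 2 * fps_shift 2 sz) n"
    proof (cases "n < 2")
      case True
      then have "n = 0 \<or> n = 1" by auto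
      then show ?thesis by (auto simp: fps_X_power_mult_nth fps_numeral_fps_const)
    next
      case False
      then have "n - 2 + 2 = n" by simp
      then show ?thesis using False unfolding fps_X_power_mult_nth fps_shift_nth by simp
    qed
  qed
  show "fps_nth (fps_shift 2 sz) 0 = 1"
    by (simp add: fps_numeral_fps_const)
qed

lemma mcoeff_eq_0: "N < r \<Longrightarrow> mcoeff r N = 0"
  by (auto simp: mcoeff_def intro!: sum.neutral weight_fps_low)

lemma durfee_moment_even:
  "complex_of_real (durfee_moment (2 * k) N) =
     fact (2 * k) * (mcoeff k N + (\<Sum>r<k. fps_nth (sz ^ r) (2 * k) * mcoeff r N))"
proof -
  obtain g where g: "sz = fps_X ^ 2 * g" "fps_nth g 0 = 1" using sz_factor by blast
  have szr: "sz ^ r = fps_X ^ (2 * r) * g ^ r" for r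
    unfolding g(1) by (simp add: power_mult_distrib power_mult)
  have low: "fps_nth (sz ^ r) (2 * k) = 0" if "k < r" for r
    unfolding szr using that by (simp add: fps_X_power_mult_nth)
  have top: "fps_nth (sz ^ k) (2 * k) = 1"
    unfolding szr by (simp add: fps_X_power_mult_nth fps_nth_power_0 g)
  have "(\<Sum>r\<le>N. fps_nth (sz ^ r) (2 * k) * mcoeff r N) = (\<Sum>r\<le>max k N. fps_nth (sz ^ r) (2 * k) * mcoeff r N)"
    by (intro sum.mono_neutral_left) (auto simp: mcoeff_eq_0)
  also have "\<dots> = (\<Sum>r\<le>k. fps_nth (sz ^ r) (2 * k) * mcoeff r N)"
    by (intro sum.mono_neutral_right) (auto simp: low)
  also have "\<dots> = mcoeff k N + (\<Sum>r<k. fps_nth (sz ^ r) (2 * k) * mcoeff r N)"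
    using top by (simp add: lessThan_Suc_atMost[symmetric])
  finally show ?thesis
    using durfee_moment_fps[of "2 * k" N] by (simp add: field_simps)
qed

section \<open>The Euler product near 1\<close>

text \<open>Equivalent to \<open>a <= 2 sinh (a/2)\<close>. With \<open>x = a/2\<close>,
  \<open>u = x + x^2/2\<close> and \<open>exp x >= 1 + u\<close>, this follows from
  \<open>(1 + u)^2 - 1 - 2x (1 + u) = (u - x)^2\<close>.\<close>

lemma exp_over_square_le:
  fixes a :: real
  assumes "0 < a"
  shows "exp (-a) / (1 - exp (-a))\<^sup>2 \<le> 1 / a\<^sup>2"
proof -
  have "0 < 1 - exp (-a)" using assms by simp
  have "a \<le> exp (a / 2) - exp (-(a / 2))"
  proof -
    define x where "x = a / 2"
    define u where "u = x + x\<^sup>2 / 2"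
    have x: "0 < x" using assms by (simp add: x_def)
    have u: "0 < u" using x by (simp add: u_def add_pos_pos)
    have E: "1 + u \<le> exp x" using exp_lower_Taylor_quadratic[of x] x by (simp add: u_def)
    have "2 * x * (1 + u) \<le> (1 + u) * (1 + u) - 1"
    proof -
      have "(1 + u) * (1 + u) - 1 - 2 * x * (1 + u) = (x\<^sup>2 / 2)\<^sup>2"
        by (simp add: u_def power2_eq_square algebra_simps)
      then show ?thesis using zero_le_power2[of "x\<^sup>2 / 2"] by linarith
    qed
    then have "2 * x \<le> (1 + u) - 1 / (1 + u)" using u by (simp add: field_simps)
    also have "\<dots> \<le> exp x - 1 / exp x"
      using E u by (intro diff_mono frac_le) auto
    finally show ?thesis by (simp add: x_def exp_minus inverse_eq_divide)
  qed
  then have "a * exp (-(a / 2)) \<le> (exp (a / 2) - exp (-(a / 2))) * exp (-(a / 2))"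
    by (rule mult_right_mono) simp
  also have "\<dots> = 1 - exp (-a)" by (simp add: algebra_simps flip: exp_add)
  finally have "(a * exp (-(a / 2)))\<^sup>2 \<le> (1 - exp (-a))\<^sup>2"
    using assms by (intro power_mono) auto
  moreover have "(a * exp (-(a / 2)))\<^sup>2 = a\<^sup>2 * exp (-a)"
    by (simp add: power_mult_distrib power2_eq_square flip: exp_add)
  ultimately show ?thesis
    using assms \<open>0 < 1 - exp (-a)\<close> by (simp add: field_simps)
qed

text \<open>The increments of the logarithm of \<open>fact n * exp n / n^(n + 1/2)\<close> are
  \<open>O(1/n^2)\<close>, so a limit exists; Wallis' product identifies it. The squared form is the
  one that meets the square of \<open>qpoch\<close>.\<close>

lemma stirling_squared:
  "(\<lambda>n. (fact n)\<^sup>2 * exp (2 * real n) / real n ^ (2 * n + 1)) \<longlonglongrightarrow> 2 * pi"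
proof -
  define a where "a n = ln (fact n) - (real n + 1 / 2) * ln (real n) + real n" for n :: nat
  have "summable (\<lambda>n. a (Suc n) - a n)"
  proof (rule summable_comparison_test_bigo)
    show "summable (\<lambda>n. norm (1 / real n ^ 2))"
      using inverse_power_summable[of 2, where ?'a = real] by (simp add: inverse_eq_divide)
    have "eventually (\<lambda>n. a (Suc n) - a n = 1 - (real n + 1 / 2) * (ln (real n + 1) - ln (real n))) at_top"
      using eventually_gt_at_top[of 0]
    proof eventually_elim
      case (elim n)
      have "ln (fact (Suc n)) = ln (real n + 1) + ln (fact n :: real)"
        by (simp add: ln_mult add.commute)
      then show ?case by (simp add: a_def algebra_simps)
    qed
    moreover have "(\<lambda>n. 1 - (real n + 1 / 2) * (ln (real n + 1) - ln (real n))) \<in> O(\<lambda>n. 1 / real n ^ 2)"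
      by real_asymp
    ultimately show "(\<lambda>n. a (Suc n) - a n) \<in> O(\<lambda>n. 1 / real n ^ 2)"
      by (subst landau_o.big.in_cong) auto
  qed
  then have "(\<lambda>n. (\<Sum>i<n. a (Suc i) - a i) + a 0) \<longlonglongrightarrow> (\<Sum>i. a (Suc i) - a i) + a 0"
    by (intro tendsto_add summable_LIMSEQ tendsto_const)
  then obtain c where c: "a \<longlonglongrightarrow> c" by (simp add: sum_lessThan_telescope)
  define A where "A n = fact n * exp (real n) / real n powr (real n + 1 / 2)" for n :: nat
  have A_eq: "A n = exp (a n)" if "n > 0" for n
    using that by (simp add: A_def a_def powr_def exp_add exp_diff)
  have A: "A \<longlonglongrightarrow> exp c"
    by (rule Lim_transform_eventually[OF tendsto_exp[OF c]])
       (use A_eq in \<open>auto intro!: eventually_mono[OF eventually_gt_at_top[of 0]]\<close>)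
  have fact_eq: "fact n = A n * real n powr (real n + 1 / 2) * exp (- real n)" if "n > 0" for n
    using that by (simp add: A_def exp_minus)
  have wal: "(\<Prod>k=1..n. (4 * real k ^ 2) / (4 * real k ^ 2 - 1)) =
      2 ^ (4 * n) * fact n ^ 4 / (fact (2 * n) ^ 2 * (2 * real n + 1))" for n
  proof (induction n)
    case (Suc n)
    have "4 * (real (Suc n))\<^sup>2 - 1 = (2 * real n + 1) * (2 * real n + 3)"
      by (simp add: power2_eq_square algebra_simps)
    moreover have "fact (2 * Suc n) = (2 * real n + 2) * (2 * real n + 1) * fact (2 * n)"
      by (simp add: algebra_simps)
    moreover have "P * F ^ 4 / (G\<^sup>2 * a) * (4 * y\<^sup>2 / (a * b)) = 16 * P * (y * F) ^ 4 / ((2 * y * a * G)\<^sup>2 * b)"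
      if "y > 0" "a > 0" "b > 0" "G > 0" for P F G a b y :: real
      using that by (simp add: field_simps power2_eq_square power4_eq_xxxx)
    from this[of "real (Suc n)" "2 * real n + 1" "2 * real n + 3" "fact (2 * n)" "2 ^ (4 * n)" "fact n"]
    have "2 ^ (4 * n) * fact n ^ 4 / (fact (2 * n) ^ 2 * (2 * real n + 1)) *
       (4 * (real (Suc n))\<^sup>2 / ((2 * real n + 1) * (2 * real n + 3))) =
       16 * 2 ^ (4 * n) * (real (Suc n) * fact n) ^ 4 /
        ((2 * real (Suc n) * (2 * real n + 1) * fact (2 * n))\<^sup>2 * (2 * real n + 3))" by simp
    moreover have "(16::real) * 2 ^ (4 * n) = 2 ^ (4 * Suc n)" by (simp add: power_add)
    moreover have "real (Suc n) * fact n = fact (Suc n)" "2 * real (Suc n) = 2 * real n + 2"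
      "2 * real (Suc n) + 1 = 2 * real n + 3" by simp_all
    ultimately show ?case
      by (simp only: prod.nat_ivl_Suc'[OF le_add1[of 1 n, unfolded plus_1_eq_Suc]] Suc.IH mult.commute)
  qed simp
  \<comment> \<open>All powers of \<open>n\<close> and of \<open>e\<close> cancel except for a
    rational factor tending to 1/4, so the limit equation becomes
    \<open>exp c ^ 2 / 4 = pi / 2\<close>.\<close>
  have "eventually (\<lambda>n. (\<Prod>k=1..n. (4 * real k ^ 2) / (4 * real k ^ 2 - 1)) =
      A n ^ 4 / A (2 * n) ^ 2 * (real n / (2 * (2 * real n + 1)))) at_top"
    using eventually_gt_at_top[of 0]
  proof eventually_elim
    case (elim n)
    define x where "x = real n powr (real n + 1 / 2)"
    have x2: "x ^ 2 = real n ^ (2 * n + 1)"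
    proof -
      have "x ^ 2 = real n powr (2 * (real n + 1 / 2))"
        using elim by (simp add: x_def powr_power algebra_simps)
      also have "2 * (real n + 1 / 2) = real (2 * n + 1)" by simp
      finally show ?thesis using elim by (simp only: powr_realpow of_nat_0_less_iff)
    qed
    define y where "y = real (2 * n) powr (real (2 * n) + 1 / 2)"
    have y2: "y ^ 2 = (2 * real n) ^ (4 * n + 1)"
    proof -
      have "y ^ 2 = real (2 * n) powr (2 * (real (2 * n) + 1 / 2))"
        using elim by (simp add: y_def powr_power algebra_simps)
      also have "2 * (real (2 * n) + 1 / 2) = real (4 * n + 1)" by simp
      finally show ?thesis using elim by (simp only: powr_realpow of_nat_0_less_iff) simp
    qed
    have f1: "fact n = A n * x * exp (- real n)" using fact_eq[of n] elim by (simp add: x_def)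
    have f2: "fact (2 * n) = A (2 * n) * y * exp (- real (2 * n))"
      using fact_eq[of "2 * n"] elim by (simp add: y_def)
    have Apos: "A n > 0" "A (2 * n) > 0" using elim by (simp_all add: A_def)
    have e: "exp (- real n) ^ 4 = exp (- real (2 * n)) ^ 2"
      by (simp flip: exp_of_nat_mult)
    have "2 ^ (4 * n) * fact n ^ 4 / (fact (2 * n) ^ 2 * (2 * real n + 1)) =
      2 ^ (4 * n) * (A n ^ 4 * (x ^ 2) ^ 2) / (A (2 * n) ^ 2 * y ^ 2 * (2 * real n + 1))"
      unfolding f1 f2 power_mult_distrib e by (simp add: divide_simps flip: power_mult)
    also have "\<dots> = A n ^ 4 / A (2 * n) ^ 2 * (real n / (2 * (2 * real n + 1)))"
      unfolding x2 y2 using elim Apos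
      by (simp add: divide_simps power_mult_distrib power_add flip: power_mult)
         (simp add: power2_eq_square mult_ac)
    finally show ?case unfolding wal .
  qed
  then have "(\<lambda>n. A n ^ 4 / A (2 * n) ^ 2 * (real n / (2 * (2 * real n + 1)))) \<longlonglongrightarrow> pi / 2"
    by (rule Lim_transform_eventually[OF wallis])
  moreover have "(\<lambda>n. A n ^ 4 / A (2 * n) ^ 2 * (real n / (2 * (2 * real n + 1)))) \<longlonglongrightarrow>
     exp c ^ 4 / exp c ^ 2 * (1 / 4)"
  proof (rule tendsto_mult)
    have "(\<lambda>n. A (2 * n)) \<longlonglongrightarrow> exp c"
      by (rule filterlim_compose[OF A]) (rule mult_nat_left_at_top, simp)
    then show "(\<lambda>n. A n ^ 4 / A (2 * n) ^ 2) \<longlonglongrightarrow> exp c ^ 4 / exp c ^ 2"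
      by (intro tendsto_divide tendsto_power A) auto
    show "(\<lambda>n. real n / (2 * (2 * real n + 1))) \<longlonglongrightarrow> 1 / 4" by real_asymp
  qed
  ultimately have "exp c ^ 4 / exp c ^ 2 * (1 / 4) = pi / 2"
    using LIMSEQ_unique by blast
  then have "exp c ^ 2 = 2 * pi" by (simp add: power4_eq_xxxx power2_eq_square)
  moreover have "(\<lambda>n. A n ^ 2) \<longlonglongrightarrow> exp c ^ 2" by (intro tendsto_intros A)
  moreover have "eventually (\<lambda>n. A n ^ 2 = (fact n)\<^sup>2 * exp (2 * real n) / real n ^ (2 * n + 1)) at_top"
    using eventually_gt_at_top[of 0]
  proof eventually_elim
    case (elim n)
    have "(real n powr (real n + 1 / 2)) ^ 2 = real n powr (2 * (real n + 1 / 2))"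
      using elim by (simp add: powr_power algebra_simps)
    also have "2 * (real n + 1 / 2) = real (2 * n + 1)" by simp
    finally have "(real n powr (real n + 1 / 2)) ^ 2 = real n ^ (2 * n + 1)"
      using elim by (simp only: powr_realpow of_nat_0_less_iff)
    then show ?case by (simp add: A_def power_divide power_mult_distrib flip: exp_of_nat_mult)
  qed
  ultimately show ?thesis by (auto dest: Lim_transform_eventually)
qed

text \<open>A cone rather than a neighbourhood: it is closed under positive scaling, hence contains
  all points \<open>n t\<close>, and on it \<open>Re t\<close> is comparable to the modulus.\<close>

definition sector :: "complex set" where
  "sector = {t. 0 < Re t \<and> \<bar>Im t\<bar> \<le> Re t}"

lemma sector_norm_le: "t \<in> sector \<Longrightarrow> norm t \<le> 2 * Re t"
  using cmod_le[of t] by (auto simp: sector_def)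

lemma sector_mult_of_real: "t \<in> sector \<Longrightarrow> 0 < c \<Longrightarrow> of_real c * t \<in> sector"
  by (auto simp: sector_def abs_mult)

section \<open>The dilogarithm \<open>Li_2(exp (-x))\<close> on the right half plane\<close>

definition dilog_exp :: "complex \<Rightarrow> complex" where
  "dilog_exp x = (\<Sum>m. exp (- x) ^ Suc m / of_nat (Suc m) ^ 2)"

lemma inverse_square_Suc_summable: "summable (\<lambda>m. 1 / real (Suc m) ^ 2)"
  using inverse_squares_sums by (simp add: sums_iff add.commute)

lemma dilog_exp_summand_bound:
  "0 \<le> Re x \<Longrightarrow> norm (exp (- x) ^ Suc m / of_nat (Suc m) ^ 2) \<le> 1 / real (Suc m) ^ 2"
  by (simp add: norm_divide norm_power divide_right_mono power_le_one del: power_Suc of_nat_Suc)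

text \<open>The boundary is included because the value at 0 enters: it is the origin of the exponent
  \<open>pi^2/(3t)\<close> of the Euler product.\<close>

lemma continuous_on_dilog_exp: "continuous_on {x. 0 \<le> Re x} dilog_exp"
proof -
  have "uniform_limit {x. 0 \<le> Re x} (\<lambda>n x. \<Sum>m<n. exp (- x) ^ Suc m / of_nat (Suc m) ^ 2) dilog_exp sequentially"
    unfolding dilog_exp_def [abs_def]
    by (rule Weierstrass_m_test[OF _ inverse_square_Suc_summable]) (use dilog_exp_summand_bound in auto)
  then show ?thesis
    by (rule uniform_limit_theorem[rotated])
       (auto intro!: always_eventually continuous_intros simp: of_nat_Suc[symmetric] simp del: of_nat_Suc)
qed

lemma dilog_exp_0: "dilog_exp 0 = of_real (pi\<^sup>2 / 6)"
proof -
  have "(\<lambda>m. complex_of_real (1 / real (Suc m) ^ 2)) sums of_real (pi\<^sup>2 / 6)"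
    using inverse_squares_sums by (intro sums_of_real) (simp add: add.commute)
  then show ?thesis by (simp add: dilog_exp_def sums_iff)
qed

lemma norm_dilog_exp_le:
  assumes "0 < Re x"
  shows "norm (dilog_exp x) \<le> exp (- Re x) * (pi\<^sup>2 / 6)"
proof -
  have s: "(\<lambda>m. exp (- Re x) * (1 / real (Suc m) ^ 2)) sums (exp (- Re x) * (pi\<^sup>2 / 6))"
    using inverse_squares_sums by (intro sums_mult) (simp add: add.commute)
  have b: "norm (exp (- x) ^ Suc m / of_nat (Suc m) ^ 2) \<le> exp (- Re x) * (1 / real (Suc m) ^ 2)" for m
  proof -
    have "exp (- Re x) ^ m \<le> 1" using assms by (intro power_le_one) auto
    then have "exp (- Re x) ^ Suc m \<le> exp (- Re x)" by simp
    then show ?thesis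
      by (simp add: norm_divide norm_power divide_right_mono del: power_Suc of_nat_Suc)
  qed
  show ?thesis
    unfolding dilog_exp_def sums_unique[OF s] by (rule norm_suminf_le[OF b sums_summable[OF s]])
qed

lemma has_field_derivative_dilog_exp:
  assumes "0 < Re x"
  shows "(dilog_exp has_field_derivative Ln (1 - exp (- x))) (at x)"
proof -
  \<comment> \<open>Here \<open>f 0 = 1/0 = 0\<close>, so the power series may start at index
    0.\<close>
  define f :: "nat \<Rightarrow> complex" where "f m = 1 / of_nat m ^ 2" for m
  have cr: "conv_radius f \<ge> 1"
  proof (rule conv_radius_geI_ex)
    fix r :: real assume r: "0 < r" "ereal r < 1"
    have "summable (\<lambda>m. norm (f m * of_real r ^ m))"
    proof (rule summable_comparison_test')
      show "summable (\<lambda>m. r ^ m)" using r by (intro summable_geometric) auto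
      show "norm (norm (f m * of_real r ^ m)) \<le> r ^ m" if "m \<ge> 1" for m
      proof -
        have "1 / real m ^ 2 * r ^ m \<le> 1 * r ^ m" using that r by (intro mult_right_mono) auto
        then show ?thesis using r by (simp add: f_def norm_mult norm_divide norm_power)
      qed
    qed
    then have "summable (\<lambda>m. f m * of_real r ^ m)" by (rule summable_norm_cancel)
    then show "\<exists>z. norm z = r \<and> summable (\<lambda>n. f n * z ^ n)"
      using r by (intro exI[of _ "of_real r"]) auto
  qed
  define y where "y = exp (- x)"
  have y: "norm y < 1" "y \<noteq> 0" using assms by (auto simp: y_def)
  have P: "((\<lambda>z. \<Sum>n. f n * z ^ n) has_field_derivative (\<Sum>n. diffs f n * y ^ n)) (at y)"
    by (rule has_field_derivative_powser, rule less_le_trans[OF _ cr]) (use y in simp)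
  have "(\<lambda>n. - ((- (- y)) ^ n) / of_nat n) sums ln (1 + - y)"
    by (rule Ln_series') (use y in auto)
  then have "(\<lambda>n. - (y ^ Suc n) / of_nat (Suc n)) sums Ln (1 - y)"
    by (subst sums_Suc_iff) simp
  then have "(\<lambda>n. y ^ Suc n / of_nat (Suc n)) sums (- Ln (1 - y))"
    using sums_minus by fastforce
  then have "(\<lambda>n. (1 / y) * (y ^ Suc n / of_nat (Suc n))) sums ((1 / y) * (- Ln (1 - y)))"
    by (rule sums_mult)
  moreover have "(1 / y) * (y ^ Suc n / of_nat (Suc n)) = diffs f n * y ^ n" for n
    using y by (simp add: diffs_def f_def power2_eq_square divide_simps del: of_nat_Suc)
  ultimately have D: "(\<Sum>n. diffs f n * y ^ n) = - Ln (1 - y) / y"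
    by (simp add: sums_iff)
  have "((\<lambda>x. \<Sum>n. f n * exp (- x) ^ n) has_field_derivative (- Ln (1 - y) / y) * (- y)) (at x)"
    unfolding y_def
    by (rule DERIV_chain2[where f = "\<lambda>z. \<Sum>n. f n * z ^ n" and g = "\<lambda>x. exp (- x)", OF P[unfolded D, unfolded y_def]]) (auto intro!: derivative_eq_intros)
  moreover have "(\<Sum>n. f n * exp (- z) ^ n) = dilog_exp z" if "0 < Re z" for z
  proof -
    have "summable (\<lambda>n. f n * exp (- z) ^ n)"
      by (rule summable_in_conv_radius, rule less_le_trans[OF _ cr]) (use that in simp)
    from suminf_split_head[OF this] show ?thesis by (simp add: dilog_exp_def f_def)
  qed
  ultimately show ?thesis
    using y by (subst DERIV_cong_ev[OF refl _ refl, where g = "\<lambda>x. \<Sum>n. f n * exp (- x) ^ n"])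
      (auto simp: y_def intro!: eventually_mono[OF eventually_nhds_in_open[of "{z. 0 < Re z}"]]
         open_halfspace_Re_gt assms)
qed

lemma sector_Re_pos: "t \<in> sector \<Longrightarrow> 0 < Re t"
  by (simp add: sector_def)

lemma sector_nonzero: "t \<in> sector \<Longrightarrow> t \<noteq> 0"
  by (auto simp: sector_def)

lemma Re_one_minus_exp_pos: "0 < Re t \<Longrightarrow> 0 < Re (1 - exp (- t))"
proof -
  assume "0 < Re t"
  have "Re (exp (- t)) \<le> norm (exp (- t))" by (rule complex_Re_le_cmod)
  also have "\<dots> < 1" using \<open>0 < Re t\<close> by simp
  finally show ?thesis by simp
qed

lemma not_nonpos_Reals_if_Re_pos: "0 < Re z \<Longrightarrow> z \<notin> \<real>\<^sub>\<le>\<^sub>0"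
  by (auto simp: complex_nonpos_Reals_iff)

section \<open>Trapezoidal sums of the regularised logarithm\<close>

text \<open>
  The logarithm of the Euler product is a Riemann sum of \<open>Ln (1 - e\<^bsup>-x\<^esup>)\<close>. Removing the
  singular part \<open>Ln x\<close>, which Stirling's formula sums, leaves the function \<open>lratio\<close> below; its
  trapezoidal sums are accurate up to \<open>o(1)\<close>, and its antiderivative is a dilogarithm.
\<close>
definition lratio :: "complex \<Rightarrow> complex" where
  "lratio x = Ln (1 - exp (- x)) - Ln x"

definition lratio_int :: "complex \<Rightarrow> complex" where
  "lratio_int x = dilog_exp x - x * Ln x + x"

definition lratio' :: "complex \<Rightarrow> complex" where
  "lratio' x = 1 / (exp x - 1) - 1 / x"

definition lratio'' :: "complex \<Rightarrow> complex" where
  "lratio'' x = 1 / x\<^sup>2 - exp x / (exp x - 1)\<^sup>2"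

lemma exp_neq_1_if_Re_pos: "0 < Re x \<Longrightarrow> exp x \<noteq> 1"
  by (metis exp_eq_1 order_less_irrefl)

lemma has_field_derivative_lratio_int:
  assumes "0 < Re x"
  shows "(lratio_int has_field_derivative lratio x) (at x)"
proof -
  have "x \<noteq> 0" using assms by auto
  then show ?thesis unfolding lratio_int_def [abs_def] lratio_def
    by (auto intro!: derivative_eq_intros has_field_derivative_dilog_exp not_nonpos_Reals_if_Re_pos assms)
qed

lemma has_field_derivative_lratio:
  assumes "0 < Re x"
  shows "(lratio has_field_derivative lratio' x) (at x)"
proof -
  have [simp]: "x \<noteq> 0" "exp x \<noteq> 1" "exp x - 1 \<noteq> 0" using assms exp_neq_1_if_Re_pos[OF assms] by auto
  have "exp (- x) / (1 - exp (- x)) = 1 / (exp x - 1)"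
    by (simp add: exp_minus field_simps)
  then show ?thesis unfolding lratio_def [abs_def] lratio'_def
    by (auto intro!: derivative_eq_intros not_nonpos_Reals_if_Re_pos Re_one_minus_exp_pos assms
        simp: divide_inverse mult.commute)
qed

lemma has_field_derivative_lratio':
  assumes "0 < Re x"
  shows "(lratio' has_field_derivative lratio'' x) (at x)"
proof -
  have [simp]: "x \<noteq> 0" "exp x - 1 \<noteq> 0" using assms exp_neq_1_if_Re_pos[OF assms] by auto
  show ?thesis unfolding lratio'_def [abs_def] lratio''_def
    unfolding divide_inverse mult_1_left
    using exp_neq_1_if_Re_pos[OF assms] by (auto intro!: derivative_eq_intros simp: power2_eq_square)
qed

lemma norm_exp_minus_one_ge: "x \<in> sector \<Longrightarrow> norm x / 2 \<le> norm (exp x - 1)"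
proof -
  assume x: "x \<in> sector"
  have "norm x / 2 \<le> Re x" using sector_norm_le[OF x] by simp
  also have "\<dots> \<le> exp (Re x) - 1" using exp_ge_add_one_self[of "Re x"] by linarith
  also have "\<dots> = norm (exp x) - norm (1::complex)" by simp
  also have "\<dots> \<le> norm (exp x - 1)" by (rule norm_triangle_ineq2)
  finally show ?thesis .
qed

text \<open>The proof bounds the function by a multiple of \<open>1/|x|\<close> near 0 and of
  \<open>1/|x|^2\<close> for large \<open>x\<close>. An exponent strictly between -2 and -1 serves
  both ranges: below -1 so that the values at the points \<open>n t\<close> are summable over
  \<open>n\<close>, above -2 so that a positive power of \<open>t\<close> is left over.\<close>

lemma norm_lratio''_le:
  assumes x: "x \<in> sector"
  shows "norm (lratio'' x) \<le> 100 * norm x powr (-3/2)"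
proof (cases "norm x \<le> 1")
  case True
  have x0: "x \<noteq> 0" "exp x - 1 \<noteq> 0"
    using sector_nonzero[OF x] exp_neq_1_if_Re_pos[OF sector_Re_pos[OF x]] by auto
  have e: "exp \<bar>Re x\<bar> \<le> 3"
  proof -
    have "\<bar>Re x\<bar> \<le> 1" using True abs_Re_le_cmod[of x] by linarith
    then have "exp \<bar>Re x\<bar> \<le> exp 1" by simp
    then show ?thesis using exp_le by linarith
  qed
  have "norm (exp x - (\<Sum>k\<le>1. x ^ k / fact k)) \<le> exp \<bar>Re x\<bar> * norm x ^ Suc 1 / fact 1"
    by (rule Taylor_exp)
  also have "\<dots> \<le> 3 * norm x ^ 2" using e by (simp add: power2_eq_square mult_right_mono)
  finally have b1: "norm (exp x - 1 - x) \<le> 3 * norm x ^ 2" by (simp add: diff_diff_eq)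
  have "norm (exp x - (\<Sum>k\<le>0. x ^ k / fact k)) \<le> exp \<bar>Re x\<bar> * norm x ^ Suc 0 / fact 0"
    by (rule Taylor_exp)
  also have "\<dots> \<le> 3 * norm x" using e by (simp add: mult_right_mono)
  finally have b2: "norm (exp x - 1) \<le> 3 * norm x" by simp
  \<comment> \<open>A difference of squares is split off; both terms are then visibly of third order
    in \<open>x\<close>.\<close>
  have "norm ((exp x - 1)\<^sup>2 - x\<^sup>2 * exp x) = norm ((exp x - 1 - x) * (exp x - 1 + x) - x\<^sup>2 * (exp x - 1))"
    by (simp add: power2_eq_square algebra_simps)
  also have "\<dots> \<le> norm (exp x - 1 - x) * norm (exp x - 1 + x) + norm x ^ 2 * norm (exp x - 1)"
    by (rule norm_triangle_le_diff) (simp add: norm_mult norm_power)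
  also have "\<dots> \<le> (3 * norm x ^ 2) * (3 * norm x + norm x) + norm x ^ 2 * (3 * norm x)"
    using b1 b2 by (intro add_mono mult_mono norm_triangle_le) auto
  also have "\<dots> = 15 * norm x ^ 3" by (simp add: power2_eq_square power3_eq_cube)
  finally have num: "norm ((exp x - 1)\<^sup>2 - x\<^sup>2 * exp x) \<le> 15 * norm x ^ 3" .
  have "lratio'' x = ((exp x - 1)\<^sup>2 - x\<^sup>2 * exp x) / (x\<^sup>2 * (exp x - 1)\<^sup>2)"
    using x0 by (simp add: lratio''_def field_simps)
  then have "norm (lratio'' x) = norm ((exp x - 1)\<^sup>2 - x\<^sup>2 * exp x) / (norm x ^ 2 * norm (exp x - 1) ^ 2)"
    by (simp add: norm_divide norm_mult norm_power)
  also have "\<dots> \<le> 15 * norm x ^ 3 / (norm x ^ 2 * (norm x / 2) ^ 2)"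
    using num norm_exp_minus_one_ge[OF x] x0
    by (intro frac_le mult_left_mono power_mono) auto
  also have "\<dots> = 60 * (1 / norm x)" using x0 by (simp add: field_simps power2_eq_square power3_eq_cube)
  also have "1 / norm x = norm x powr (-1)" using x0 by (simp add: powr_minus_divide)
  also have "norm x powr (-1) \<le> norm x powr (-3/2)"
    using True x0 by (intro powr_mono') auto
  finally show ?thesis using powr_ge_zero[of "norm x" "-3/2"] by linarith
next
  case False
  have a: "0 < Re x" "norm x / 2 \<le> Re x" using sector_norm_le[OF x] sector_Re_pos[OF x] by auto
  have "norm (exp x / (exp x - 1)\<^sup>2) \<le> exp (Re x) / (exp (Re x) - 1)\<^sup>2"
  proof -
    have "exp (Re x) - 1 \<le> norm (exp x - 1)"
      using norm_triangle_ineq2[of "exp x" 1] by simp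
    then show ?thesis using a
      by (auto simp: norm_divide norm_power intro!: frac_le power_mono)
  qed
  also have "\<dots> = exp (- Re x) / (1 - exp (- Re x))\<^sup>2"
    using a by (simp add: exp_minus field_simps power2_eq_square)
  also have "\<dots> \<le> 1 / (Re x)\<^sup>2" by (rule exp_over_square_le) (rule a)
  also have "\<dots> \<le> 1 / (norm x / 2)\<^sup>2" using a False by (intro frac_le power_mono) auto
  finally have "norm (exp x / (exp x - 1)\<^sup>2) \<le> 4 / norm x ^ 2" by (simp add: power2_eq_square)
  then have "norm (lratio'' x) \<le> 5 * (1 / norm x ^ 2)"
    unfolding lratio''_def by (intro norm_triangle_le_diff) (simp add: norm_divide norm_power)
  also have "1 / norm x ^ 2 = norm x powr (-2)"
    using False by (simp add: powr_minus_divide powr_numeral)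
  also have "norm x powr (-2) \<le> norm x powr (-3/2)" using False by (intro powr_mono) auto
  finally show ?thesis using powr_ge_zero[of "norm x" "-3/2"] by linarith
qed

text \<open>Taylor expansion of \<open>F\<close> to third and of \<open>f\<close> to second order at
  \<open>a\<close>: the lower terms cancel in the trapezoidal rule, and the two remainders
  contribute one half of the bound each.\<close>

lemma trapezoid_error:
  fixes f F f' f'' :: "complex \<Rightarrow> complex"
  assumes F: "\<And>x. x \<in> closed_segment a b \<Longrightarrow> (F has_field_derivative f x) (at x)"
    and f: "\<And>x. x \<in> closed_segment a b \<Longrightarrow> (f has_field_derivative f' x) (at x)"
    and f': "\<And>x. x \<in> closed_segment a b \<Longrightarrow> (f' has_field_derivative f'' x) (at x)"
    and B: "\<And>x. x \<in> closed_segment a b \<Longrightarrow> norm (f'' x) \<le> B"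
  shows "norm ((f a + f b) / 2 * (b - a) - (F b - F a)) \<le> B * norm (b - a) ^ 3"
proof -
  define d where "d = b - a"
  define S where "S = closed_segment a b"
  have S: "convex S" "a \<in> S" "b \<in> S" by (auto simp: S_def)
  define g where "g i = (if i = 0 then F else if i = 1 then f else if i = 2 then f' else f'')" for i :: nat
  define h where "h i = (if i = 0 then f else if i = 1 then f' else f'')" for i :: nat
  have 1: "norm (g 0 b - (\<Sum>i\<le>2. g i a * (b - a) ^ i / fact i)) \<le> B * norm (b - a) ^ Suc 2 / fact 2"
  proof (rule complex_Taylor[OF S(1)])
    fix i x assume "x \<in> S" "i \<le> (2::nat)"
    then have "i = 0 \<or> i = 1 \<or> i = 2" "x \<in> closed_segment a b" by (auto simp: S_def)
    then show "(g i has_field_derivative g (Suc i) x) (at x within S)"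
      using F f f' by (auto simp: g_def numeral_2_eq_2 intro: has_field_derivative_at_within)
  qed (use S B in \<open>auto simp: g_def S_def\<close>)
  have 2: "norm (h 0 b - (\<Sum>i\<le>1. h i a * (b - a) ^ i / fact i)) \<le> B * norm (b - a) ^ Suc 1 / fact 1"
  proof (rule complex_Taylor[OF S(1)])
    fix i x assume "x \<in> S" "i \<le> (1::nat)"
    then have "i = 0 \<or> i = 1" "x \<in> closed_segment a b" by (auto simp: S_def)
    then show "(h i has_field_derivative h (Suc i) x) (at x within S)"
      using f f' by (auto simp: h_def intro: has_field_derivative_at_within)
  qed (use S B in \<open>auto simp: h_def S_def\<close>)
  have 1: "norm (F b - (F a + f a * d + f' a * d\<^sup>2 / 2)) \<le> B * norm d ^ 3 / 2"
    using 1 by (simp add: g_def d_def numeral_2_eq_2 numeral_3_eq_3)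
  have 2: "norm (f b - (f a + f' a * d)) \<le> B * norm d ^ 2"
    using 2 by (simp add: h_def d_def numeral_2_eq_2)
  have "(f a + f b) / 2 * d - (F b - F a) =
      (f b - (f a + f' a * d)) * d / 2 - (F b - (F a + f a * d + f' a * d\<^sup>2 / 2))"
    by (simp add: field_simps power2_eq_square)
  also have "norm \<dots> \<le> norm ((f b - (f a + f' a * d)) * d / 2) + norm (F b - (F a + f a * d + f' a * d\<^sup>2 / 2))"
    by (rule norm_triangle_ineq4)
  also have "\<dots> \<le> B * norm d ^ 2 * norm d / 2 + B * norm d ^ 3 / 2"
    using 1 mult_right_mono[OF 2, of "norm d"] by (simp add: norm_mult norm_divide)
  finally show ?thesis by (simp add: d_def power2_eq_square power3_eq_cube field_simps)
qed

definition euler :: "complex \<Rightarrow> complex" where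
  "euler q = (\<Prod>j. 1 - q ^ Suc j)"

lemma qpoch_eq_prod_lessThan: "qpoch n q = (\<Prod>j<n. 1 - q ^ Suc j)"
  unfolding qpoch_def by (simp add: prod.atLeast1_atMost_eq)

lemma one_minus_power_nonzero:
  fixes q :: complex
  assumes "norm q < 1" "1 \<le> j"
  shows "1 - q ^ j \<noteq> 0"
proof
  assume "1 - q ^ j = 0"
  then have "norm q ^ j = 1" by (metis eq_iff_diff_eq_0 norm_one norm_power)
  moreover have "norm q ^ j \<le> norm q ^ 1" using assms by (intro power_decreasing) auto
  ultimately show False using assms by simp
qed

lemma euler_facts:
  assumes "norm q < 1"
  shows qpoch_LIMSEQ: "(\<lambda>n. qpoch n q) \<longlonglongrightarrow> euler q" and euler_nonzero: "euler q \<noteq> 0"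
proof -
  have "summable (\<lambda>j. norm ((1 - q ^ Suc j) - 1))"
    using summable_geometric[of "norm q"] assms
    by (subst summable_Suc_iff[where f = "\<lambda>j. norm ((1 - q ^ j) - 1)"]) (simp add: norm_power)
  then have conv: "convergent_prod (\<lambda>j. 1 - q ^ Suc j)"
    by (intro abs_convergent_prod_imp_convergent_prod) (simp add: abs_convergent_prod_conv_summable)
  have nz: "1 - q ^ Suc j \<noteq> 0" for j using one_minus_power_nonzero[OF assms, of "Suc j"] by simp
  show "euler q \<noteq> 0" unfolding euler_def using nz conv by (intro prodinf_nonzero) auto
  have "(\<lambda>n. \<Prod>j\<le>n. 1 - q ^ Suc j) \<longlonglongrightarrow> euler q"
    unfolding euler_def by (rule convergent_prod_LIMSEQ[OF conv])
  then have "(\<lambda>n. qpoch (Suc n) q) \<longlonglongrightarrow> euler q"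
    by (simp add: qpoch_eq_prod_lessThan lessThan_Suc_atMost del: power_Suc prod.lessThan_Suc)
  then show "(\<lambda>n. qpoch n q) \<longlonglongrightarrow> euler q" by (rule LIMSEQ_imp_Suc)
qed

lemma exp_lratio:
  assumes "0 < Re x"
  shows "exp (lratio x) = (1 - exp (- x)) / x"
proof -
  have "x \<noteq> 0" "1 - exp (- x) \<noteq> 0" using assms Re_one_minus_exp_pos[OF assms] by auto
  then show ?thesis by (simp add: lratio_def exp_diff)
qed

definition lratio_err :: "complex \<Rightarrow> nat \<Rightarrow> complex" where
  "lratio_err t N = (\<Sum>n=1..<N. (lratio (of_nat n * t) + lratio (of_nat (Suc n) * t)) / 2
      - (lratio_int (of_nat (Suc n) * t) - lratio_int (of_nat n * t)) / t)"

text \<open>The trapezoidal errors collect half of each endpoint of every step, while the values of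
  the antiderivative \<open>lratio_int\<close> telescope.\<close>

lemma sum_lratio_eq:
  assumes "1 \<le> N"
  shows "(\<Sum>n=1..N. lratio (of_nat n * t)) =
    lratio_err t N + (lratio t + lratio (of_nat N * t)) / 2 + (lratio_int (of_nat N * t) - lratio_int t) / t"
  using assms
proof (induction N rule: dec_induct)
  case base
  show ?case by (simp add: lratio_err_def)
next
  case (step N)
  have "lratio_err t (Suc N) = lratio_err t N + ((lratio (of_nat N * t) + lratio (of_nat (Suc N) * t)) / 2
      - (lratio_int (of_nat (Suc N) * t) - lratio_int (of_nat N * t)) / t)"
    using step by (simp add: lratio_err_def del: of_nat_Suc)
  then show ?case using step
    by (simp add: diff_divide_distrib add_divide_distrib del: of_nat_Suc)
qed

lemma summable_powr_three_halves: "summable (\<lambda>n. real n powr (-3/2))"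
  using summable_real_powr_iff[of "-3/2"] by simp

text \<open>Up to a constant a step contributes
  \<open>|t|^2 (n |t|)^(-3/2) = |t|^(1/2) n^(-3/2)\<close>, which is summable in \<open>n\<close>;
  the bound is therefore uniform in \<open>N\<close> and tends to 0 with \<open>t\<close>.\<close>

lemma norm_lratio_err_le:
  assumes t: "t \<in> sector"
  shows "norm (lratio_err t N) \<le> 100 * (\<Sum>n. real n powr (-3/2)) * sqrt (norm t)"
proof -
  have t0: "t \<noteq> 0" by (rule sector_nonzero[OF t])
  have trm: "norm ((lratio (of_nat n * t) + lratio (of_nat (Suc n) * t)) / 2
      - (lratio_int (of_nat (Suc n) * t) - lratio_int (of_nat n * t)) / t) \<le> 100 * sqrt (norm t) * real n powr (-3/2)"
    if n: "n \<ge> 1" for n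
  proof -
    let ?a = "of_nat n * t" and ?b = "of_nat (Suc n) * t"
    have seg: "x \<in> sector \<and> real n * norm t \<le> norm x" if x: "x \<in> closed_segment ?a ?b" for x
    proof -
      from x obtain u where u: "0 \<le> u" "u \<le> 1" "x = (1 - u) *\<^sub>R ?a + u *\<^sub>R ?b"
        by (auto simp: closed_segment_def)
      then have x_eq: "x = of_real (real n + u) * t"
        by (simp add: scaleR_conv_of_real algebra_simps)
      have "norm x = (real n + u) * norm t" unfolding x_eq using u by (simp add: norm_mult del: of_real_add)
      moreover have "real n * norm t \<le> (real n + u) * norm t" using u by (intro mult_right_mono) auto
      moreover have "x \<in> sector" unfolding x_eq by (rule sector_mult_of_real[OF t]) (use n u in auto)
      ultimately show ?thesis by simp
    qed
    have ba: "?b - ?a = t" by (simp add: algebra_simps)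
    have "norm ((lratio ?a + lratio ?b) / 2 * (?b - ?a) - (lratio_int ?b - lratio_int ?a))
      \<le> 100 * (real n * norm t) powr (-3/2) * norm (?b - ?a) ^ 3"
    proof (rule trapezoid_error[where f' = lratio' and f'' = lratio''])
      fix x assume x: "x \<in> closed_segment ?a ?b"
      note xs = seg[OF x]
      show "(lratio_int has_field_derivative lratio x) (at x)" "(lratio has_field_derivative lratio' x) (at x)"
        "(lratio' has_field_derivative lratio'' x) (at x)"
        using xs sector_Re_pos has_field_derivative_lratio_int has_field_derivative_lratio has_field_derivative_lratio'
        by auto
      have "norm (lratio'' x) \<le> 100 * norm x powr (-3/2)" using xs norm_lratio''_le by simp
      also have "\<dots> \<le> 100 * (real n * norm t) powr (-3/2)"
        using xs n t0 by (intro mult_left_mono powr_mono2') auto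
      finally show "norm (lratio'' x) \<le> 100 * (real n * norm t) powr (-3/2)" .
    qed
    then have *: "norm ((lratio ?a + lratio ?b) / 2 * t - (lratio_int ?b - lratio_int ?a))
      \<le> 100 * (real n * norm t) powr (-3/2) * norm t ^ 3" unfolding ba .
    have "(lratio ?a + lratio ?b) / 2 - (lratio_int ?b - lratio_int ?a) / t =
       ((lratio ?a + lratio ?b) / 2 * t - (lratio_int ?b - lratio_int ?a)) / t"
      using t0 by (simp add: diff_divide_distrib)
    also have "norm \<dots> \<le> 100 * (real n * norm t) powr (-3/2) * norm t ^ 3 / norm t"
      unfolding norm_divide using * by (rule divide_right_mono) simp
    also have "\<dots> = 100 * (norm t powr (-3/2) * norm t ^ 2) * real n powr (-3/2)"
      using t0 by (simp add: powr_mult power2_eq_square power3_eq_cube)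
    also have "norm t powr (-3/2) * norm t ^ 2 = sqrt (norm t)"
    proof -
      have "norm t ^ 2 = norm t powr 2" using t0 by (simp add: powr_numeral)
      then have "norm t powr (-3/2) * norm t ^ 2 = norm t powr (-3/2 + 2)" by (simp only: powr_add)
      then show ?thesis by (simp add: powr_half_sqrt)
    qed
    finally show ?thesis by (simp add: mult_ac)
  qed
  have "norm (lratio_err t N) \<le> (\<Sum>n=1..<N. 100 * sqrt (norm t) * real n powr (-3/2))"
    unfolding lratio_err_def by (rule sum_norm_le) (use trm in auto)
  also have "\<dots> = 100 * sqrt (norm t) * (\<Sum>n=1..<N. real n powr (-3/2))"
    by (simp add: sum_distrib_left)
  also have "\<dots> \<le> 100 * sqrt (norm t) * (\<Sum>n. real n powr (-3/2))"
    by (intro mult_left_mono sum_le_suminf summable_powr_three_halves) auto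
  finally show ?thesis by (simp add: mult_ac)
qed

text \<open>Each factor \<open>1 - q^n\<close> is \<open>n t exp (lratio (n t))\<close>. Squaring
  turns the half endpoint terms of the trapezoidal rule into whole ones, which exponentiate to
  \<open>(1 - exp (-x)) / x\<close> without square roots. The formula is exact; its factors are
  grouped by their behaviour for growing \<open>N\<close>.\<close>

lemma qpoch_square_eq:
  assumes t: "t \<in> sector" and N: "1 \<le> N"
  shows "(qpoch N (exp (- t)))\<^sup>2 = of_real ((fact N)\<^sup>2 * exp (2 * real N) / real N ^ (2 * N + 1)) *
     (1 - exp (- (of_nat N * t))) * exp (2 * dilog_exp (of_nat N * t) / t) *
     ((1 - exp (- t)) / t\<^sup>2) * exp (2 * lratio_err t N) * exp (- (2 * lratio_int t / t))"
proof -
  have t0: "t \<noteq> 0" and tpos: "0 < Re t" using t by (auto simp: sector_def)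
  define M :: complex where "M = of_nat N"
  have M: "M \<noteq> 0" "0 < Re (M * t)" "M * t \<noteq> 0" using N t0 tpos by (auto simp: M_def)
  have nt: "0 < Re (of_nat n * t)" if "n \<ge> 1" for n using that tpos by simp
  have "qpoch N (exp (- t)) = (\<Prod>n=1..N. of_nat n * t * exp (lratio (of_nat n * t)))"
    unfolding qpoch_def
  proof (intro prod.cong refl)
    fix n assume n: "n \<in> {1..N}"
    then have "of_nat n * t \<noteq> 0" using t0 by auto
    moreover have "exp (- t) ^ n = exp (- (of_nat n * t))" by (simp flip: exp_of_nat_mult)
    ultimately show "1 - exp (- t) ^ n = of_nat n * t * exp (lratio (of_nat n * t))"
      using exp_lratio[OF nt[of n]] n by simp
  qed
  also have "\<dots> = fact N * t ^ N * exp (\<Sum>n=1..N. lratio (of_nat n * t))"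
    by (simp add: prod.distrib exp_sum fact_prod)
  finally have "(qpoch N (exp (- t)))\<^sup>2 = (fact N)\<^sup>2 * t ^ (2 * N) * exp (2 * (\<Sum>n=1..N. lratio (of_nat n * t)))"
    by (simp only: power_mult_distrib exp_double power_even_eq)
  also have "2 * (\<Sum>n=1..N. lratio (of_nat n * t)) =
      2 * lratio_err t N + lratio t + lratio (M * t) + 2 * lratio_int (M * t) / t - 2 * lratio_int t / t"
    unfolding sum_lratio_eq[OF N] M_def by (simp add: algebra_simps diff_divide_distrib)
  also have "exp \<dots> = exp (2 * lratio_err t N) * ((1 - exp (- t)) / t) * ((1 - exp (- (M * t))) / (M * t)) *
      exp (2 * lratio_int (M * t) / t) * exp (- (2 * lratio_int t / t))"
    using exp_lratio[OF tpos] exp_lratio[OF M(2)] by (simp only: exp_add exp_diff exp_minus divide_inverse)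
  \<comment> \<open>The logarithmic part of \<open>lratio_int\<close> yields
    \<open>(N t)^(-2N)\<close>, an integer power free of branches, which removes
    \<open>t^(2N)\<close> and completes \<open>(fact N)^2\<close> to Stirling's quotient.\<close>
  also have "exp (2 * lratio_int (M * t) / t) =
      exp (2 * dilog_exp (M * t) / t) * exp (2 * of_real (real N)) / (M * t) ^ (2 * N)"
  proof -
    have "2 * lratio_int (M * t) / t = 2 * dilog_exp (M * t) / t + 2 * M - of_nat (2 * N) * Ln (M * t)"
      using t0 by (simp add: lratio_int_def M_def add_divide_distrib diff_divide_distrib ring_distribs)
    also have "exp \<dots> = exp (2 * dilog_exp (M * t) / t) * exp (2 * M) / exp (Ln (M * t)) ^ (2 * N)"
      by (simp only: exp_add exp_diff exp_of_nat_mult)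
    also have "exp (Ln (M * t)) = M * t" using M(3) by simp
    finally show ?thesis by (simp add: M_def)
  qed
  finally have qpoch_eq: "(qpoch N (exp (- t)))\<^sup>2 = (fact N)\<^sup>2 * t ^ (2 * N) *
      (exp (2 * lratio_err t N) * ((1 - exp (- t)) / t) * ((1 - exp (- (M * t))) / (M * t)) *
      (exp (2 * dilog_exp (M * t) / t) * exp (2 * of_real (real N)) / (M ^ (2 * N) * t ^ (2 * N))) *
      exp (- (2 * lratio_int t / t)))"
    by (simp only: power_mult_distrib)
  have key: "K * T * (E * (a / t) * (b / (M * t)) * (L * X / (m * T)) * P) =
      K * X / (m * M) * b * L * (a / t\<^sup>2) * E * P" if "T \<noteq> 0" for K T E a b L X m P :: complex
    using that t0 by (simp add: power2_eq_square mult_ac)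
  have st_eq: "complex_of_real ((fact N)\<^sup>2 * exp (2 * real N) / real N ^ (2 * N + 1)) =
      (fact N)\<^sup>2 * exp (2 * of_real (real N)) / (M ^ (2 * N) * M)"
    by (simp add: M_def exp_of_real[symmetric] mult.commute)
  have "t ^ (2 * N) \<noteq> 0" using t0 by simp
  then show ?thesis unfolding M_def[symmetric] st_eq qpoch_eq by (rule key)
qed

lemma one_minus_exp_over_tendsto: "((\<lambda>x::complex. (1 - exp (- x)) / x) \<longlongrightarrow> 1) (at 0 within S)"
proof -
  have "((\<lambda>x::complex. 1 - exp (- x)) has_field_derivative 1) (at 0)"
    by (auto intro!: derivative_eq_intros)
  then have "((\<lambda>x::complex. (1 - exp (- x)) / x) \<longlongrightarrow> 1) (at 0)" by (simp add: has_field_derivative_iff)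
  then show ?thesis by (rule tendsto_within_subset) auto
qed

text \<open>The principal logarithm of the quotient is the difference of the logarithms, since in
  the right half plane both imaginary parts are below \<open>pi/2\<close> in modulus.\<close>

lemma lratio_tendsto_0: "(lratio \<longlongrightarrow> 0) (at 0 within sector)"
proof -
  have "((\<lambda>x. Ln ((1 - exp (- x)) / x)) \<longlongrightarrow> Ln 1) (at 0 within sector)"
    by (rule tendsto_Ln[OF one_minus_exp_over_tendsto]) auto
  moreover have "eventually (\<lambda>x. Ln ((1 - exp (- x)) / x) = lratio x) (at 0 within sector)"
    unfolding eventually_at_filter
  proof (rule always_eventually, safe)
    fix x assume x: "x \<in> sector"
    have 1: "0 < Re x" "0 < Re (1 - exp (- x))" using sector_Re_pos[OF x] Re_one_minus_exp_pos by auto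
    then have 2: "x \<noteq> 0" "1 - exp (- x) \<noteq> 0" by auto
    have im: "\<bar>Im (Ln x)\<bar> < pi / 2" "\<bar>Im (Ln (1 - exp (- x)))\<bar> < pi / 2"
      using Re_Ln_pos_lt[OF 2(1)] Re_Ln_pos_lt[OF 2(2)] 1 by auto
    have inv: "Ln (inverse x) = - Ln x"
      by (rule Ln_inverse) (use 1 not_nonpos_Reals_if_Re_pos in auto)
    have "Ln ((1 - exp (- x)) * inverse x) = Ln (1 - exp (- x)) + Ln (inverse x)"
      by (rule Ln_times_simple) (use 2 im in \<open>auto simp: inv\<close>)
    then show "Ln ((1 - exp (- x)) / x) = lratio x" by (simp add: lratio_def inv divide_inverse)
  qed
  ultimately show ?thesis by (auto dest: Lim_transform_eventually)
qed

text \<open>Along a ray \<open>Ln (c t) = ln c + Ln t\<close>, which reduces the singular term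
  \<open>x * Ln x\<close> to the real limit of \<open>c * ln c\<close>.\<close>

lemma lratio_int_tendsto_scaled:
  assumes t: "t \<in> sector"
  shows "(\<lambda>n. lratio_int (of_real (1 / real (Suc n)) * t)) \<longlonglongrightarrow> of_real (pi\<^sup>2 / 6)"
proof -
  have t0: "t \<noteq> 0" and tpos: "0 < Re t" using t by (auto simp: sector_def)
  define c where "c n = 1 / real (Suc n)" for n
  have c0: "c \<longlonglongrightarrow> 0" unfolding c_def [abs_def] by real_asymp
  have cpos: "c n > 0" for n by (simp add: c_def)
  have ct: "(\<lambda>n. of_real (c n) * t) \<longlonglongrightarrow> 0"
    using tendsto_mult_right[OF tendsto_of_real[OF c0], of t] by simp
  have "(\<lambda>n. dilog_exp (of_real (c n) * t)) \<longlonglongrightarrow> dilog_exp 0"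
    by (rule continuous_on_tendsto_compose[OF continuous_on_dilog_exp ct])
       (use tpos cpos in \<open>auto intro!: always_eventually less_imp_le\<close>)
  moreover have "(\<lambda>n. of_real (c n) * t * Ln (of_real (c n) * t)) \<longlonglongrightarrow> 0"
  proof -
    have "Ln (of_real (c n) * t) = of_real (ln (c n)) + Ln t" for n
      using cpos[of n] t0 by (simp add: Ln_times_of_real Ln_of_real)
    moreover have "(\<lambda>n. of_real (c n * ln (c n)) * t + of_real (c n) * (t * Ln t)) \<longlonglongrightarrow> of_real 0 * t + of_real 0 * (t * Ln t)"
    proof (intro tendsto_intros c0)
      show "(\<lambda>n. c n * ln (c n)) \<longlonglongrightarrow> 0" unfolding c_def [abs_def] by real_asymp
    qed
    ultimately show ?thesis by (simp add: algebra_simps)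
  qed
  ultimately have "(\<lambda>n. lratio_int (of_real (c n) * t)) \<longlonglongrightarrow> dilog_exp 0 - 0 + 0"
    unfolding lratio_int_def by (intro tendsto_intros ct)
  then show ?thesis by (simp add: c_def dilog_exp_0)
qed

text \<open>Integrating \<open>lratio\<close>, which tends to 0, along the ray from 0 to
  \<open>t\<close> gives an error \<open>o(t)\<close>; in the exponent, divided by \<open>t\<close>,
  it disappears.\<close>

lemma lratio_int_remainder_tendsto:
  "((\<lambda>t. (lratio_int t - of_real (pi\<^sup>2 / 6)) / t) \<longlongrightarrow> 0) (at 0 within sector)"
proof (rule tendstoI)
  fix e :: real assume e: "0 < e"
  have "eventually (\<lambda>x. dist (lratio x) 0 < e / 2) (at 0 within sector)"
    using lratio_tendsto_0 e by (intro tendstoD) auto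
  then obtain d where d: "d > 0" "\<And>x. x \<in> sector \<Longrightarrow> norm x < d \<Longrightarrow> norm (lratio x) < e / 2"
    unfolding eventually_at by (auto dest: sector_nonzero)
  have "norm (lratio_int t - of_real (pi\<^sup>2 / 6)) \<le> e / 2 * norm t" if t: "t \<in> sector" "norm t < d" for t
  proof (rule tendsto_upperbound)
    show "(\<lambda>n. norm (lratio_int t - lratio_int (of_real (1 / real (Suc n)) * t))) \<longlonglongrightarrow> norm (lratio_int t - of_real (pi\<^sup>2 / 6))"
      by (intro tendsto_intros lratio_int_tendsto_scaled t)
    show "eventually (\<lambda>n. norm (lratio_int t - lratio_int (of_real (1 / real (Suc n)) * t)) \<le> e / 2 * norm t) sequentially"
    proof (rule always_eventually, rule allI)
      fix n
      define c where "c = 1 / real (Suc n)"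
      have c: "0 < c" "c \<le> 1" by (auto simp: c_def)
      let ?S = "closed_segment (of_real c * t) t"
      have seg: "x \<in> sector \<and> norm x \<le> norm t" if x: "x \<in> ?S" for x
      proof -
        from x obtain u where u: "0 \<le> u" "u \<le> 1" "x = (1 - u) *\<^sub>R (of_real c * t) + u *\<^sub>R t"
          by (auto simp: closed_segment_def)
        define v where "v = (1 - u) * c + u"
        have v: "0 < v" "v \<le> 1"
        proof -
          show "0 < v" using u c by (cases "u = 0") (auto simp: v_def intro: add_nonneg_pos)
          have "(1 - u) * c \<le> (1 - u) * 1" using u c by (intro mult_left_mono) auto
          then show "v \<le> 1" by (simp add: v_def)
        qed
        have xv: "x = of_real v * t" using u(3) by (simp add: v_def scaleR_conv_of_real algebra_simps)
        have "norm x = v * norm t" using v by (simp add: xv norm_mult)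
        then have "norm x \<le> norm t" using v mult_right_mono[of v 1 "norm t"] by simp
        then show ?thesis using sector_mult_of_real[OF t(1) v(1)] xv by simp
      qed
      have "norm (lratio_int t - lratio_int (of_real c * t)) \<le> e / 2 * norm (t - of_real c * t)"
      proof (rule field_differentiable_bound[where S = ?S and f' = lratio])
        fix x assume "x \<in> ?S"
        then have x: "x \<in> sector" "norm x < d" using seg[of x] t(2) by auto
        show "(lratio_int has_field_derivative lratio x) (at x within ?S)"
          by (rule has_field_derivative_at_within[OF has_field_derivative_lratio_int[OF sector_Re_pos[OF x(1)]]])
        show "norm (lratio x) \<le> e / 2" using d(2)[OF x] by simp
      qed auto
      also have "norm (t - of_real c * t) \<le> norm t"
      proof -
        have "t - of_real c * t = of_real (1 - c) * t" by (simp add: algebra_simps)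
        then have "norm (t - of_real c * t) = (1 - c) * norm t" using c by (simp only: norm_mult norm_of_real)
        then show ?thesis using c mult_right_mono[of "1 - c" 1 "norm t"] by simp
      qed
      finally show "norm (lratio_int t - lratio_int (of_real (1 / real (Suc n)) * t)) \<le> e / 2 * norm t"
        using e by (simp add: c_def mult_left_mono)
    qed
  qed simp
  note bound = this
  have "dist ((lratio_int t - of_real (pi\<^sup>2 / 6)) / t) 0 < e" if t: "t \<in> sector" "norm t < d" for t
  proof -
    have tn: "0 < norm t" using sector_nonzero[OF t(1)] by simp
    have "norm (lratio_int t - of_real (pi\<^sup>2 / 6)) \<le> e / 2 * norm t" by (rule bound[OF t])
    also have "\<dots> < e * norm t" using e tn by (intro mult_strict_right_mono) auto
    finally have "norm (lratio_int t - of_real (pi\<^sup>2 / 6)) / norm t < e"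
      using tn by (simp only: pos_divide_less_eq)
    then show ?thesis by (simp only: dist_norm diff_zero norm_divide)
  qed
  then show "eventually (\<lambda>t. dist ((lratio_int t - of_real (pi\<^sup>2 / 6)) / t) 0 < e) (at 0 within sector)"
    unfolding eventually_at using d(1) by (intro exI[of _ d]) auto
qed

text \<open>This is the leading order of the transformation law of the eta function. For growing
  \<open>N\<close> everything in \<open>qpoch_square_eq\<close> except the accumulated error has an
  explicit limit.\<close>

theorem euler_square_asymptotics:
  "((\<lambda>t. (euler (exp (- t)))\<^sup>2 * t * exp (of_real (pi\<^sup>2) / (3 * t))) \<longlongrightarrow> of_real (2 * pi)) (at 0 within sector)"
proof -
  \<comment> \<open>\<open>G t\<close> is the limit of \<open>exp (2 * lratio_err t N)\<close> for
    growing \<open>N\<close>, solved from \<open>qpoch_square_eq\<close>; the error bound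
    \<open>O(sqrt (norm t))\<close>, uniform in \<open>N\<close>, passes to it.\<close>
  define G where "G t = (euler (exp (- t)))\<^sup>2 * t\<^sup>2 * exp (2 * lratio_int t / t) / (of_real (2 * pi) * (1 - exp (- t)))" for t
  define C where "C = 200 * (\<Sum>n. real n powr (-3/2))"
  have C0: "C \<ge> 0" unfolding C_def by (intro mult_nonneg_nonneg suminf_nonneg summable_powr_three_halves) auto
  have G: "norm (G t - 1) \<le> exp (C * sqrt (norm t)) * (C * sqrt (norm t))" if t: "t \<in> sector" for t
  proof -
    have t0: "t \<noteq> 0" and tpos: "0 < Re t" using t by (auto simp: sector_def)
    have q: "norm (exp (- t)) < 1" using tpos by simp
    have e1: "1 - exp (- t) \<noteq> 0" using Re_one_minus_exp_pos[OF tpos] by auto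
    define st where "st N = complex_of_real ((fact N)\<^sup>2 * exp (2 * real N) / real N ^ (2 * N + 1))" for N
    have st: "st \<longlonglongrightarrow> of_real (2 * pi)" unfolding st_def [abs_def] by (intro tendsto_of_real stirling_squared)
    have ex: "(\<lambda>N. exp (- (of_nat N * t))) \<longlonglongrightarrow> 0"
    proof -
      have "(\<lambda>N. exp (- t) ^ N) \<longlonglongrightarrow> 0" by (rule LIMSEQ_power_zero[OF q])
      then show ?thesis by (simp flip: exp_of_nat_mult)
    qed
    have dl: "(\<lambda>N. dilog_exp (of_nat N * t)) \<longlonglongrightarrow> 0"
    proof (rule Lim_null_comparison)
      show "eventually (\<lambda>N. norm (dilog_exp (of_nat N * t)) \<le> norm (exp (- (of_nat N * t))) * (pi\<^sup>2 / 6)) sequentially"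
        using eventually_gt_at_top[of 0]
        by eventually_elim (use norm_dilog_exp_le[of "of_nat N * t" for N] tpos in auto)
      show "(\<lambda>N. norm (exp (- (of_nat N * t))) * (pi\<^sup>2 / 6)) \<longlonglongrightarrow> 0"
        using tendsto_mult_right[OF tendsto_norm[OF ex], of "pi\<^sup>2 / 6"] by simp
    qed
    have "(\<lambda>N. (qpoch N (exp (- t)))\<^sup>2 / (st N * (1 - exp (- (of_nat N * t))) * exp (2 * dilog_exp (of_nat N * t) / t) *
         ((1 - exp (- t)) / t\<^sup>2) * exp (- (2 * lratio_int t / t)))) \<longlonglongrightarrow>
       (euler (exp (- t)))\<^sup>2 / (of_real (2 * pi) * (1 - 0) * exp (2 * 0 / t) * ((1 - exp (- t)) / t\<^sup>2) * exp (- (2 * lratio_int t / t)))"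
      using t0 e1 by (intro tendsto_intros st ex dl qpoch_LIMSEQ q) auto
    also have "(euler (exp (- t)))\<^sup>2 / (of_real (2 * pi) * (1 - 0) * exp (2 * 0 / t) * ((1 - exp (- t)) / t\<^sup>2) * exp (- (2 * lratio_int t / t))) = G t"
      using t0 e1 by (simp add: G_def exp_minus field_simps)
    finally have lim: "(\<lambda>N. (qpoch N (exp (- t)))\<^sup>2 / (st N * (1 - exp (- (of_nat N * t))) * exp (2 * dilog_exp (of_nat N * t) / t) *
         ((1 - exp (- t)) / t\<^sup>2) * exp (- (2 * lratio_int t / t)))) \<longlonglongrightarrow> G t" .
    have "eventually (\<lambda>N. (qpoch N (exp (- t)))\<^sup>2 / (st N * (1 - exp (- (of_nat N * t))) * exp (2 * dilog_exp (of_nat N * t) / t) *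
         ((1 - exp (- t)) / t\<^sup>2) * exp (- (2 * lratio_int t / t))) = exp (2 * lratio_err t N)) sequentially"
      using eventually_ge_at_top[of 1]
    proof eventually_elim
      case (elim N)
      have "0 < Re (of_nat N * t)" using elim tpos by simp
      then have "1 - exp (- (of_nat N * t)) \<noteq> 0" using Re_one_minus_exp_pos by fastforce
      moreover have "st N \<noteq> 0" using elim by (simp add: st_def)
      ultimately show ?case
        unfolding qpoch_square_eq[OF t elim] st_def[symmetric] using e1 t0 by simp
    qed
    then have lim': "(\<lambda>N. exp (2 * lratio_err t N)) \<longlonglongrightarrow> G t"
      by (rule Lim_transform_eventually[OF lim])
    have bd: "norm (exp (2 * lratio_err t N) - 1) \<le> exp (C * sqrt (norm t)) * (C * sqrt (norm t))" for N
    proof -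
      define z where "z = 2 * lratio_err t N"
      have z: "norm z \<le> C * sqrt (norm t)"
      proof -
        have "norm z = 2 * norm (lratio_err t N)" by (simp add: z_def norm_mult)
        also have "\<dots> \<le> 2 * (100 * (\<Sum>n. real n powr (-3/2)) * sqrt (norm t))"
          using norm_lratio_err_le[OF t, of N] by (intro mult_left_mono) auto
        finally show ?thesis by (simp add: C_def mult.assoc)
      qed
      have "norm (exp z - (\<Sum>k\<le>0. z ^ k / fact k)) \<le> exp \<bar>Re z\<bar> * norm z ^ Suc 0 / fact 0"
        by (rule Taylor_exp)
      then have "norm (exp z - 1) \<le> exp \<bar>Re z\<bar> * norm z" by simp
      also have "\<dots> \<le> exp (C * sqrt (norm t)) * (C * sqrt (norm t))"
        using z abs_Re_le_cmod[of z] by (intro mult_mono) auto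
      finally show ?thesis unfolding z_def .
    qed
    show ?thesis
      by (rule tendsto_upperbound[OF tendsto_norm[OF tendsto_diff[OF lim' tendsto_const]]])
         (use bd in auto)
  qed
  have "((\<lambda>t. G t - 1) \<longlongrightarrow> 0) (at 0 within sector)"
  proof (rule Lim_null_comparison)
    show "eventually (\<lambda>t. norm (G t - 1) \<le> exp (C * sqrt (norm t)) * (C * sqrt (norm t))) (at 0 within sector)"
      unfolding eventually_at_filter using G by (intro always_eventually) auto
    have "((\<lambda>t. exp (C * sqrt (norm t)) * (C * sqrt (norm t))) \<longlongrightarrow>
        exp (C * sqrt (norm (0::complex))) * (C * sqrt (norm (0::complex)))) (at 0 within sector)"
      by (intro tendsto_intros)
    then show "((\<lambda>t. exp (C * sqrt (norm t)) * (C * sqrt (norm t))) \<longlongrightarrow> 0) (at (0::complex) within sector)"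
      by simp
  qed
  then have Glim: "(G \<longlongrightarrow> 1) (at 0 within sector)" by (simp add: LIM_zero_iff)
  have "((\<lambda>t. G t * of_real (2 * pi) * ((1 - exp (- t)) / t) * exp (- 2 * ((lratio_int t - of_real (pi\<^sup>2 / 6)) / t)))
     \<longlongrightarrow> 1 * of_real (2 * pi) * 1 * exp (- 2 * 0)) (at 0 within sector)"
    by (intro tendsto_mult tendsto_exp tendsto_const Glim one_minus_exp_over_tendsto lratio_int_remainder_tendsto)
  moreover have "eventually (\<lambda>t. G t * of_real (2 * pi) * ((1 - exp (- t)) / t) * exp (- 2 * ((lratio_int t - of_real (pi\<^sup>2 / 6)) / t))
     = (euler (exp (- t)))\<^sup>2 * t * exp (of_real (pi\<^sup>2) / (3 * t))) (at 0 within sector)"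
    unfolding eventually_at_filter
  proof (rule always_eventually, safe)
    fix t assume t: "t \<in> sector"
    have t0: "t \<noteq> 0" and tpos: "0 < Re t" using t by (auto simp: sector_def)
    have e1: "1 - exp (- t) \<noteq> 0" using Re_one_minus_exp_pos[OF tpos] by auto
    have "- 2 * ((lratio_int t - of_real (pi\<^sup>2 / 6)) / t) = of_real (pi\<^sup>2) / (3 * t) - 2 * lratio_int t / t"
      using t0 by (simp add: field_simps)
    then have "exp (- 2 * ((lratio_int t - of_real (pi\<^sup>2 / 6)) / t)) = exp (of_real (pi\<^sup>2) / (3 * t)) / exp (2 * lratio_int t / t)"
      by (simp only: exp_diff)
    then show "G t * of_real (2 * pi) * ((1 - exp (- t)) / t) * exp (- 2 * ((lratio_int t - of_real (pi\<^sup>2 / 6)) / t))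
     = (euler (exp (- t)))\<^sup>2 * t * exp (of_real (pi\<^sup>2) / (3 * t))"
      using t0 e1 by (simp add: G_def power2_eq_square)
  qed
  ultimately show ?thesis by (auto dest: Lim_transform_eventually)
qed

section \<open>The major arc\<close>

lemma cos_ge_quadratic: "1 - x\<^sup>2 / 2 \<le> cos (x::real)"
proof -
  have "cos x = 1 - 2 * (sin (x / 2))\<^sup>2" using cos_double_sin[of "x / 2"] by simp
  moreover have "(sin (x / 2))\<^sup>2 \<le> (x / 2)\<^sup>2"
    using abs_sin_x_le_abs_x[of "x / 2"] by (simp only: abs_le_square_iff)
  ultimately show ?thesis by (simp add: power2_eq_square)
qed

lemma norm_one_minus_exp_power:
  "(norm (1 - exp (- t) ^ j))\<^sup>2 =
     1 - 2 * exp (- Re t) ^ j * cos (real j * Im t) + (exp (- Re t) ^ j)\<^sup>2"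
proof -
  define r where "r = exp (- Re t) ^ j"
  define x where "x = real j * Im t"
  have r: "r = exp (- (real j * Re t))" using exp_of_nat_mult[of j "- Re t"] by (simp add: r_def)
  have "exp (- t) ^ j = exp (- (of_nat j * t))" using exp_of_nat_mult[of j "- t"] by simp
  then have "Re (exp (- t) ^ j) = r * cos x" "Im (exp (- t) ^ j) = - (r * sin x)"
    by (simp_all add: Re_exp Im_exp r x_def)
  then have "(norm (1 - exp (- t) ^ j))\<^sup>2 = (1 - r * cos x)\<^sup>2 + (r * sin x)\<^sup>2"
    by (simp add: cmod_power2)
  also have "(r * sin x)\<^sup>2 = r\<^sup>2 * (1 - (cos x)\<^sup>2)" by (simp add: power_mult_distrib sin_squared_eq)
  also have "(1 - r * cos x)\<^sup>2 + r\<^sup>2 * (1 - (cos x)\<^sup>2) = 1 - 2 * r * cos x + r\<^sup>2"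
    by (simp add: power2_eq_square algebra_simps)
  finally show ?thesis by (simp only: r_def x_def)
qed

text \<open>
  The exponent \<open>4/3\<close> is below \<open>3/2\<close>, the width of the saddle, and above \<open>1\<close>, so that
  \<open>t\<close> is asymptotically real: on a cone of positive aperture the partial products of
  \<open>(1 - q\<^sup>j)\<close> can be exponentially large.
\<close>
definition major_arc :: "complex set" where
  "major_arc = {t. 0 < Re t \<and> Re t < 1 \<and> \<bar>Im t\<bar> \<le> Re t powr (4/3)}"

lemma major_subset_sector: "major_arc \<subseteq> sector"
proof
  fix t assume t: "t \<in> major_arc"
  then have "Re t powr (4/3) \<le> Re t powr 1" by (intro powr_mono') (auto simp: major_arc_def)
  then show "t \<in> sector" using t by (auto simp: major_arc_def sector_def)
qed

text \<open>With \<open>r\<close> the modulus of the power, a cosine of at least 3/4 bounds the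
  squared modulus by \<open>1 - 3r/2 + r^2 <= 1 - r/2\<close>.\<close>

lemma norm_one_minus_exp_power_le:
  assumes t: "0 < Re t" and th: "(real j * Im t)\<^sup>2 \<le> 1 / 2"
  shows "norm (1 - exp (- t) ^ j) \<le> exp (- (exp (- Re t) ^ j / 4))"
proof -
  define r where "r = exp (- Re t) ^ j"
  have r: "0 < r" "r \<le> 1" using t by (auto simp: r_def intro!: power_le_one)
  have "1 - 1 / 4 \<le> cos (real j * Im t)" using cos_ge_quadratic[of "real j * Im t"] th by simp
  then have "2 * r * (1 - 1 / 4) \<le> 2 * r * cos (real j * Im t)" using r by (intro mult_left_mono) auto
  moreover have "r\<^sup>2 \<le> r" using r by (simp add: power2_eq_square mult_left_le)
  ultimately have "(norm (1 - exp (- t) ^ j))\<^sup>2 \<le> 1 + (- (r / 2))"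
    unfolding norm_one_minus_exp_power r_def[symmetric] by simp
  also have "\<dots> \<le> exp (- (r / 2))" by (rule exp_ge_add_one_self)
  also have "\<dots> = (exp (- (r / 4)))\<^sup>2" by (simp add: power2_eq_square flip: exp_add)
  finally show ?thesis unfolding r_def[symmetric] by (rule power2_le_imp_le) simp
qed

text \<open>The width \<open>a^(4/3)\<close> enters here: a factor whose angle
  \<open>j * Im t\<close> is not small has \<open>j a\<close> at least of order
  \<open>a^(-1/3)\<close>, so that \<open>exp (-a) ^ j\<close> is smaller than any power of
  \<open>a\<close>. All other factors have modulus below 1.\<close>

lemma major_prod_bound:
  "eventually (\<lambda>t. \<forall>n m. norm (\<Prod>j=Suc n..m. 1 - exp (- t) ^ j) \<le>
      exp 2 * exp (- ((\<Sum>j=Suc n..m. exp (- Re t) ^ j) / 4))) (at 0 within major_arc)"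
proof -
  have "eventually (\<lambda>a::real. exp (- (a powr (-1/3)) / 4) / (1 - exp (- a / 2)) \<le> 1) (at_right 0)"
  proof -
    have "((\<lambda>a::real. exp (- (a powr (-1/3)) / 4) / (1 - exp (- a / 2))) \<longlongrightarrow> 0) (at_right 0)"
      by real_asymp
    then show ?thesis by (auto dest!: order_tendstoD(2)[of _ _ _ 1] elim!: eventually_mono)
  qed
  then obtain d where d: "d > 0" "\<And>a::real. 0 < a \<Longrightarrow> a < d \<Longrightarrow> exp (- (a powr (-1/3)) / 4) / (1 - exp (- a / 2)) \<le> 1"
    unfolding eventually_at_right_field by blast
  have main: "norm (\<Prod>j=Suc n..m. 1 - exp (- t) ^ j) \<le> exp 2 * exp (- ((\<Sum>j=Suc n..m. exp (- Re t) ^ j) / 4))"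
    if t: "t \<in> major_arc" "norm t < d" for t n m
  proof -
    define a where "a = Re t"
    define s where "s = exp (- (a / 2))"
    have a: "0 < a" "a < 1" "\<bar>Im t\<bar> \<le> a powr (4/3)" "a < d"
      using t complex_Re_le_cmod[of t] by (auto simp: major_arc_def a_def)
    have s: "0 < s" "s < 1" using a by (auto simp: s_def)
    define E where "E = exp (- (a powr (-1/3)) / 4)"
    have E1: "E / (1 - s) \<le> 1" using d(2)[OF a(1) a(4)] by (simp add: E_def s_def)
    \<comment> \<open>The second term is a reserve for large angles: with
      \<open>x = exp (-a)\<close>, the modulus is at most \<open>exp (x^j)\<close>, where
      \<open>x^j = -x^j/4 + 5/4 x^j\<close> and \<open>x^j <= E s^j\<close>. Summed over
      \<open>j\<close> the reserve is at most 5/4, hence the constant \<open>exp 2\<close>.\<close>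
    have fac: "norm (1 - exp (- t) ^ j) \<le> exp (- (exp (- a) ^ j / 4) + 5 / 4 * (E * s ^ j))" if "j \<ge> 1" for j
    proof (cases "(real j * Im t)\<^sup>2 \<le> 1 / 2")
      case True
      have "norm (1 - exp (- t) ^ j) \<le> exp (- (exp (- a) ^ j / 4))"
        using norm_one_minus_exp_power_le[OF _ True] a by (simp add: a_def)
      also have "\<dots> \<le> exp (- (exp (- a) ^ j / 4) + 5 / 4 * (E * s ^ j))"
        using s by (simp add: E_def)
      finally show ?thesis .
    next
      case False
      have "1 / 2 < real j * \<bar>Im t\<bar>"
      proof (rule ccontr)
        assume "\<not> ?thesis"
        then have "(real j * \<bar>Im t\<bar>)\<^sup>2 \<le> (1/2)\<^sup>2" by (intro power_mono) auto
        then show False using False by (simp add: power_mult_distrib power2_eq_square)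
      qed
      also have "\<dots> \<le> real j * a powr (4/3)" using a by (intro mult_left_mono) auto
      also have "\<dots> = real j * a * a powr (1/3)"
      proof -
        have "a powr (4/3) = a powr (1 + 1/3)" by simp
        also have "\<dots> = a powr 1 * a powr (1/3)" by (rule powr_add)
        finally show ?thesis using a by simp
      qed
      finally have "1 / 2 * a powr (-1/3) \<le> real j * a * a powr (1/3) * a powr (-1/3)"
        by (intro mult_right_mono less_imp_le) auto
      also have "\<dots> = real j * a" using a by (simp flip: powr_add)
      finally have ja: "a powr (-1/3) / 4 \<le> real j * a / 2" by simp
      have sj: "s ^ j = exp (- (real j * a / 2))" using exp_of_nat_mult[of j "- (a / 2)"] by (simp add: s_def)
      have "exp (- a) = s * s" by (simp add: s_def flip: exp_add)
      then have "exp (- a) ^ j = s ^ j * s ^ j" by (simp add: power_mult_distrib)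
      also have "s ^ j * s ^ j \<le> E * s ^ j"
      proof (rule mult_right_mono)
        have "exp (- (real j * a / 2)) \<le> E" using ja by (simp add: E_def)
        then show "s ^ j \<le> E" using sj by simp
      qed (use s in auto)
      finally have rj: "exp (- a) ^ j \<le> E * s ^ j" .
      have "norm (1 - exp (- t) ^ j) \<le> 1 + exp (- a) ^ j"
        using norm_triangle_ineq4[of 1 "exp (- t) ^ j"] by (simp add: norm_power a_def)
      also have "\<dots> \<le> exp (exp (- a) ^ j)" by (rule exp_ge_add_one_self)
      also have "\<dots> \<le> exp (- (exp (- a) ^ j / 4) + 5 / 4 * (E * s ^ j))" using rj by simp
      finally show ?thesis .
    qed
    have "norm (\<Prod>j=Suc n..m. 1 - exp (- t) ^ j) \<le> (\<Prod>j=Suc n..m. exp (- (exp (- a) ^ j / 4) + 5 / 4 * (E * s ^ j)))"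
      unfolding prod_norm[symmetric] by (intro prod_mono) (use fac in auto)
    also have "\<dots> = exp (- ((\<Sum>j=Suc n..m. exp (- a) ^ j) / 4) + 5 / 4 * (E * (\<Sum>j=Suc n..m. s ^ j)))"
      by (simp add: exp_sum[symmetric] sum.distrib sum_subtractf sum_negf sum_divide_distrib sum_distrib_left)
    also have "\<dots> \<le> exp (- ((\<Sum>j=Suc n..m. exp (- a) ^ j) / 4) + 2)"
    proof -
      have "(\<Sum>j=Suc n..m. s ^ j) \<le> (\<Sum>j. s ^ j)"
        using s by (intro sum_le_suminf summable_geometric) auto
      also have "\<dots> = 1 / (1 - s)" using s by (intro suminf_geometric) auto
      finally have "E * (\<Sum>j=Suc n..m. s ^ j) \<le> E * (1 / (1 - s))" by (intro mult_left_mono) (auto simp: E_def)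
      then show ?thesis using E1 by simp
    qed
    finally show ?thesis by (simp add: a_def flip: exp_add)
  qed
  show ?thesis unfolding eventually_at using d(1) main by (intro exI[of _ d]) auto
qed

section \<open>The tails \<open>(q^(n+1); q)_inf\<close> of the Euler product\<close>

definition qtail :: "nat \<Rightarrow> complex \<Rightarrow> complex" where
  "qtail n q = euler q / qpoch n q"

lemma qpoch_nonzero: "norm q < 1 \<Longrightarrow> qpoch n (q::complex) \<noteq> 0"
  using one_minus_power_nonzero by (auto simp: qpoch_def)

lemma qpoch_split: "n \<le> m \<Longrightarrow> qpoch m q = qpoch n q * (\<Prod>j=Suc n..m. 1 - q ^ j)"
proof (induction m)
  case (Suc m)
  then show ?case by (cases "n = Suc m") (auto simp: qpoch_def mult.assoc)
qed (simp add: qpoch_def)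

lemma qtail_LIMSEQ:
  assumes "norm q < 1"
  shows "(\<lambda>m. \<Prod>j=Suc n..m. 1 - q ^ j) \<longlonglongrightarrow> qtail n q"
proof (rule Lim_transform_eventually)
  show "(\<lambda>m. qpoch m q / qpoch n q) \<longlonglongrightarrow> qtail n q"
    unfolding qtail_def by (intro tendsto_divide qpoch_LIMSEQ tendsto_const assms qpoch_nonzero)
  show "eventually (\<lambda>m. qpoch m q / qpoch n q = (\<Prod>j=Suc n..m. 1 - q ^ j)) sequentially"
    using eventually_ge_at_top[of n]
  proof eventually_elim
    case (elim m)
    show ?case using qpoch_split[OF elim, of q] qpoch_nonzero[OF assms] by simp
  qed
qed

lemma qtail_step:
  assumes "norm q < 1"
  shows "qtail n q = qtail (Suc n) q * (1 - q ^ Suc n)"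
  using qpoch_nonzero[OF assms, of "Suc n"] qpoch_nonzero[OF assms, of n]
  by (simp add: qtail_def qpoch_def divide_simps)

lemma qtail_tendsto_1:
  assumes "norm q < 1"
  shows "(\<lambda>n. qtail n q) \<longlonglongrightarrow> 1"
proof -
  have "(\<lambda>n. euler q / qpoch n q) \<longlonglongrightarrow> euler q / euler q"
    by (intro tendsto_divide tendsto_const qpoch_LIMSEQ euler_nonzero assms)
  then show ?thesis using euler_nonzero[OF assms] by (simp add: qtail_def)
qed

lemma geometric_tail_sums:
  fixes x :: real
  assumes "0 \<le> x" "x < 1"
  shows "(\<lambda>m. \<Sum>j=Suc n..m. x ^ j) \<longlonglongrightarrow> x ^ Suc n / (1 - x)"
proof -
  have "(\<lambda>m. \<Sum>j<m. x ^ (Suc n) * x ^ j) \<longlonglongrightarrow> x ^ Suc n * (1 / (1 - x))"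
    using geometric_sums[of x] assms by (subst sums_def[symmetric]) (intro sums_mult, auto)
  moreover have "(\<Sum>j=Suc n..m + n. x ^ j) = (\<Sum>j<m. x ^ (Suc n) * x ^ j)" for m
  proof -
    have "(\<Sum>j=Suc n..m + n. x ^ j) = (\<Sum>j=0 + Suc n..<m + Suc n. x ^ j)"
      by (intro sum.cong) auto
    also have "\<dots> = (\<Sum>j=0..<m. x ^ (j + Suc n))" by (rule sum.shift_bounds_nat_ivl)
    finally show ?thesis by (simp add: lessThan_atLeast0 power_add mult_ac)
  qed
  ultimately have "(\<lambda>m. \<Sum>j=Suc n..m + n. x ^ j) \<longlonglongrightarrow> x ^ Suc n / (1 - x)" by simp
  then show ?thesis by (rule LIMSEQ_offset)
qed

lemma qtail_minus_one_le:
  assumes "norm q < 1"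
  shows "norm (qtail n q - 1) \<le> exp (norm q ^ Suc n / (1 - norm q)) - 1"
proof (rule tendsto_le)
  show "(\<lambda>m. norm ((\<Prod>j=Suc n..m. 1 - q ^ j) - 1)) \<longlonglongrightarrow> norm (qtail n q - 1)"
    by (intro tendsto_intros qtail_LIMSEQ assms)
  show "(\<lambda>m. exp (\<Sum>j=Suc n..m. norm q ^ j) - 1) \<longlonglongrightarrow> exp (norm q ^ Suc n / (1 - norm q)) - 1"
    by (intro tendsto_intros geometric_tail_sums) (use assms in auto)
  have "norm ((\<Prod>j=Suc n..m. 1 - q ^ j) - 1) \<le> exp (\<Sum>j=Suc n..m. norm q ^ j) - 1" for m
  proof -
    have "norm ((\<Prod>j=Suc n..m. 1 + (- (q ^ j))) - 1) \<le> (\<Prod>j=Suc n..m. 1 + norm (- (q ^ j))) - 1"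
      by (rule norm_prod_minus1_le_prod_minus1)
    also have "\<dots> \<le> (\<Prod>j=Suc n..m. exp (norm q ^ j)) - 1"
      by (intro diff_right_mono prod_mono) (auto simp: norm_power intro: add_nonneg_nonneg)
    finally show ?thesis by (simp add: exp_sum)
  qed
  then show "eventually (\<lambda>m. norm ((\<Prod>j=Suc n..m. 1 - q ^ j) - 1) \<le> exp (\<Sum>j=Suc n..m. norm q ^ j) - 1) sequentially"
    by simp
qed simp

text \<open>With \<open>a = Re t\<close> and \<open>x = exp (-a)\<close>, the natural variable is
  \<open>x^n / a\<close>: the geometric tail \<open>x^(n+1) / (1 - x)\<close> lies between half of
  it and itself. Decay, a bounded quotient and closeness to 1 are what the comparison with the
  telescoping sum needs.\<close>

lemma major_qtail_bounds:
  "eventually (\<lambda>t. \<forall>n. norm (qtail n (exp (- t))) \<le> exp 2 * exp (- (exp (- Re t) ^ n / Re t / 8)) \<and>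
      norm (qtail n (exp (- t)) / qtail (2 * n) (exp (- t))) \<le> exp 2 \<and>
      norm (1 - qtail n (exp (- t))) \<le> (exp 2 + 2) * (exp (- Re t) ^ n / Re t)) (at 0 within major_arc)"
proof -
  have "eventually (\<lambda>t::complex. norm t < 1/2) (at 0 within major_arc)"
    by (auto simp: eventually_at intro!: exI[of _ "1/2"])
  moreover have "eventually (\<lambda>t. t \<in> major_arc) (at 0 within major_arc)"
    by (auto simp: eventually_at_filter)
  ultimately show ?thesis using major_prod_bound
  proof eventually_elim
    case (elim t)
    define a where "a = Re t"
    define x where "x = exp (- a)"
    define q where "q = exp (- t)"
    have a: "0 < a" "a < 1 / 2" using elim complex_Re_le_cmod[of t] by (auto simp: major_arc_def a_def)
    have x: "0 < x" "x < 1" "norm q = x" using a by (auto simp: x_def q_def a_def)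
    have q: "norm q < 1" using x by simp
    have x1: "1 - x \<le> a" using exp_ge_add_one_self[of "- a"] by (simp add: x_def)
    have x2: "1 / 2 \<le> x" using x1 a by simp
    have x3: "x / (1 - x) \<le> 1 / a"
    proof -
      have "x * (1 + a) \<le> x * exp a" using exp_ge_add_one_self[of a] x by (intro mult_left_mono) auto
      then have "x * (1 + a) \<le> 1" by (simp add: x_def flip: exp_add)
      then show ?thesis using x a by (simp add: field_simps)
    qed
    have x4: "1 / (2 * a) \<le> x / (1 - x)"
    proof -
      have "(1 / 2) / a \<le> x / (1 - x)" using x1 x2 x by (intro frac_le) auto
      then show ?thesis by simp
    qed
    note pb = elim(3)[rule_format, folded a_def, folded x_def, folded q_def]
    show ?case unfolding a_def[symmetric] x_def[symmetric] q_def[symmetric]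
    proof (intro allI conjI)
      fix n
      have sm: "(\<lambda>m. \<Sum>j=Suc n..m. x ^ j) \<longlonglongrightarrow> x ^ Suc n / (1 - x)"
        by (rule geometric_tail_sums) (use x in auto)
      have "norm (qtail n q) \<le> exp 2 * exp (- (x ^ Suc n / (1 - x) / 4))"
        by (rule tendsto_le[OF _ tendsto_mult[OF tendsto_const tendsto_exp[OF tendsto_minus[OF tendsto_divide[OF sm tendsto_const]]]]
              tendsto_norm[OF qtail_LIMSEQ[OF q]]]) (use pb in auto)
      also have "\<dots> \<le> exp 2 * exp (- (x ^ n / a / 8))"
      proof -
        have "x ^ n / a / 8 = x ^ n * (1 / (2 * a)) / 4" by simp
        also have "\<dots> \<le> x ^ n * (x / (1 - x)) / 4"
          using x4 x by (intro divide_right_mono mult_left_mono) auto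
        finally show ?thesis by (simp add: mult.commute)
      qed
      finally show R: "norm (qtail n q) \<le> exp 2 * exp (- (x ^ n / a / 8))" .
      have nz: "qpoch n q \<noteq> 0" "qpoch (2 * n) q \<noteq> 0" "euler q \<noteq> 0"
        using qpoch_nonzero[OF q] euler_nonzero[OF q] by auto
      have "qtail n q / qtail (2 * n) q = (\<Prod>j=Suc n..2*n. 1 - q ^ j)"
        using qpoch_split[of n "2 * n" q] nz by (simp add: qtail_def)
      also have "norm \<dots> \<le> exp 2 * exp (- ((\<Sum>j=Suc n..2*n. x ^ j) / 4))" by (rule pb)
      also have "\<dots> \<le> exp 2 * 1" using x by (intro mult_left_mono) (auto intro!: sum_nonneg)
      finally show "norm (qtail n q / qtail (2 * n) q) \<le> exp 2" by simp
      define S where "S = x ^ Suc n / (1 - x)"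
      have S: "0 \<le> S" "S \<le> x ^ n / a"
        using x x3 mult_left_mono[of "x / (1 - x)" "1 / a" "x ^ n"] by (auto simp: S_def mult.commute)
      have "norm (1 - qtail n q) \<le> (exp 2 + 2) * S"
      proof (cases "S \<le> 1")
        case True
        have "norm (1 - qtail n q) \<le> exp S - 1"
          using qtail_minus_one_le[OF q, of n] by (simp add: norm_minus_commute x S_def)
        also have "\<dots> \<le> 2 * S"
          using exp_bound[OF S(1) True] S True mult_left_mono[of S 1 S] by (simp add: power2_eq_square)
        also have "\<dots> \<le> (exp 2 + 2) * S" using S by (intro mult_right_mono) auto
        finally show ?thesis .
      next
        case False
        have "exp (- (x ^ n / a / 8)) \<le> 1" using x a by simp
        then have "exp 2 * exp (- (x ^ n / a / 8)) \<le> exp 2 * 1" by (intro mult_left_mono) auto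
        then have "norm (qtail n q) \<le> exp 2" using R by linarith
        then have "norm (1 - qtail n q) \<le> exp 2 + 2" using norm_triangle_ineq4[of 1 "qtail n q"] by simp
        also have "\<dots> \<le> (exp 2 + 2) * S" using False by (simp add: add_nonneg_pos)
        finally show ?thesis .
      qed
      also have "\<dots> \<le> (exp 2 + 2) * (x ^ n / a)" using S by (intro mult_left_mono) (auto intro: add_nonneg_nonneg)
      finally show "norm (1 - qtail n q) \<le> (exp 2 + 2) * (x ^ n / a)" .
    qed
  qed
qed

section \<open>Complete homogeneous symmetric functions of the Lambert terms\<close>

lemma hsym_scale: "hsym (\<lambda>j. c * X j) r n = c ^ r * hsym X r n"
proof (induction r arbitrary: n)
  case (Suc r)
  have "hsym (\<lambda>j. c * X j) (Suc r) n = (\<Sum>j=1..n. c * X j * (c ^ r * hsym X r j))"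
    by (simp only: hsym.simps Suc)
  also have "\<dots> = c ^ Suc r * hsym X (Suc r) n"
    by (simp add: sum_distrib_left mult_ac)
  finally show ?case .
qed simp

lemma sum_inverse_squares_le: "(\<Sum>j=1..n. 1 / real j ^ 2) \<le> 2"
proof -
  have "(\<Sum>j=1..n. 1 / real j ^ 2) = (\<Sum>j<n. 1 / real (Suc j) ^ 2)"
    by (simp add: sum.atLeast1_atMost_eq)
  also have "\<dots> \<le> (\<Sum>j. 1 / real (Suc j) ^ 2)"
    by (intro sum_le_suminf inverse_square_Suc_summable) auto
  also have "\<dots> = pi\<^sup>2 / 6" using inverse_squares_sums by (simp add: sums_iff add.commute)
  also have "\<dots> \<le> 2"
  proof -
    have "pi\<^sup>2 \<le> (3.2)\<^sup>2" using pi_approx by (intro power_mono) auto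
    then show ?thesis by (simp add: power2_eq_square)
  qed
  finally show ?thesis .
qed

lemma norm_hsym_le:
  fixes X :: "nat \<Rightarrow> complex"
  assumes "\<And>j. 1 \<le> j \<Longrightarrow> norm (X j) \<le> B / real j ^ 2" "0 \<le> B"
  shows "norm (hsym X r n) \<le> (2 * B) ^ r"
proof (induction r arbitrary: n)
  case (Suc r)
  have "norm (hsym X (Suc r) n) \<le> (\<Sum>j=1..n. B / real j ^ 2 * (2 * B) ^ r)"
    unfolding hsym.simps
  proof (rule sum_norm_le)
    fix j assume "j \<in> {1..n}"
    then have "norm (X j) \<le> B / real j ^ 2" using assms(1) by simp
    then show "norm (X j * hsym X r j) \<le> B / real j ^ 2 * (2 * B) ^ r"
      unfolding norm_mult by (rule mult_mono[OF _ Suc]) (use assms(2) in auto)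
  qed
  also have "\<dots> = B * (2 * B) ^ r * (\<Sum>j=1..n. 1 / real j ^ 2)"
    by (simp add: sum_distrib_left)
  also have "\<dots> \<le> B * (2 * B) ^ r * 2"
    using assms(2) by (intro mult_left_mono sum_inverse_squares_le) auto
  finally show ?case by simp
qed simp

text \<open>Since the recursion runs over the largest index, only the outermost sum becomes infinite
  and the finite \<open>hsym\<close> stays inside.\<close>

fun hsym_inf :: "(nat \<Rightarrow> complex) \<Rightarrow> nat \<Rightarrow> complex" where
  "hsym_inf X 0 = 1"
| "hsym_inf X (Suc r) = (\<Sum>j. X (Suc j) * hsym X r (Suc j))"

lemma hsym_summand_le:
  fixes X :: "nat \<Rightarrow> complex"
  assumes "\<And>j. 1 \<le> j \<Longrightarrow> norm (X j) \<le> B / real j ^ 2" "0 \<le> B"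
  shows "norm (X (Suc j) * hsym X r (Suc j)) \<le> B * (2 * B) ^ r * (1 / real (Suc j) ^ 2)"
proof -
  have "norm (X (Suc j)) * norm (hsym X r (Suc j)) \<le> B / real (Suc j) ^ 2 * (2 * B) ^ r"
    by (rule mult_mono[OF assms(1) norm_hsym_le[OF assms]]) (use assms(2) in auto)
  then show ?thesis by (simp add: norm_mult mult_ac)
qed

lemma hsym_LIMSEQ:
  fixes X :: "nat \<Rightarrow> complex"
  assumes "\<And>j. 1 \<le> j \<Longrightarrow> norm (X j) \<le> B / real j ^ 2" "0 \<le> B"
  shows "(\<lambda>n. hsym X r n) \<longlonglongrightarrow> hsym_inf X r"
proof (cases r)
  case (Suc r')
  have "summable (\<lambda>j. X (Suc j) * hsym X r' (Suc j))"
    by (rule summable_comparison_test'[OF summable_mult[OF inverse_square_Suc_summable]])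
       (use hsym_summand_le[OF assms] in blast)
  then have "(\<lambda>n. \<Sum>j<n. X (Suc j) * hsym X r' (Suc j)) \<longlonglongrightarrow> hsym_inf X r"
    unfolding Suc hsym_inf.simps by (rule summable_LIMSEQ)
  then show ?thesis by (simp add: Suc sum.atLeast1_atMost_eq)
qed simp

lemma norm_hsym_inf_le:
  fixes X :: "nat \<Rightarrow> complex"
  assumes "\<And>j. 1 \<le> j \<Longrightarrow> norm (X j) \<le> B / real j ^ 2" "0 \<le> B"
  shows "norm (hsym_inf X r) \<le> (2 * B) ^ r"
  by (rule tendsto_upperbound[OF tendsto_norm[OF hsym_LIMSEQ[OF assms]]])
     (use norm_hsym_le[OF assms] in auto)

text \<open>The difference consists of the monomials whose largest index exceeds \<open>n\<close>;
  their outermost factor carries the small constant \<open>c\<close>, the inner factors are bounded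
  as before.\<close>

lemma hsym_diff_le:
  fixes X :: "nat \<Rightarrow> complex"
  assumes B: "\<And>j. 1 \<le> j \<Longrightarrow> norm (X j) \<le> B / real j ^ 2" "0 \<le> B"
    and c: "\<And>j. 1 \<le> j \<Longrightarrow> norm (X (n + j)) \<le> c * B / real j ^ 2" "0 \<le> c"
  shows "norm (hsym_inf X r - hsym X r n) \<le> c * (2 * B) ^ r"
proof (cases r)
  case 0
  then show ?thesis using c by simp
next
  case (Suc r')
  have "norm (hsym X r (n + m) - hsym X r n) \<le> c * (2 * B) ^ r" for m
  proof -
    have "hsym X r (n + m) = hsym X r n + (\<Sum>j=1..m. X (n + j) * hsym X r' (n + j))"
      unfolding Suc by (induction m) auto
    then have "hsym X r (n + m) - hsym X r n = (\<Sum>j=1..m. X (n + j) * hsym X r' (n + j))" by simp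
    also have "norm \<dots> \<le> (\<Sum>j=1..m. c * B / real j ^ 2 * (2 * B) ^ r')"
    proof (rule sum_norm_le)
      fix j assume "j \<in> {1..m}"
      then have "norm (X (n + j)) \<le> c * B / real j ^ 2" using c by simp
      then show "norm (X (n + j) * hsym X r' (n + j)) \<le> c * B / real j ^ 2 * (2 * B) ^ r'"
        unfolding norm_mult by (rule mult_mono[OF _ norm_hsym_le[OF B]]) (use B(2) c(2) in auto)
    qed
    also have "\<dots> = c * B * (2 * B) ^ r' * (\<Sum>j=1..m. 1 / real j ^ 2)"
      by (simp add: sum_distrib_left)
    also have "\<dots> \<le> c * B * (2 * B) ^ r' * 2"
      using B c by (intro mult_left_mono sum_inverse_squares_le) auto
    finally show ?thesis by (simp add: Suc)
  qed
  moreover have "(\<lambda>m. hsym X r (n + m)) \<longlonglongrightarrow> hsym_inf X r"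
    using LIMSEQ_ignore_initial_segment[OF hsym_LIMSEQ[OF B], of r n] by (simp add: add.commute)
  then have "(\<lambda>m. norm (hsym X r (n + m) - hsym X r n)) \<longlonglongrightarrow> norm (hsym_inf X r - hsym X r n)"
    by (intro tendsto_intros)
  ultimately show ?thesis by (intro tendsto_upperbound) auto
qed

definition lambert :: "complex \<Rightarrow> nat \<Rightarrow> complex" where
  "lambert q j = q ^ j / (1 - q ^ j)\<^sup>2"

text \<open>The numerator gives the extra factor \<open>exp (- Re t) ^ n\<close>, while the
  denominator is bounded below by its real counterpart at index \<open>j\<close>.\<close>

lemma norm_lambert_shift_le:
  assumes t: "0 < Re t" and j: "1 \<le> j"
  shows "norm (lambert (exp (- t)) (n + j)) \<le> exp (- Re t) ^ n * (1 / (Re t)\<^sup>2) / real j ^ 2"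
proof -
  define a where "a = Re t"
  define x where "x = exp (- a)"
  have a: "0 < a" and x: "0 < x" "x < 1" using t by (auto simp: a_def x_def)
  have nq: "norm (exp (- t)) = x" by (simp add: x_def a_def)
  have xj: "x ^ j < 1" "x ^ (n + j) \<le> x ^ j" using x j by (auto intro: power_decreasing power_Suc_less_one simp: power_less_one_iff)
  have xje: "x ^ j = exp (- (real j * a))" using exp_of_nat_mult[of j "- a"] by (simp add: x_def)
  have "1 - x ^ j \<le> 1 - x ^ (n + j)" using xj by simp
  also have "\<dots> \<le> norm (1 - exp (- t) ^ (n + j))"
    using norm_triangle_ineq2[of 1 "exp (- t) ^ (n + j)"] by (simp add: norm_power x_def a_def)
  finally have den: "1 - x ^ j \<le> norm (1 - exp (- t) ^ (n + j))" .
  have "norm (lambert (exp (- t)) (n + j)) = x ^ (n + j) / (norm (1 - exp (- t) ^ (n + j)))\<^sup>2"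
    by (simp add: lambert_def norm_divide norm_power x_def a_def)
  also have "\<dots> \<le> x ^ (n + j) / (1 - x ^ j)\<^sup>2"
    using den xj x by (intro divide_left_mono power_mono mult_pos_pos zero_less_power) auto
  also have "\<dots> = x ^ n * (x ^ j / (1 - x ^ j)\<^sup>2)" by (simp add: power_add)
  also have "\<dots> \<le> x ^ n * (1 / (real j * a)\<^sup>2)"
    unfolding xje using x a j by (intro mult_left_mono exp_over_square_le) auto
  finally show ?thesis by (simp add: a_def x_def power_mult_distrib mult_ac)
qed

lemma norm_lambert_le:
  assumes "0 < Re t" "1 \<le> j"
  shows "norm (lambert (exp (- t)) j) \<le> (1 / (Re t)\<^sup>2) / real j ^ 2"
  using norm_lambert_shift_le[OF assms, of 0] by simp

lemma norm_scaled_lambert_shift_le: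
  assumes t: "t \<in> sector" and j: "1 \<le> j"
  shows "norm (t\<^sup>2 * lambert (exp (- t)) (n + j)) \<le> exp (- Re t) ^ n * 4 / real j ^ 2"
proof -
  have tp: "0 < Re t" by (rule sector_Re_pos[OF t])
  have "norm (t\<^sup>2 * lambert (exp (- t)) (n + j)) \<le> (2 * Re t)\<^sup>2 * (exp (- Re t) ^ n * (1 / (Re t)\<^sup>2) / real j ^ 2)"
    unfolding norm_mult norm_power using sector_norm_le[OF t] norm_lambert_shift_le[OF tp j, of n]
    by (intro mult_mono power_mono) auto
  also have "\<dots> = exp (- Re t) ^ n * 4 / real j ^ 2" using tp by (simp add: power_mult_distrib)
  finally show ?thesis .
qed

lemma norm_scaled_lambert_le:
  assumes "t \<in> sector" "1 \<le> j"
  shows "norm (t\<^sup>2 * lambert (exp (- t)) j) \<le> 4 / real j ^ 2"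
  using norm_scaled_lambert_shift_le[OF assms, of 0] by simp

lemma scaled_lambert_tendsto:
  assumes "1 \<le> j"
  shows "((\<lambda>t. t\<^sup>2 * lambert (exp (- t)) j) \<longlongrightarrow> 1 / of_nat j ^ 2) (at 0 within sector)"
proof -
  have "((\<lambda>t. (1 - exp (- t) ^ j) / t) \<longlongrightarrow> of_nat j) (at (0::complex))"
  proof -
    have "((\<lambda>x::complex. 1 - exp (- x) ^ j) has_field_derivative of_nat j) (at 0)"
      by (auto intro!: derivative_eq_intros)
    then show ?thesis by (simp add: has_field_derivative_iff)
  qed
  then have 1: "((\<lambda>t. (1 - exp (- t) ^ j) / t) \<longlongrightarrow> of_nat j) (at (0::complex) within sector)"
    by (rule tendsto_within_subset) auto
  have "((\<lambda>t. exp (- t) ^ j / ((1 - exp (- t) ^ j) / t)\<^sup>2) \<longlongrightarrow> exp (- 0) ^ j / (of_nat j)\<^sup>2) (at (0::complex) within sector)"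
    by (intro tendsto_intros 1) (use assms in auto)
  then show ?thesis by (simp add: lambert_def power_divide mult.commute)
qed

lemma scaled_hsym_tendsto:
  "((\<lambda>t. hsym (\<lambda>j. t\<^sup>2 * lambert (exp (- t)) j) r n) \<longlongrightarrow> hsym (\<lambda>j. 1 / of_nat j ^ 2) r n) (at 0 within sector)"
proof (induction r arbitrary: n)
  case (Suc r)
  show ?case unfolding hsym.simps
    by (intro tendsto_sum tendsto_mult Suc scaled_lambert_tendsto) auto
qed simp

lemma at_0_within_sector_nontrivial: "at 0 within sector \<noteq> bot"
proof -
  have "(\<lambda>n. complex_of_real (1 / real (Suc n))) \<longlonglongrightarrow> of_real 0"
    by (intro tendsto_of_real) real_asymp
  then have "0 islimpt sector"
    unfolding islimpt_sequential
    by (intro exI[of _ "\<lambda>n. complex_of_real (1 / real (Suc n))"]) (auto simp: sector_def simp del: of_nat_Suc)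
  then show ?thesis by (simp add: trivial_limit_within)
qed

text \<open>Tannery's theorem over the largest index, with a majorant that does not depend on
  \<open>t\<close> in the sector.\<close>

lemma scaled_hsym_inf_tendsto:
  "((\<lambda>t. hsym_inf (\<lambda>j. t\<^sup>2 * lambert (exp (- t)) j) r) \<longlongrightarrow> hsym_inf (\<lambda>j. 1 / of_nat j ^ 2) r) (at 0 within sector)"
proof (cases r)
  case (Suc r')
  let ?Y = "\<lambda>t j. t\<^sup>2 * lambert (exp (- t)) j"
  have "((\<lambda>t. \<Sum>j. ?Y t (Suc j) * hsym (?Y t) r' (Suc j)) \<longlongrightarrow>
     (\<Sum>j. 1 / of_nat (Suc j) ^ 2 * hsym (\<lambda>j. 1 / of_nat j ^ 2) r' (Suc j))) (at 0 within sector)"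
  proof (rule tannerys_theorem[THEN conjunct2, THEN conjunct2])
    show "((\<lambda>t. ?Y t (Suc j) * hsym (?Y t) r' (Suc j)) \<longlongrightarrow>
        1 / of_nat (Suc j) ^ 2 * hsym (\<lambda>j. 1 / of_nat j ^ 2) r' (Suc j)) (at 0 within sector)" for j
      by (intro tendsto_mult scaled_lambert_tendsto scaled_hsym_tendsto) simp
    show "summable (\<lambda>j. 4 * (2 * 4) ^ r' * (1 / real (Suc j) ^ 2))"
      by (intro summable_mult inverse_square_Suc_summable)
    have ev: "eventually (\<lambda>t. t \<in> sector) (at 0 within sector)" by (auto simp: eventually_at_filter)
    show "eventually (\<lambda>(j, t). norm (?Y t (Suc j) * hsym (?Y t) r' (Suc j)) \<le> 4 * (2 * 4) ^ r' * (1 / real (Suc j) ^ 2))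
       (sequentially \<times>\<^sub>F (at 0 within sector))"
      unfolding eventually_prod_filter case_prod_conv
    proof (intro exI conjI)
      show "eventually (\<lambda>_. True) sequentially" by simp
      show "eventually (\<lambda>t. t \<in> sector) (at 0 within sector)" by (rule ev)
      show "\<forall>x y. True \<longrightarrow> y \<in> sector \<longrightarrow>
         norm (?Y y (Suc x) * hsym (?Y y) r' (Suc x)) \<le> 4 * (2 * 4) ^ r' * (1 / real (Suc x) ^ 2)"
        by (intro allI impI hsym_summand_le norm_scaled_lambert_le) auto
    qed
  qed (rule at_0_within_sector_nontrivial)
  then show ?thesis by (simp add: Suc)
qed simp

section \<open>The sum over the peaks on the major arc\<close>

definition peak_term :: "nat \<Rightarrow> nat \<Rightarrow> complex \<Rightarrow> complex" where
  "peak_term r n q = q ^ n * qpoch (2 * n) q / (qpoch n q) ^ 3 * hsym (lambert q) r n"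

text \<open>The shift of the index excludes the peak 0.\<close>

definition peak_sum :: "nat \<Rightarrow> complex \<Rightarrow> complex" where
  "peak_sum r q = (\<Sum>n. peak_term r (Suc n) q)"

text \<open>Three tails over one tail leave two surplus Euler products: the growth
  \<open>1 / (euler q)^2\<close> is common to all \<open>n\<close>, and the tails are controlled by
  \<open>major_qtail_bounds\<close>.\<close>

lemma peak_term_eq_qtail:
  assumes "norm q < 1"
  shows "peak_term r n q = (q ^ n * (qtail n q ^ 3 / qtail (2 * n) q) * hsym (lambert q) r n) / (euler q)\<^sup>2"
  using qpoch_nonzero[OF assms] euler_nonzero[OF assms]
  by (simp add: peak_term_def qtail_def power3_eq_cube power2_eq_square mult_ac)

text \<open>Used with \<open>y = x^n / a\<close>: the square root leaves \<open>x^(n/2)\<close>, a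
  convergent geometric series in \<open>n\<close>. The constant is \<open>2 * 12^3\<close>, from
  \<open>y/12 <= exp (y/12)\<close>.\<close>

lemma cubic_exp_bound:
  fixes y :: real
  assumes "0 < y"
  shows "(y ^ 2 + y ^ 3) * exp (- (y / 4)) \<le> 3456 * sqrt y"
proof (cases "y \<le> 1")
  case True
  have y1: "y \<le> sqrt y" using assms True by (simp add: real_le_rsqrt power2_eq_square mult_left_le)
  have "y ^ 2 \<le> y ^ 1" "y ^ 3 \<le> y ^ 1" using assms True by (intro power_decreasing; simp)+
  then have "y ^ 2 + y ^ 3 \<le> 2 * sqrt y" using y1 by simp
  moreover have "exp (- (y / 4)) \<le> 1" using assms by simp
  ultimately have "(y ^ 2 + y ^ 3) * exp (- (y / 4)) \<le> (2 * sqrt y) * 1"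
    using assms by (intro mult_mono) auto
  also have "\<dots> \<le> 3456 * sqrt y" using assms by simp
  finally show ?thesis .
next
  case False
  have "y / 12 \<le> exp (y / 12)" using exp_ge_add_one_self[of "y / 12"] by linarith
  then have "(y / 12) ^ 3 \<le> exp (y / 12) ^ 3" using assms by (intro power_mono) auto
  also have "\<dots> = exp (y / 4)" by (simp add: power3_eq_cube flip: exp_add)
  finally have "y ^ 3 \<le> 1728 * exp (y / 4)" by (simp add: power_divide)
  moreover have "y ^ 2 \<le> y ^ 3" using False by (intro power_increasing) auto
  ultimately have "y ^ 2 + y ^ 3 \<le> 3456 * exp (y / 4)" by simp
  then have "(y ^ 2 + y ^ 3) * exp (- (y / 4)) \<le> 3456 * exp (y / 4) * exp (- (y / 4))"
    by (rule mult_right_mono) simp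
  also have "\<dots> = 3456 * 1" by (simp add: mult.assoc flip: exp_add)
  also have "\<dots> \<le> 3456 * sqrt y" using False by (intro mult_left_mono) auto
  finally show ?thesis .
qed

lemma filterlim_Re_major_arc: "filterlim Re (at_right 0) (at 0 within major_arc)"
proof -
  have "((\<lambda>t. Re t) \<longlongrightarrow> Re 0) (at 0 within major_arc)" by (intro tendsto_intros)
  then show ?thesis
    by (auto simp: filterlim_at eventually_at_filter major_arc_def)
qed

text \<open>Compared with the telescoping series every error term gains a factor \<open>x^n\<close>
  or \<open>x^(2n) / a\<close>. Since \<open>norm (R n) ^ 2\<close> suppresses the range where
  \<open>x^n\<close> exceeds \<open>a\<close>, this gain is of size \<open>a\<close> where it
  counts, and the errors add up to \<open>O(sqrt a)\<close>.\<close>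

lemma major_peak_sum_tendsto:
  "((\<lambda>t. (euler (exp (- t)))\<^sup>2 * (t ^ (2 * r) * peak_sum r (exp (- t)))) \<longlongrightarrow> hsym_inf (\<lambda>j. 1 / of_nat j ^ 2) r / 3) (at 0 within major_arc)"
proof -
  define F where "F = at 0 within major_arc"
  define K2 where "K2 = exp 2 + (2::real)"
  define K3 where "K3 = 3 * 8 ^ r * (exp 2) ^ 3 * K2"
  have K2: "K2 \<ge> 1" by (simp add: K2_def add_increasing)
  define H where "H t = hsym_inf (\<lambda>j. t\<^sup>2 * lambert (exp (- t)) j) r" for t
  define err where "err a = 3456 * K3 * (a\<^sup>2 / sqrt a) / (1 - exp (- (a / 2)))" for a
  have main: "eventually (\<lambda>t. norm ((euler (exp (- t)))\<^sup>2 * (t ^ (2 * r) * peak_sum r (exp (- t))) -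
       H t * ((1 - euler (exp (- t)) ^ 3) / 3)) \<le> err (Re t) \<and>
       norm (euler (exp (- t))) \<le> exp 2 * exp (- (1 / Re t / 8))) F"
  proof -
    have "eventually (\<lambda>t. t \<in> major_arc) F" by (auto simp: F_def eventually_at_filter)
    then show ?thesis using major_qtail_bounds[folded F_def]
    proof eventually_elim
      case (elim t)
      define a where "a = Re t"
      define x where "x = exp (- a)"
      define s where "s = exp (- (a / 2))"
      define q where "q = exp (- t)"
      define R where "R n = qtail n q" for n
      define h where "h n = hsym (\<lambda>j. t\<^sup>2 * lambert q j) r n" for n
      have trc: "t \<in> sector" using elim major_subset_sector by auto
      have a: "0 < a" using elim by (auto simp: major_arc_def a_def)
      have x: "0 < x" "x < 1" using a by (auto simp: x_def)
      have s: "0 < s" "s < 1" "x = s * s" using a by (auto simp: s_def x_def simp flip: exp_add)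
      have nq: "norm q = x" by (simp add: x_def q_def a_def)
      have q: "norm q < 1" using x nq by simp
      have B1: "norm (R n) \<le> exp 2 * exp (- (x ^ n / a / 8))"
        and B2: "norm (R n / R (2 * n)) \<le> exp 2"
        and B3: "norm (1 - R n) \<le> K2 * (x ^ n / a)" for n
        using elim(2)[rule_format, of n] by (auto simp: R_def q_def x_def a_def K2_def)
      have B1': "norm (R n) \<le> exp 2" for n
      proof -
        have "exp (- (x ^ n / a / 8)) \<le> 1" using x a by simp
        then have "exp 2 * exp (- (x ^ n / a / 8)) \<le> exp 2 * 1" by (intro mult_left_mono) auto
        then show ?thesis using B1[of n] by linarith
      qed
      have B1sq: "norm (R n) ^ 2 \<le> (exp 2)\<^sup>2 * exp (- (x ^ n / a / 4))" for n
      proof -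
        have "norm (R n) ^ 2 \<le> (exp 2 * exp (- (x ^ n / a / 8)))\<^sup>2" using B1 by (intro power_mono) auto
        also have "\<dots> = (exp 2)\<^sup>2 * exp (- (x ^ n / a / 4))"
          by (simp add: power_mult_distrib power2_eq_square flip: exp_add)
        finally show ?thesis .
      qed
      have hH: "norm (H t - h n) \<le> x ^ n * 8 ^ r" for n
      proof -
        have "norm (H t - h n) \<le> x ^ n * (2 * 4) ^ r"
          unfolding H_def h_def q_def[symmetric]
        proof (rule hsym_diff_le)
          show "norm (t\<^sup>2 * lambert q (n + j)) \<le> x ^ n * 4 / real j ^ 2" if "1 \<le> j" for j
            using norm_scaled_lambert_shift_le[OF trc that, of n] by (simp add: q_def x_def a_def)
          show "norm (t\<^sup>2 * lambert q j) \<le> 4 / real j ^ 2" if "1 \<le> j" for j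
            using norm_scaled_lambert_le[OF trc that] by (simp add: q_def)
        qed (use x in auto)
        then show ?thesis by simp
      qed
      have Hb: "norm (H t) \<le> 8 ^ r"
        using norm_hsym_inf_le[of "\<lambda>j. t\<^sup>2 * lambert q j" 4 r] norm_scaled_lambert_le[OF trc] by (simp add: H_def q_def)
      define T where "T n = q ^ n * (R n ^ 3 / R (2 * n)) * h n" for n
      \<comment> \<open>For positive \<open>n\<close> this is
        \<open>(R n ^ 3 - R (n - 1) ^ 3) / 3\<close>, because
        \<open>R (n - 1) = R n * (1 - q ^ n)\<close>.\<close>
      define U where "U n = q ^ n * R n ^ 3 * (1 - q ^ n + q ^ (2 * n) / 3)" for n
      have Rnz: "R n \<noteq> 0" for n using qpoch_nonzero[OF q] euler_nonzero[OF q] by (simp add: R_def qtail_def)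
      have D: "norm (T n - U n * H t) \<le> 3456 * K3 * (a\<^sup>2 / sqrt a) * s ^ n" for n
      proof -
        \<comment> \<open>Three replacements: \<open>h n\<close> by its limit \<open>H t\<close>,
          the denominator \<open>R (2 * n)\<close> by 1, and the leading factor \<open>q ^ n\<close>
          by the telescoping one.\<close>
        have eq: "T n - U n * H t = q ^ n * (R n)\<^sup>2 * (R n / R (2 * n)) * (h n - H t)
            + H t * q ^ n * (R n)\<^sup>2 * (R n / R (2 * n)) * (1 - R (2 * n))
            + H t * q ^ n * (R n)\<^sup>2 * R n * (q ^ n - q ^ (2 * n) / 3)"
          using Rnz[of "2 * n"] by (simp add: T_def U_def field_simps power2_eq_square power3_eq_cube)
        define Z where "Z = x ^ n * norm (R n) ^ 2"
        have Z0: "0 \<le> Z" using x by (simp add: Z_def)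
        have 1: "norm (q ^ n * (R n)\<^sup>2 * (R n / R (2 * n)) * (h n - H t)) \<le> Z * exp 2 * (x ^ n * 8 ^ r)"
          unfolding norm_mult norm_power nq Z_def[symmetric]
          using B2[of n] hH[of n] Z0 by (intro mult_mono) (auto simp: norm_minus_commute)
        have 2: "norm (H t * q ^ n * (R n)\<^sup>2 * (R n / R (2 * n)) * (1 - R (2 * n)))
            \<le> 8 ^ r * Z * exp 2 * (K2 * (x ^ (2 * n) / a))"
        proof -
          have "norm (H t * q ^ n * (R n)\<^sup>2 * (R n / R (2 * n)) * (1 - R (2 * n))) =
             norm (H t) * Z * norm (R n / R (2 * n)) * norm (1 - R (2 * n))"
            by (simp add: norm_mult norm_power nq Z_def norm_divide)
          also have "\<dots> \<le> 8 ^ r * Z * exp 2 * (K2 * (x ^ (2 * n) / a))"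
            using Hb B2[of n] B3[of "2 * n"] Z0 by (intro mult_mono) auto
          finally show ?thesis .
        qed
        have 3: "norm (H t * q ^ n * (R n)\<^sup>2 * R n * (q ^ n - q ^ (2 * n) / 3)) \<le> 8 ^ r * Z * exp 2 * (2 * x ^ n)"
        proof -
          have "norm (q ^ n - q ^ (2 * n) / 3) \<le> norm (q ^ n) + norm (q ^ (2 * n) / 3)" by (rule norm_triangle_ineq4)
          also have "\<dots> = x ^ n + x ^ (2 * n) / 3" by (simp add: norm_divide norm_power nq)
          also have "x ^ (2 * n) \<le> x ^ n" using x by (intro power_decreasing) auto
          finally have b: "norm (q ^ n - q ^ (2 * n) / 3) \<le> 2 * x ^ n"
            using zero_less_power[OF x(1), of n] by linarith
          have "norm (H t * q ^ n * (R n)\<^sup>2 * R n * (q ^ n - q ^ (2 * n) / 3)) =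
             norm (H t) * Z * norm (R n) * norm (q ^ n - q ^ (2 * n) / 3)"
            by (simp add: norm_mult norm_power nq Z_def)
          also have "\<dots> \<le> 8 ^ r * Z * exp 2 * (2 * x ^ n)"
            using Hb B1'[of n] b Z0 by (intro mult_mono) auto
          finally show ?thesis .
        qed
        have "norm (T n - U n * H t) \<le> Z * exp 2 * (x ^ n * 8 ^ r) + 8 ^ r * Z * exp 2 * (K2 * (x ^ (2 * n) / a))
            + 8 ^ r * Z * exp 2 * (2 * x ^ n)"
          unfolding eq by (intro order_trans[OF norm_triangle_ineq] add_mono 1 2 3)
        also have "\<dots> = 8 ^ r * exp 2 * Z * (3 * x ^ n + K2 * (x ^ (2 * n) / a))" by (simp add: algebra_simps)
        also have "\<dots> \<le> 8 ^ r * exp 2 * Z * (3 * K2 * (x ^ n + x ^ (2 * n) / a))"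
        proof (intro mult_left_mono)
          have "3 * x ^ n \<le> 3 * K2 * x ^ n" using K2 x by (intro mult_right_mono) auto
          moreover have "K2 * (x ^ (2 * n) / a) \<le> 3 * K2 * (x ^ (2 * n) / a)"
            using K2 x a by (intro mult_right_mono) auto
          ultimately show "3 * x ^ n + K2 * (x ^ (2 * n) / a) \<le> 3 * K2 * (x ^ n + x ^ (2 * n) / a)"
            by (simp add: algebra_simps)
        qed (use Z0 in auto)
        also have "\<dots> \<le> 8 ^ r * exp 2 * (x ^ n * ((exp 2)\<^sup>2 * exp (- (x ^ n / a / 4)))) * (3 * K2 * (x ^ n + x ^ (2 * n) / a))"
          unfolding Z_def using B1sq[of n] x K2 a by (intro mult_right_mono mult_left_mono) auto
        also have "\<dots> = K3 * (x ^ n * (x ^ n + x ^ (2 * n) / a) * exp (- (x ^ n / a / 4)))"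
          by (simp add: K3_def power3_eq_cube power2_eq_square mult_ac)
        \<comment> \<open>In terms of \<open>y = x^n / a\<close> the bound becomes
          \<open>a^2 (y^2 + y^3) exp (-y/4)\<close>, the form of
          \<open>cubic_exp_bound\<close>.\<close>
        also have "x ^ n * (x ^ n + x ^ (2 * n) / a) = a\<^sup>2 * ((x ^ n / a) ^ 2 + (x ^ n / a) ^ 3)"
          unfolding power_even_eq using a by (simp add: power_divide power2_eq_square power3_eq_cube field_simps)
        also have "K3 * (a\<^sup>2 * ((x ^ n / a) ^ 2 + (x ^ n / a) ^ 3) * exp (- (x ^ n / a / 4))) =
            K3 * a\<^sup>2 * (((x ^ n / a) ^ 2 + (x ^ n / a) ^ 3) * exp (- (x ^ n / a / 4)))" by (simp add: mult_ac)
        also have "\<dots> \<le> K3 * a\<^sup>2 * (3456 * sqrt (x ^ n / a))"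
          using x a K2 by (intro mult_left_mono cubic_exp_bound) (auto simp: K3_def)
        also have "sqrt (x ^ n / a) = s ^ n / sqrt a"
          using s by (simp add: real_sqrt_divide real_sqrt_power power_mult_distrib real_sqrt_mult)
        finally show ?thesis by (simp add: mult_ac)
      qed
      have U: "(\<lambda>n. U (Suc n)) sums ((1 - euler q ^ 3) / 3)"
      proof -
        have "(\<lambda>n. R n ^ 3) \<longlonglongrightarrow> 1 ^ 3" unfolding R_def by (intro tendsto_power qtail_tendsto_1 q)
        then have "(\<lambda>n. R (Suc n) ^ 3 - R n ^ 3) sums (1 ^ 3 - R 0 ^ 3)" by (rule telescope_sums)
        then have "(\<lambda>n. (R (Suc n) ^ 3 - R n ^ 3) / 3) sums ((1 ^ 3 - R 0 ^ 3) / 3)" by (rule sums_divide)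
        moreover have "(R (Suc n) ^ 3 - R n ^ 3) / 3 = U (Suc n)" for n
        proof -
          have "R n = R (Suc n) * (1 - q ^ Suc n)" unfolding R_def by (rule qtail_step[OF q])
          moreover have "(A ^ 3 - (A * (1 - y)) ^ 3) / 3 = y * A ^ 3 * (1 - y + y\<^sup>2 / 3)" for A y :: complex
            by (simp add: field_simps power2_eq_square power3_eq_cube)
          moreover have "q ^ (2 * Suc n) = (q ^ Suc n)\<^sup>2" by (rule power_even_eq)
          ultimately show ?thesis unfolding U_def by metis
        qed
        moreover have "R 0 = euler q" by (simp add: R_def qtail_def qpoch_def)
        ultimately show ?thesis by simp
      qed
      have gs: "(\<lambda>n. 3456 * K3 * (a\<^sup>2 / sqrt a) * s ^ n) sums err a"
        unfolding err_def using geometric_sums[of s] s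
        by (intro sums_mult[where c = "3456 * K3 * (a\<^sup>2 / sqrt a)", THEN back_subst[where P = "\<lambda>z. _ sums z"]])
           (auto simp: s_def)
      have D': "norm (T (Suc n) - U (Suc n) * H t) \<le> 3456 * K3 * (a\<^sup>2 / sqrt a) * s ^ n" for n
      proof -
        have "s ^ Suc n \<le> s ^ n" using s by (intro power_decreasing) auto
        then have "3456 * K3 * (a\<^sup>2 / sqrt a) * s ^ Suc n \<le> 3456 * K3 * (a\<^sup>2 / sqrt a) * s ^ n"
          using K2 a by (intro mult_left_mono) (auto simp: K3_def)
        then show ?thesis using D[of "Suc n"] by linarith
      qed
      have sD: "summable (\<lambda>n. T (Suc n) - U (Suc n) * H t)"
        by (rule summable_comparison_test'[OF sums_summable[OF gs]]) (use D' in blast)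
      have "(\<lambda>n. (T (Suc n) - U (Suc n) * H t) + U (Suc n) * H t) sums
          ((\<Sum>n. T (Suc n) - U (Suc n) * H t) + (1 - euler q ^ 3) / 3 * H t)"
        by (intro sums_add summable_sums[OF sD] sums_mult2 U)
      then have Tsums: "(\<lambda>n. T (Suc n)) sums ((\<Sum>n. T (Suc n) - U (Suc n) * H t) + (1 - euler q ^ 3) / 3 * H t)" by simp
      have T_eq: "peak_term r n q = T n / ((euler q)\<^sup>2 * t ^ (2 * r))" for n
        unfolding peak_term_eq_qtail[OF q] T_def h_def hsym_scale R_def
        using sector_nonzero[OF trc] by (simp add: power_mult)
      have "(euler q)\<^sup>2 * (t ^ (2 * r) * peak_sum r q) = (\<Sum>n. T (Suc n) - U (Suc n) * H t) + (1 - euler q ^ 3) / 3 * H t"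
      proof -
        have "peak_sum r q = ((\<Sum>n. T (Suc n) - U (Suc n) * H t) + (1 - euler q ^ 3) / 3 * H t) / ((euler q)\<^sup>2 * t ^ (2 * r))"
          unfolding peak_sum_def T_eq by (rule sums_unique[symmetric]) (rule sums_divide[OF Tsums])
        then show ?thesis using euler_nonzero[OF q] sector_nonzero[OF trc] by simp
      qed
      then have "(euler q)\<^sup>2 * (t ^ (2 * r) * peak_sum r q) - H t * ((1 - euler q ^ 3) / 3) = (\<Sum>n. T (Suc n) - U (Suc n) * H t)"
        by (simp add: mult.commute)
      also have "norm \<dots> \<le> err a"
        unfolding sums_unique[OF gs] by (rule norm_suminf_le[OF D' sums_summable[OF gs]])
      finally have "norm ((euler q)\<^sup>2 * (t ^ (2 * r) * peak_sum r q) - H t * ((1 - euler q ^ 3) / 3)) \<le> err a" .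
      moreover have "norm (euler q) \<le> exp 2 * exp (- (1 / a / 8))"
        using B1[of 0] by (simp add: R_def qtail_def qpoch_def)
      ultimately show ?case by (simp add: q_def a_def)
    qed
  qed
  have err0: "((\<lambda>t. err (Re t)) \<longlongrightarrow> 0) F"
    unfolding F_def
  proof (rule filterlim_compose[OF _ filterlim_Re_major_arc])
    have "((\<lambda>a::real. (a\<^sup>2 / sqrt a) / (1 - exp (- (a / 2)))) \<longlongrightarrow> 0) (at_right 0)" by real_asymp
    from tendsto_mult_left[OF this, of "3456 * K3"]
    show "(err \<longlongrightarrow> 0) (at_right 0)" by (simp add: err_def [abs_def])
  qed
  have euler0: "((\<lambda>t. euler (exp (- t))) \<longlongrightarrow> 0) F"
  proof (rule Lim_null_comparison)
    show "eventually (\<lambda>t. norm (euler (exp (- t))) \<le> exp 2 * exp (- (1 / Re t / 8))) F"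
      using main by eventually_elim simp
    have "((\<lambda>a::real. exp 2 * exp (- (1 / a / 8))) \<longlongrightarrow> 0) (at_right 0)" by real_asymp
    then show "((\<lambda>t. exp 2 * exp (- (1 / Re t / 8))) \<longlongrightarrow> 0) F"
      unfolding F_def by (rule filterlim_compose[OF _ filterlim_Re_major_arc])
  qed
  have H0: "(H \<longlongrightarrow> hsym_inf (\<lambda>j. 1 / of_nat j ^ 2) r) F"
    unfolding F_def H_def [abs_def]
    by (rule tendsto_within_subset[OF scaled_hsym_inf_tendsto major_subset_sector])
  have "((\<lambda>t. (euler (exp (- t)))\<^sup>2 * (t ^ (2 * r) * peak_sum r (exp (- t))) - H t * ((1 - euler (exp (- t)) ^ 3) / 3)) \<longlongrightarrow> 0) F"
    by (rule Lim_null_comparison[OF _ err0]) (use main in \<open>auto elim: eventually_mono\<close>)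
  moreover have "((\<lambda>t. H t * ((1 - euler (exp (- t)) ^ 3) / 3)) \<longlongrightarrow> hsym_inf (\<lambda>j. 1 / of_nat j ^ 2) r * ((1 - 0 ^ 3) / 3)) F"
    by (intro tendsto_intros H0 euler0) auto
  ultimately show ?thesis
    using tendsto_add by (fastforce simp: F_def)
qed

theorem major_peak_sum_asymptotics:
  "((\<lambda>t. t ^ (2 * r) * peak_sum r (exp (- t)) / (t * exp (of_real (pi\<^sup>2) / (3 * t)))) \<longlongrightarrow>
      hsym_inf (\<lambda>j. 1 / of_nat j ^ 2) r / of_real (6 * pi)) (at 0 within major_arc)"
proof -
  have "((\<lambda>t. (euler (exp (- t)))\<^sup>2 * (t ^ (2 * r) * peak_sum r (exp (- t))) /
       ((euler (exp (- t)))\<^sup>2 * t * exp (of_real (pi\<^sup>2) / (3 * t)))) \<longlongrightarrow>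
      (hsym_inf (\<lambda>j. 1 / of_nat j ^ 2) r / 3) / of_real (2 * pi)) (at 0 within major_arc)"
    by (intro tendsto_divide major_peak_sum_tendsto
        tendsto_within_subset[OF euler_square_asymptotics major_subset_sector]) auto
  moreover have "eventually (\<lambda>t. (euler (exp (- t)))\<^sup>2 * (t ^ (2 * r) * peak_sum r (exp (- t))) /
       ((euler (exp (- t)))\<^sup>2 * t * exp (of_real (pi\<^sup>2) / (3 * t))) =
       t ^ (2 * r) * peak_sum r (exp (- t)) / (t * exp (of_real (pi\<^sup>2) / (3 * t)))) (at 0 within major_arc)"
    unfolding eventually_at_filter
  proof (rule always_eventually, safe)
    fix t assume "t \<in> major_arc"
    then have "norm (exp (- t)) < 1" by (auto simp: major_arc_def)
    then have "euler (exp (- t)) \<noteq> 0" by (rule euler_nonzero)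
    then show "(euler (exp (- t)))\<^sup>2 * (t ^ (2 * r) * peak_sum r (exp (- t))) /
       ((euler (exp (- t)))\<^sup>2 * t * exp (of_real (pi\<^sup>2) / (3 * t))) =
       t ^ (2 * r) * peak_sum r (exp (- t)) / (t * exp (of_real (pi\<^sup>2) / (3 * t)))" by simp
  qed
  ultimately show ?thesis by (auto dest: Lim_transform_eventually)
qed

section \<open>The minor arc\<close>

lemma gauss_binom_mult_qpoch:
  fixes q :: "'a::comm_ring_1"
  shows "k \<le> n \<Longrightarrow> gauss_binom q n k * qpoch k q * qpoch (n - k) q = qpoch n q"
proof (induction n arbitrary: k)
  case 0
  then show ?case by (simp add: qpoch_def)
next
  case (Suc n)
  show ?case
  proof (cases k)
    case 0
    then show ?thesis by (simp add: qpoch_def)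
  next
    case (Suc j)
    then have j: "j \<le> n" using Suc.prems by simp
    have qpS: "qpoch (Suc m) q = qpoch m q * (1 - q ^ Suc m)" for m by (simp add: qpoch_def)
    have 1: "gauss_binom q n j * qpoch (Suc j) q * qpoch (n - j) q = qpoch n q * (1 - q ^ Suc j)"
    proof -
      have "gauss_binom q n j * qpoch (Suc j) q * qpoch (n - j) q =
         (gauss_binom q n j * qpoch j q * qpoch (n - j) q) * (1 - q ^ Suc j)" by (simp only: qpS mult_ac)
      then show ?thesis by (simp only: Suc.IH[OF j])
    qed
    have 2: "gauss_binom q n (Suc j) * qpoch (Suc j) q * qpoch (n - j) q = qpoch n q * (1 - q ^ (n - j))"
    proof (cases "j = n")
      case True
      have "gauss_binom q n (Suc n) = 0" by (rule gauss_binom_eq_0) simp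
      then show ?thesis using True by simp
    next
      case False
      then have s: "Suc j \<le> n" "n - j = Suc (n - Suc j)" using j by auto
      have "qpoch (n - j) q = qpoch (n - Suc j) q * (1 - q ^ (n - j))" unfolding s(2) by (rule qpS)
      then have "gauss_binom q n (Suc j) * qpoch (Suc j) q * qpoch (n - j) q =
         (gauss_binom q n (Suc j) * qpoch (Suc j) q * qpoch (n - Suc j) q) * (1 - q ^ (n - j))" by (simp only: mult_ac)
      then show ?thesis by (simp only: Suc.IH[OF s(1)])
    qed
    have "gauss_binom q (Suc n) k * qpoch k q * qpoch (Suc n - k) q =
        gauss_binom q n j * qpoch (Suc j) q * qpoch (n - j) q + q ^ Suc j * (gauss_binom q n (Suc j) * qpoch (Suc j) q * qpoch (n - j) q)"
      by (simp add: Suc algebra_simps)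
    also have "\<dots> = qpoch n q * (1 - q ^ Suc j * q ^ (n - j))" unfolding 1 2 by (simp add: algebra_simps)
    also have "q ^ Suc j * q ^ (n - j) = q ^ Suc n" using j by (simp flip: power_add power_Suc)
    finally show ?thesis by (simp only: qpS)
  qed
qed

lemma norm_gauss_binom_le: "norm (gauss_binom q n k) \<le> gauss_binom (norm q) n k" for q :: complex
proof (induction q n k rule: gauss_binom.induct)
  case (3 q n k)
  have "norm (gauss_binom q (Suc n) (Suc k)) \<le> norm (gauss_binom q n k) + norm (q ^ Suc k * gauss_binom q n (Suc k))"
    unfolding gauss_binom.simps by (rule norm_triangle_ineq)
  also have "\<dots> \<le> gauss_binom (norm q) n k + norm q ^ Suc k * gauss_binom (norm q) n (Suc k)"
    unfolding norm_mult norm_power using 3 by (intro add_mono mult_left_mono) auto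
  finally show ?case by simp
qed auto

lemma qpoch_real_pos:
  fixes x :: real
  assumes "0 \<le> x" "x < 1"
  shows "0 < qpoch n x"
  unfolding qpoch_def
proof (rule prod_pos)
  fix j assume "j \<in> {1..n}"
  then have "x ^ j \<le> x ^ 1" using assms by (intro power_decreasing) auto
  then show "0 < 1 - x ^ j" using assms by simp
qed

lemma qpoch_of_real: "qpoch n (of_real x :: complex) = of_real (qpoch n x)"
  by (simp add: qpoch_def)

text \<open>With \<open>r\<close> the modulus of \<open>exp (- t) ^ j\<close> and \<open>m\<close>
  that of the factor, the law of cosines gives \<open>(1 - r)^2 = m^2 - 2r (1 - cos)\<close>. Since
  \<open>m^2 <= 4\<close>, the subtracted term can be absorbed as a factor
  \<open>1 - r (1 - cos) / 2\<close> of \<open>m^2\<close>.\<close>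

lemma one_minus_power_le:
  assumes t: "0 < Re t" and j: "1 \<le> j"
  shows "1 - exp (- Re t) ^ j \<le> norm (1 - exp (- t) ^ j) * exp (- (exp (- Re t) ^ j * (1 - cos (real j * Im t)) / 4))"
proof -
  define r where "r = exp (- Re t) ^ j"
  define c where "c = cos (real j * Im t)"
  define m where "m = norm (1 - exp (- t) ^ j)"
  have r: "0 < r" "r \<le> 1" using t by (auto simp: r_def intro!: power_le_one)
  have c: "c \<le> 1" by (simp add: c_def)
  have m0: "0 \<le> m" by (simp add: m_def)
  have m2: "m\<^sup>2 = 1 - 2 * r * c + r\<^sup>2" unfolding m_def r_def c_def by (rule norm_one_minus_exp_power)
  have m4: "m\<^sup>2 \<le> 4"
  proof -
    have "m \<le> 1 + r" using norm_triangle_ineq4[of 1 "exp (- t) ^ j"] by (simp add: m_def r_def norm_power)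
    then have "m\<^sup>2 \<le> 2\<^sup>2" using m0 r by (intro power_mono) auto
    then show ?thesis by simp
  qed
  have "(1 - r)\<^sup>2 = m\<^sup>2 - 2 * r * (1 - c)" unfolding m2 by (simp add: power2_eq_square algebra_simps)
  also have "2 * r * (1 - c) \<ge> m\<^sup>2 * (r * (1 - c) / 2)"
    using m4 r c mult_right_mono[of "m\<^sup>2" 4 "r * (1 - c) / 2"] by simp
  then have "m\<^sup>2 - 2 * r * (1 - c) \<le> m\<^sup>2 * (1 + (- (r * (1 - c) / 2)))" by (simp add: algebra_simps)
  also have "\<dots> \<le> m\<^sup>2 * exp (- (r * (1 - c) / 2))" by (intro mult_left_mono exp_ge_add_one_self) auto
  also have "\<dots> = (m * exp (- (r * (1 - c) / 4)))\<^sup>2"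
    by (simp add: power_mult_distrib power2_eq_square flip: exp_add)
  finally have "1 - r \<le> m * exp (- (r * (1 - c) / 4))" by (rule power2_le_imp_le) (simp add: m0)
  then show ?thesis by (simp add: r_def c_def m_def)
qed

lemma inverse_norm_qpoch_le:
  assumes t: "0 < Re t"
  shows "1 / norm (qpoch n (exp (- t))) \<le>
    exp (- ((\<Sum>j=1..n. exp (- Re t) ^ j * (1 - cos (real j * Im t))) / 4)) / qpoch n (exp (- Re t))"
proof -
  let ?e = "\<lambda>j. exp (- Re t) ^ j * (1 - cos (real j * Im t)) / 4"
  have q: "norm (exp (- t)) < 1" using t by simp
  have "qpoch n (exp (- Re t)) \<le> (\<Prod>j=1..n. norm (1 - exp (- t) ^ j) * exp (- ?e j))"
    unfolding qpoch_def using t by (intro prod_mono) (auto intro!: one_minus_power_le power_le_one)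
  also have "\<dots> = norm (qpoch n (exp (- t))) * exp (- (\<Sum>j=1..n. ?e j))"
    by (simp add: prod.distrib prod_norm qpoch_def sum_negf flip: exp_sum)
  finally have "qpoch n (exp (- Re t)) \<le> norm (qpoch n (exp (- t))) * exp (- (\<Sum>j=1..n. ?e j))" .
  moreover have "0 < qpoch n (exp (- Re t))" using t by (intro qpoch_real_pos) auto
  moreover have "0 < norm (qpoch n (exp (- t)))" using qpoch_nonzero[OF q] by simp
  ultimately show ?thesis by (simp add: field_simps sum_divide_distrib)
qed

text \<open>The exponential is kept on purpose: for \<open>n\<close> well below \<open>1/a\<close>
  the phases of \<open>1 / (q)_n\<close> give too little, and the saving has to come from the
  tails.\<close>

lemma qpoch_real_quotient_le:
  assumes a: "0 < a"
  shows "qpoch (2 * n) (exp (- a)) / qpoch n (exp (- a)) ^ 3 \<le>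
     exp (- (2 * (exp (- a) ^ Suc n / (1 - exp (- a))))) / (norm (euler (exp (- of_real a))))\<^sup>2"
proof -
  define x where "x = exp (- a)"
  define q where "q = complex_of_real x"
  have x: "0 < x" "x < 1" using a by (auto simp: x_def)
  have q: "norm q < 1" using x by (simp add: q_def)
  have q_eq: "exp (- of_real a) = q" by (simp add: q_def x_def exp_of_real[symmetric])
  have pos: "0 < qpoch m x" for m using x by (intro qpoch_real_pos) auto
  have np: "norm (qpoch m q) = qpoch m x" for m using pos[of m] by (simp add: q_def qpoch_of_real)
  have pi0: "0 < norm (euler q)" using euler_nonzero[OF q] by simp
  have R: "norm (euler q) / qpoch n x \<le> exp (- (x ^ Suc n / (1 - x)))"
  proof -
    have "norm (qtail n q) \<le> exp (- (x ^ Suc n / (1 - x)))"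
    proof (rule tendsto_le[OF _ tendsto_exp[OF tendsto_minus[OF geometric_tail_sums]] tendsto_norm[OF qtail_LIMSEQ[OF q]]])
      have "norm (\<Prod>j=Suc n..m. 1 - q ^ j) \<le> exp (- (\<Sum>j=Suc n..m. x ^ j))" for m
      proof -
        have "norm (\<Prod>j=Suc n..m. 1 - q ^ j) = (\<Prod>j=Suc n..m. 1 - x ^ j)"
        proof -
          have "norm (1 - q ^ j) = 1 - x ^ j" for j
          proof -
            have "1 - q ^ j = of_real (1 - x ^ j)" by (simp add: q_def)
            moreover have "x ^ j \<le> 1" using x by (intro power_le_one) auto
            ultimately show ?thesis by (simp only: norm_of_real)
          qed
          then show ?thesis by (simp add: prod_norm[symmetric])
        qed
        also have "\<dots> \<le> (\<Prod>j=Suc n..m. exp (- (x ^ j)))"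
        proof (intro prod_mono conjI)
          fix j
          show "0 \<le> 1 - x ^ j" using x by (simp add: power_le_one)
          show "1 - x ^ j \<le> exp (- (x ^ j))" using exp_ge_add_one_self[of "- (x ^ j)"] by simp
        qed
        finally show ?thesis by (simp add: sum_negf flip: exp_sum)
      qed
      then show "eventually (\<lambda>m. norm (\<Prod>j=Suc n..m. 1 - q ^ j) \<le> exp (- (\<Sum>j=Suc n..m. x ^ j))) sequentially" by simp
    qed (use x in auto)
    then show ?thesis by (simp add: qtail_def norm_divide np)
  qed
  have mono: "qpoch (2 * n) x \<le> qpoch n x"
  proof -
    have "qpoch (2 * n) x = qpoch n x * (\<Prod>j=Suc n..2*n. 1 - x ^ j)" by (rule qpoch_split) simp
    also have "\<dots> \<le> qpoch n x * 1"
      using pos[of n] x by (intro mult_left_mono prod_le_1) (auto intro!: power_le_one)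
    finally show ?thesis by simp
  qed
  have "qpoch (2 * n) x / qpoch n x ^ 3 = (qpoch (2 * n) x / qpoch n x) * ((norm (euler q) / qpoch n x)\<^sup>2 / (norm (euler q))\<^sup>2)"
    using pos[of n] pi0 by (simp add: power2_eq_square power3_eq_cube)
  also have "\<dots> \<le> 1 * ((exp (- (x ^ Suc n / (1 - x))))\<^sup>2 / (norm (euler q))\<^sup>2)"
    using mono pos[of n] pos[of "2 * n"] R pi0
    by (intro mult_mono divide_right_mono power_mono) auto
  also have "(exp (- (x ^ Suc n / (1 - x))))\<^sup>2 = exp (- (2 * (x ^ Suc n / (1 - x))))"
    by (simp add: power2_eq_square flip: exp_add)
  finally show ?thesis by (simp add: x_def[symmetric] q_eq)
qed

text \<open>The quotient is split into a Gaussian binomial coefficient and \<open>1 / (q)_n\<close>: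
  the first is bounded by its value at \<open>|q|\<close>, the second gains from its phases, and the
  values at \<open>|q|\<close> recombine to the real quotient.\<close>

lemma norm_peak_term_le:
  assumes t: "0 < Re t"
  shows "norm (peak_term r n (exp (- t))) \<le> exp (- Re t) ^ n * (2 / (Re t)\<^sup>2) ^ r / (norm (euler (exp (- of_real (Re t)))))\<^sup>2 *
     exp (- ((\<Sum>j=1..n. exp (- Re t) ^ j * (1 - cos (real j * Im t))) / 4) - 2 * (exp (- Re t) ^ Suc n / (1 - exp (- Re t))))"
proof -
  define x where "x = exp (- Re t)"
  define q where "q = exp (- t)"
  define S where "S = (\<Sum>j=1..n. x ^ j * (1 - cos (real j * Im t))) / 4"
  have x: "0 < x" "x < 1" and nq: "norm q = x" using t by (auto simp: x_def q_def)
  have q: "norm q < 1" using x nq by simp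
  have pos: "0 < qpoch m x" for m using x by (intro qpoch_real_pos) auto
  have nz: "qpoch n q \<noteq> 0" by (rule qpoch_nonzero[OF q])
  have gb: "gauss_binom q (2 * n) n * qpoch n q * qpoch n q = qpoch (2 * n) q"
    using gauss_binom_mult_qpoch[of n "2 * n" q] by simp
  have gbx: "gauss_binom x (2 * n) n * qpoch n x * qpoch n x = qpoch (2 * n) x"
    using gauss_binom_mult_qpoch[of n "2 * n" x] by simp
  have "peak_term r n q = q ^ n * gauss_binom q (2 * n) n * (1 / qpoch n q) * hsym (lambert q) r n"
    unfolding peak_term_def gb[symmetric] using nz by (simp add: power3_eq_cube)
  then have "norm (peak_term r n q) = x ^ n * norm (gauss_binom q (2 * n) n) * (1 / norm (qpoch n q)) * norm (hsym (lambert q) r n)"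
    by (simp add: norm_mult norm_power norm_divide nq)
  also have "\<dots> \<le> x ^ n * gauss_binom x (2 * n) n * (exp (- S) / qpoch n x) * (2 / (Re t)\<^sup>2) ^ r"
  proof (intro mult_mono)
    show "norm (gauss_binom q (2 * n) n) \<le> gauss_binom x (2 * n) n"
      using norm_gauss_binom_le[of q "2 * n" n] by (simp add: nq)
    show "1 / norm (qpoch n q) \<le> exp (- S) / qpoch n x"
      using inverse_norm_qpoch_le[OF t, of n] by (simp add: x_def q_def S_def)
    have "norm (hsym (lambert q) r n) \<le> (2 * (1 / (Re t)\<^sup>2)) ^ r"
      unfolding q_def by (rule norm_hsym_le) (use norm_lambert_le[OF t] in auto)
    then show "norm (hsym (lambert q) r n) \<le> (2 / (Re t)\<^sup>2) ^ r" by simp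
    show "0 \<le> x ^ n * gauss_binom x (2 * n) n"
      using x order_trans[OF norm_ge_zero norm_gauss_binom_le[of q "2 * n" n]] nq by simp
    show "0 \<le> x ^ n * gauss_binom x (2 * n) n * (exp (- S) / qpoch n x)"
      using x pos[of n] order_trans[OF norm_ge_zero norm_gauss_binom_le[of q "2 * n" n]] nq by simp
  qed (use x in auto)
  also have "\<dots> = x ^ n * (2 / (Re t)\<^sup>2) ^ r * exp (- S) * (qpoch (2 * n) x / qpoch n x ^ 3)"
    unfolding gbx[symmetric] using pos[of n] by (simp add: power3_eq_cube)
  also have "\<dots> \<le> x ^ n * (2 / (Re t)\<^sup>2) ^ r * exp (- S) *
      (exp (- (2 * (x ^ Suc n / (1 - x)))) / (norm (euler (exp (- of_real (Re t)))))\<^sup>2)"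
    using qpoch_real_quotient_le[OF t, of n] x by (intro mult_left_mono) (auto simp: x_def[symmetric])
  also have "\<dots> = x ^ n * (2 / (Re t)\<^sup>2) ^ r / (norm (euler (exp (- of_real (Re t)))))\<^sup>2 *
      exp (- S - 2 * (x ^ Suc n / (1 - x)))"
    by (simp add: exp_diff exp_minus divide_inverse)
  finally show ?thesis by (simp add: x_def q_def S_def)
qed

section \<open>Lower bounds for sums of \<open>1 - cos\<close>\<close>

lemma sin_ge_half:
  fixes x :: real
  assumes "\<bar>x\<bar> \<le> pi / 2"
  shows "(x / 2)\<^sup>2 \<le> (sin x)\<^sup>2"
proof -
  have pos: "y / 2 \<le> sin y" if y: "0 \<le> y" "y \<le> pi / 2" for y :: real
  proof -
    have "(\<lambda>y::real. sin y - y + y ^ 3 / 6) 0 \<le> (\<lambda>y. sin y - y + y ^ 3 / 6) y"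
    proof (rule DERIV_nonneg_imp_nondecreasing[OF y(1)])
      fix z :: real
      show "\<exists>d. ((\<lambda>y. sin y - y + y ^ 3 / 6) has_real_derivative d) (at z) \<and> 0 \<le> d"
        using cos_ge_quadratic[of z]
        by (intro exI[of _ "cos z - 1 + z\<^sup>2 / 2"]) (auto intro!: derivative_eq_intros)
    qed
    then have 1: "y - y ^ 3 / 6 \<le> sin y" by simp
    have "y\<^sup>2 \<le> (1.6)\<^sup>2" using y pi_approx by (intro power_mono) auto
    then have "y * y\<^sup>2 \<le> y * 3" using y by (intro mult_left_mono) (auto simp: power2_eq_square)
    then have "y ^ 3 / 6 \<le> y / 2" by (simp add: power3_eq_cube power2_eq_square)
    then show ?thesis using 1 by linarith
  qed
  have "\<bar>x / 2\<bar> \<le> \<bar>sin x\<bar>"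
  proof (cases "0 \<le> x")
    case True
    then show ?thesis using pos[of x] assms by simp
  next
    case False
    then have "(- x) / 2 \<le> sin (- x)" using pos[of "- x"] assms by simp
    then show ?thesis using False by simp
  qed
  then show ?thesis by (simp only: abs_le_square_iff)
qed

lemma one_minus_cos_eq: "1 - cos x = 2 * (sin (x / 2))\<^sup>2" for x :: real
  using cos_double_sin[of "x / 2"] by simp

lemma one_minus_cos_ge:
  fixes x :: real
  assumes "\<bar>x\<bar> \<le> pi"
  shows "x\<^sup>2 / 8 \<le> 1 - cos x"
  using sin_ge_half[of "x / 2"] assms by (simp add: one_minus_cos_eq power2_eq_square)

text \<open>Two angles cannot both be close to multiples of \<open>2 pi\<close> unless their
  difference is. It is applied to consecutive multiples of one angle.\<close>

lemma one_minus_cos_pair: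
  fixes x y :: real
  shows "(sin ((y - x) / 2))\<^sup>2 \<le> (1 - cos x) + (1 - cos y)"
proof -
  define u where "u = x / 2"
  define v where "v = y / 2"
  have e: "(y - x) / 2 = v - u" by (simp add: u_def v_def)
  have "\<bar>sin (v - u)\<bar> \<le> \<bar>sin v\<bar> + \<bar>sin u\<bar>"
  proof -
    have "\<bar>sin v * cos u\<bar> \<le> \<bar>sin v\<bar>" "\<bar>cos v * sin u\<bar> \<le> \<bar>sin u\<bar>"
      by (auto simp: abs_mult mult_left_le mult_left_le_one_le)
    then show ?thesis unfolding sin_diff by linarith
  qed
  then have "\<bar>sin (v - u)\<bar>\<^sup>2 \<le> (\<bar>sin v\<bar> + \<bar>sin u\<bar>)\<^sup>2" by (intro power_mono) auto
  also have "\<dots> \<le> 2 * ((sin u)\<^sup>2 + (sin v)\<^sup>2)"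
    using sum_squares_bound[of "\<bar>sin v\<bar>" "\<bar>sin u\<bar>"] by (simp add: power2_sum)
  finally show ?thesis unfolding e one_minus_cos_eq u_def[symmetric] v_def[symmetric] by simp
qed

lemma sum_squares_ge: "real J ^ 3 / 3 \<le> (\<Sum>j=1..J. real j ^ 2)"
proof (induction J)
  case (Suc J)
  have "real (Suc J) ^ 3 / 3 \<le> real J ^ 3 / 3 + real (Suc J) ^ 2"
    by (simp add: power2_eq_square power3_eq_cube field_simps)
  then show ?case using Suc by simp
qed simp

text \<open>The exponent -1/3 is attained at both ends: at \<open>th = a^(4/3)\<close> the quadratic
  regime gives \<open>th^2\<close> times the cube of \<open>1/a\<close>, and for angles from
  \<open>a^(1/3)\<close> on about \<open>1/a\<close> pairs of terms are each at least of order
  \<open>a^(2/3)\<close>.\<close>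

lemma sum_one_minus_cos_ge:
  fixes a th :: real
  assumes a: "0 < a" "a < 1 / 8" and th: "a powr (4/3) \<le> \<bar>th\<bar>" "\<bar>th\<bar> \<le> pi"
  shows "a powr (-1/3) / 192 \<le> (\<Sum>j=1..nat \<lfloor>1 / a\<rfloor>. 1 - cos (real j * th))"
proof -
  define N where "N = nat \<lfloor>1 / a\<rfloor>"
  define L where "L = (\<Sum>j=1..N. 1 - cos (real j * th))"
  have th0: "0 < \<bar>th\<bar>" using th a by (smt (verit) powr_gt_zero)
  have N: "1 / a - 1 \<le> real N" "real N \<le> 1 / a"
    using a unfolding N_def by (auto simp: of_nat_nat)
  show ?thesis
  proof (cases "a powr (1/3) \<le> \<bar>th\<bar>")
    case True
    define s where "s = (sin (th / 2))\<^sup>2"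
    have N1: "1 \<le> N" using N a by (smt (verit) divide_less_eq_1 less_divide_eq_1_pos of_nat_less_iff of_nat_1 divide_le_eq_1 le_divide_eq mult_le_cancel_left_pos not_less of_nat_0 less_one)
    have s_ge: "th\<^sup>2 / 16 \<le> s" using sin_ge_half[of "th / 2"] th by (simp add: s_def power2_eq_square)
    have "(real N - 1) * s \<le> (\<Sum>j=1..<N. (1 - cos (real j * th)) + (1 - cos (real (Suc j) * th)))"
    proof -
      have "(\<Sum>j=1..<N. s) \<le> (\<Sum>j=1..<N. (1 - cos (real j * th)) + (1 - cos (real (Suc j) * th)))"
      proof (rule sum_mono)
        fix j
        have eq: "(real (Suc j) * th - real j * th) / 2 = th / 2" by (simp add: algebra_simps)
        show "s \<le> (1 - cos (real j * th)) + (1 - cos (real (Suc j) * th))"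
          using one_minus_cos_pair[where x = "real j * th" and y = "real (Suc j) * th"] unfolding eq s_def .
      qed
      then show ?thesis using N1 by (simp add: of_nat_diff)
    qed
    also have "\<dots> = (\<Sum>j=1..<N. 1 - cos (real j * th)) + (\<Sum>j=1..<N. 1 - cos (real (Suc j) * th))"
      by (rule sum.distrib)
    also have "(\<Sum>j=1..<N. 1 - cos (real (Suc j) * th)) = (\<Sum>j=Suc 1..<Suc N. 1 - cos (real j * th))"
      by (rule sum.shift_bounds_Suc_ivl[symmetric])
    also have "(\<Sum>j=1..<N. 1 - cos (real j * th)) + (\<Sum>j=Suc 1..<Suc N. 1 - cos (real j * th)) \<le> L + L"
      unfolding L_def by (intro add_mono sum_mono2) auto
    finally have "(real N - 1) * s \<le> 2 * L" by simp
    moreover have "1 / (2 * a) * (a powr (2/3) / 16) \<le> (real N - 1) * s"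
    proof (rule mult_mono)
      have "2 \<le> 1 / (2 * a)" using a by (simp add: field_simps)
      moreover have "1 / (2 * a) + 1 / (2 * a) = 1 / a" using a by (simp add: field_simps)
      ultimately show "1 / (2 * a) \<le> real N - 1" using N(1) by linarith
      have "(a powr (1/3))\<^sup>2 \<le> \<bar>th\<bar>\<^sup>2" using True by (intro power_mono) auto
      moreover have "(a powr (1/3))\<^sup>2 = a powr (2/3)" by (simp add: power2_eq_square flip: powr_add)
      ultimately have "a powr (2/3) \<le> th\<^sup>2" by simp
      then show "a powr (2/3) / 16 \<le> s" using s_ge by linarith
    next
      show "0 \<le> real N - 1" using N1 by simp
    qed simp
    moreover have "1 / (2 * a) * (a powr (2/3) / 16) = a powr (-1/3) / 32"
    proof -
      have "a powr (2/3) = a powr (1 + -1/3)" by simp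
      also have "\<dots> = a * a powr (-1/3)" unfolding powr_add using a by simp
      finally show ?thesis using a by simp
    qed
    ultimately have "a powr (-1/3) / 32 \<le> 2 * L" by linarith
    moreover have "0 < a powr (-1/3)" using a by simp
    ultimately show ?thesis unfolding L_def N_def by linarith
  next
    case False
    \<comment> \<open>Up to \<open>m\<close> the angles \<open>j * th\<close> stay within 1, where
      \<open>1 - cos\<close> is bounded below quadratically, and \<open>j\<close> does not exceed
      \<open>1/a\<close>.\<close>
    define m where "m = min (1 / a) (1 / \<bar>th\<bar>)"
    define J where "J = nat \<lfloor>m\<rfloor>"
    \<comment> \<open>Since \<open>a < 1/8\<close> gives \<open>|th| <= 1/2\<close>, the number
      \<open>m\<close> is at least 2, and rounding it down loses at most a half.\<close>
    have "(2::real) \<le> 1 / \<bar>th\<bar>"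
    proof -
      have "a powr (1/3) \<le> (1/8) powr (1/3)" using a by (intro powr_mono2) auto
      also have "(1/8::real) powr (1/3) = 1/2"
      proof -
        have "(1/8::real) = (1/2) powr 3" by (simp add: powr_numeral power3_eq_cube)
        then have "(1/8::real) powr (1/3) = (1/2) powr (3 * (1/3))" by (simp only: powr_powr)
        then show ?thesis by simp
      qed
      finally have "\<bar>th\<bar> \<le> 1/2" using False by linarith
      then show ?thesis using th0 by (simp add: field_simps)
    qed
    then have m2: "2 \<le> m" using a by (simp add: m_def field_simps)
    have J: "m / 2 \<le> real J" "real J \<le> m"
      using m2 unfolding J_def by (auto simp: of_nat_nat) linarith+
    have JN: "J \<le> N" unfolding J_def N_def m_def by (intro nat_mono floor_mono) auto
    have "th\<^sup>2 * m ^ 3 / 192 \<le> th\<^sup>2 * real J ^ 3 / 24"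
    proof -
      have "(m / 2) ^ 3 \<le> real J ^ 3" using J m2 by (intro power_mono) auto
      then have "th\<^sup>2 * (m / 2) ^ 3 \<le> th\<^sup>2 * real J ^ 3" by (intro mult_left_mono) auto
      then show ?thesis by (simp add: power_divide mult.commute)
    qed
    also have "\<dots> = th\<^sup>2 / 8 * (real J ^ 3 / 3)" by simp
    also have "\<dots> \<le> th\<^sup>2 / 8 * (\<Sum>j=1..J. real j ^ 2)" by (intro mult_left_mono sum_squares_ge) auto
    also have "\<dots> = (\<Sum>j=1..J. (real j * th)\<^sup>2 / 8)" by (simp add: sum_distrib_left power_mult_distrib mult_ac)
    also have "\<dots> \<le> (\<Sum>j=1..J. 1 - cos (real j * th))"
    proof (intro sum_mono one_minus_cos_ge)
      fix j assume "j \<in> {1..J}"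
      then have "real j \<le> 1 / \<bar>th\<bar>" using J(2) by (simp add: m_def)
      then have "real j * \<bar>th\<bar> \<le> 1" using th0 by (simp add: field_simps)
      then show "\<bar>real j * th\<bar> \<le> pi" using pi_gt3 by (simp add: abs_mult)
    qed
    also have "\<dots> \<le> L" unfolding L_def using JN by (intro sum_mono2) auto
    finally have Lge: "th\<^sup>2 * m ^ 3 / 192 \<le> L" .
    have "a powr (-1/3) \<le> th\<^sup>2 * m ^ 3"
    proof (cases "1 / a \<le> 1 / \<bar>th\<bar>")
      case True
      then have m: "m = 1 / a" by (simp add: m_def)
      have "(a powr (4/3))\<^sup>2 \<le> \<bar>th\<bar>\<^sup>2" using th by (intro power_mono) auto
      moreover have "(a powr (4/3))\<^sup>2 = a powr (8/3)" by (simp add: power2_eq_square flip: powr_add)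
      ultimately have "a powr (8/3) \<le> th\<^sup>2" by simp
      then have "a powr (8/3) * (1 / a) ^ 3 \<le> th\<^sup>2 * (1 / a) ^ 3" using a by (intro mult_right_mono) auto
      moreover have "a powr (8/3) * (1 / a) ^ 3 = a powr (-1/3)"
      proof -
        have "a powr (8/3) = a powr (-1/3 + 3)" by simp
        also have "\<dots> = a powr (-1/3) * a ^ 3" unfolding powr_add using a by (simp add: powr_numeral)
        finally show ?thesis using a by (simp add: power_divide)
      qed
      ultimately show ?thesis by (simp add: m)
    next
      case F: False
      then have m: "m = 1 / \<bar>th\<bar>" by (simp add: m_def)
      have "th\<^sup>2 * m ^ 3 = 1 / \<bar>th\<bar>" unfolding m using th0
        by (simp add: power_divide power3_eq_cube field_simps) (simp add: power2_eq_square)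
      moreover have "a powr (-1/3) = 1 / a powr (1/3)" using powr_minus_divide[of a "1/3"] by simp
      moreover have "1 / a powr (1/3) \<le> 1 / \<bar>th\<bar>" using False th0 a by (intro divide_left_mono mult_pos_pos) auto
      ultimately show ?thesis by simp
    qed
    then show ?thesis using Lge unfolding L_def N_def by linarith
  qed
qed

text \<open>If \<open>n\<close> reaches \<open>1/a\<close>, rounded down, the phases alone suffice,
  as \<open>exp (-a) ^ j >= 1/3\<close> for \<open>j <= 1/a\<close>; for smaller \<open>n\<close>
  the tail \<open>exp (-a) ^ Suc n / (1 - exp (-a))\<close> is at least \<open>1/(3a)\<close>. The
  constant is \<open>192 * 3 * 4\<close>.\<close>

lemma minor_exponent_bound:
  fixes a th :: real
  assumes a: "0 < a" "a < 1 / 8" and th: "a powr (4/3) \<le> \<bar>th\<bar>" "\<bar>th\<bar> \<le> pi"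
  shows "a powr (-1/3) / 2304 \<le> (\<Sum>j=1..n. exp (- a) ^ j * (1 - cos (real j * th))) / 4 +
     2 * (exp (- a) ^ Suc n / (1 - exp (- a)))"
proof -
  define N where "N = nat \<lfloor>1 / a\<rfloor>"
  have N: "real N \<le> 1 / a" using a unfolding N_def by (simp add: of_nat_nat)
  have x: "0 < exp (- a)" "exp (- a) < 1" "1 - exp (- a) \<le> a"
    using a exp_ge_add_one_self[of "- a"] by auto
  have e3: "1 / 3 \<le> exp (- a) ^ j" if "j \<le> N" for j
  proof -
    have "real j * a \<le> 1" using that N a by (smt (verit) le_divide_eq of_nat_mono)
    then have "exp (- 1) \<le> exp (- (real j * a))" by simp
    moreover have "exp (- (real j * a)) = exp (- a) ^ j" using exp_of_nat_mult[of j "- a"] by simp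
    moreover have "1 / 3 \<le> exp (- 1 :: real)" using exp_le by (simp add: exp_minus field_simps)
    ultimately show ?thesis by linarith
  qed
  have t1: "0 \<le> (\<Sum>j=1..n. exp (- a) ^ j * (1 - cos (real j * th)))"
    by (intro sum_nonneg mult_nonneg_nonneg) auto
  have t2: "0 \<le> 2 * (exp (- a) ^ Suc n / (1 - exp (- a)))" using x by simp
  show ?thesis
  proof (cases "N \<le> n")
    case True
    have "a powr (-1/3) / 192 / 3 \<le> (\<Sum>j=1..N. 1 - cos (real j * th)) / 3"
      using sum_one_minus_cos_ge[OF assms] unfolding N_def by simp
    also have "\<dots> = (\<Sum>j=1..N. 1 / 3 * (1 - cos (real j * th)))" by (simp add: sum_divide_distrib)
    also have "\<dots> \<le> (\<Sum>j=1..N. exp (- a) ^ j * (1 - cos (real j * th)))"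
      by (intro sum_mono mult_right_mono e3) auto
    also have "\<dots> \<le> (\<Sum>j=1..n. exp (- a) ^ j * (1 - cos (real j * th)))"
      using True by (intro sum_mono2) auto
    finally show ?thesis using t2 by linarith
  next
    case False
    have "a powr (-1/3) \<le> 1 / a"
    proof -
      have "a powr (-1/3) \<le> a powr (-1)" using a by (intro powr_mono') auto
      then show ?thesis using a by (simp add: powr_minus_divide)
    qed
    moreover have "1 / 3 / a \<le> exp (- a) ^ Suc n / (1 - exp (- a))"
      using e3[of "Suc n"] False x a by (intro frac_le) auto
    moreover have "1 / 3 / a = (1 / a) / 3" by simp
    moreover have "0 < 1 / a" using a by simp
    ultimately show ?thesis using t1 by linarith
  qed
qed

text \<open>The first bound holds for every imaginary part and serves convergence; the second
  carries the saving off the major arc.\<close>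

lemma peak_term_bounds:
  fixes r n :: nat and t :: complex
  assumes t: "0 < Re t"
  defines "K \<equiv> (2 / (Re t)\<^sup>2) ^ r / (norm (euler (exp (- of_real (Re t)))))\<^sup>2"
  shows norm_peak_term_le_simple: "norm (peak_term r n (exp (- t))) \<le> K * exp (- Re t) ^ n"
    and norm_peak_term_le_minor: "Re t < 1 / 8 \<Longrightarrow> Re t powr (4/3) \<le> \<bar>Im t\<bar> \<Longrightarrow> \<bar>Im t\<bar> \<le> pi \<Longrightarrow>
       norm (peak_term r n (exp (- t))) \<le> K * exp (- (Re t powr (-1/3) / 2304)) * exp (- Re t) ^ n"
proof -
  define Z where "Z = (\<Sum>j=1..n. exp (- Re t) ^ j * (1 - cos (real j * Im t))) / 4 + 2 * (exp (- Re t) ^ Suc n / (1 - exp (- Re t)))"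
  have K: "0 \<le> K" unfolding K_def by simp
  have le: "norm (peak_term r n (exp (- t))) \<le> K * exp (- Re t) ^ n * exp (- Z)"
    using norm_peak_term_le[OF t, of r n] unfolding Z_def K_def by (simp add: mult_ac)
  have "0 \<le> Z" unfolding Z_def using t by (auto intro!: add_nonneg_nonneg sum_nonneg divide_nonneg_nonneg mult_nonneg_nonneg)
  then have "K * exp (- Re t) ^ n * exp (- Z) \<le> K * exp (- Re t) ^ n * 1" using K by (intro mult_left_mono) auto
  then show "norm (peak_term r n (exp (- t))) \<le> K * exp (- Re t) ^ n" using le by simp
  assume "Re t < 1 / 8" "Re t powr (4/3) \<le> \<bar>Im t\<bar>" "\<bar>Im t\<bar> \<le> pi"
  from minor_exponent_bound[OF t this, of n] have "exp (- Z) \<le> exp (- (Re t powr (-1/3) / 2304))"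
    unfolding Z_def by simp
  then have "K * exp (- Re t) ^ n * exp (- Z) \<le> K * exp (- Re t) ^ n * exp (- (Re t powr (-1/3) / 2304))"
    using K by (intro mult_left_mono) auto
  then show "norm (peak_term r n (exp (- t))) \<le> K * exp (- (Re t powr (-1/3) / 2304)) * exp (- Re t) ^ n"
    using le by (simp add: mult_ac)
qed

text \<open>By \<open>euler_square_asymptotics\<close> the product of the two sides' reciprocal data
  tends to \<open>2 pi\<close> on the real axis, which exceeds 1.\<close>

lemma euler_real_lower:
  "eventually (\<lambda>a::real. 1 / (norm (euler (exp (- of_real a))))\<^sup>2 \<le> a * exp (pi\<^sup>2 / (3 * a))) (at_right 0)"
proof -
  have "filterlim complex_of_real (at 0 within sector) (at_right 0)"
    unfolding filterlim_at
  proof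
    show "eventually (\<lambda>x. complex_of_real x \<in> sector \<and> complex_of_real x \<noteq> 0) (at_right 0)"
      by (auto simp: sector_def eventually_at_filter)
    have "(complex_of_real \<longlongrightarrow> of_real 0) (at_right 0)" by (intro tendsto_intros)
    then show "(complex_of_real \<longlongrightarrow> 0) (at_right 0)" by simp
  qed
  from filterlim_compose[OF euler_square_asymptotics this]
  have "((\<lambda>a. norm ((euler (exp (- of_real a)))\<^sup>2 * of_real a * exp (of_real (pi\<^sup>2) / (3 * of_real a)))) \<longlongrightarrow> norm (of_real (2 * pi) :: complex)) (at_right 0)"
    by (rule tendsto_norm)
  then have "eventually (\<lambda>a. 1 < norm ((euler (exp (- of_real a)))\<^sup>2 * of_real a * exp (of_real (pi\<^sup>2) / (3 * of_real a)))) (at_right 0)"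
    by (rule order_tendstoD) (use pi_gt3 in auto)
  moreover have "eventually (\<lambda>a::real. 0 < a) (at_right 0)" by (auto simp: eventually_at_filter)
  ultimately show ?thesis
  proof eventually_elim
    case (elim a)
    have "exp (complex_of_real (pi\<^sup>2) / (3 * of_real a)) = of_real (exp (pi\<^sup>2 / (3 * a)))"
      by (simp add: exp_of_real[symmetric])
    then have "1 < (norm (euler (exp (- of_real a))))\<^sup>2 * (a * exp (pi\<^sup>2 / (3 * a)))"
      using elim by (simp add: norm_mult norm_power mult.assoc)
    moreover have "norm (euler (exp (- complex_of_real a))) > 0"
      using euler_nonzero[of "exp (- complex_of_real a)"] elim by simp
    ultimately show ?case by (simp add: field_simps)
  qed
qed

text \<open>Summing the geometric series over \<open>n\<close> costs \<open>1/a\<close>, which the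
  factor \<open>a\<close> from \<open>euler_real_lower\<close> cancels. The saving
  \<open>exp (- (a^(-1/3) / 2304))\<close> beats every power of \<open>a\<close>, in particular the
  one from the symmetric functions.\<close>

theorem minor_peak_sum_bound:
  "eventually (\<lambda>a::real. \<forall>th. a powr (4/3) \<le> \<bar>th\<bar> \<longrightarrow> \<bar>th\<bar> \<le> pi \<longrightarrow>
      norm (peak_sum r (exp (- Complex a th))) \<le> (2 / a\<^sup>2) ^ r * exp (pi\<^sup>2 / (3 * a) - a powr (-1/3) / 2304)) (at_right 0)"
proof -
  have "eventually (\<lambda>a::real. 0 < a \<and> a < 1 / 8) (at_right 0)"
    by (auto simp: eventually_at_right_field intro!: exI[of _ "1/8"])
  then show ?thesis using euler_real_lower
  proof eventually_elim
    case (elim a)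
    show ?case
    proof (intro allI impI)
      fix th assume th: "a powr (4/3) \<le> \<bar>th\<bar>" "\<bar>th\<bar> \<le> pi"
      define x where "x = exp (- a)"
      define E where "E = exp (- (a powr (-1/3) / 2304))"
      define K where "K = (2 / a\<^sup>2) ^ r / (norm (euler (exp (- of_real a))))\<^sup>2"
      have x: "0 < x" "x < 1" using elim by (auto simp: x_def)
      have K0: "0 \<le> K" by (simp add: K_def)
      have s: "(\<lambda>n. K * E * x ^ Suc n) sums (K * E * (x / (1 - x)))"
        using sums_mult[OF geometric_sums[of x], of "K * E * x"] x by (simp add: mult_ac)
      have b: "norm (peak_term r (Suc n) (exp (- Complex a th))) \<le> K * E * x ^ Suc n" for n
        using norm_peak_term_le_minor[of "Complex a th" r "Suc n"] elim th by (simp add: K_def E_def x_def)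
      have "norm (peak_sum r (exp (- Complex a th))) \<le> K * E * (x / (1 - x))"
        unfolding peak_sum_def sums_unique[OF s] by (rule norm_suminf_le[OF b sums_summable[OF s]])
      also have "\<dots> \<le> K * E * (1 / a)"
      proof -
        have "x * (1 + a) \<le> x * exp a" using exp_ge_add_one_self[of a] x by (intro mult_left_mono) auto
        then have "x * (1 + a) \<le> 1" by (simp add: x_def flip: exp_add)
        then have "x / (1 - x) \<le> 1 / a" using x elim by (simp add: field_simps)
        then show ?thesis using K0 by (intro mult_left_mono) (auto simp: E_def)
      qed
      also have "K \<le> (2 / a\<^sup>2) ^ r * (a * exp (pi\<^sup>2 / (3 * a)))"
      proof -
        have "K = (2 / a\<^sup>2) ^ r * (1 / (norm (euler (exp (- of_real a))))\<^sup>2)" by (simp only: K_def times_divide_eq_right mult_1_right)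
        also have "\<dots> \<le> (2 / a\<^sup>2) ^ r * (a * exp (pi\<^sup>2 / (3 * a)))"
          by (rule mult_left_mono) (use elim in auto)
        finally show ?thesis .
      qed
      then have "K * E * (1 / a) \<le> (2 / a\<^sup>2) ^ r * (a * exp (pi\<^sup>2 / (3 * a))) * E * (1 / a)"
        using elim by (intro mult_right_mono) (auto simp: E_def)
      also have "\<dots> = (2 / a\<^sup>2) ^ r * exp (pi\<^sup>2 / (3 * a) - a powr (-1/3) / 2304)"
      proof -
        have "P * (a * e) * E * (1 / a) = P * (e * E)" for P e :: real using elim by simp
        moreover have "exp (pi\<^sup>2 / (3 * a)) * E = exp (pi\<^sup>2 / (3 * a) - a powr (-1/3) / 2304)"
          unfolding E_def exp_add[symmetric] by (simp only: diff_conv_add_uminus)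
        ultimately show ?thesis by metis
      qed
      finally show "norm (peak_sum r (exp (- Complex a th))) \<le> (2 / a\<^sup>2) ^ r * exp (pi\<^sup>2 / (3 * a) - a powr (-1/3) / 2304)" .
    qed
  qed
qed

section \<open>The circle method\<close>

text \<open>Moves the saddle, at angle 0, from the boundary of the interval into its
  interior.\<close>

lemma has_integral_period_shift:
  fixes f :: "real \<Rightarrow> complex"
  assumes f: "(f has_integral I) {0..2*pi}" and per: "\<And>x. f (x + 2 * pi) = f x"
  shows "(f has_integral I) {-pi..pi}"
proof -
  have int: "f integrable_on {0..2*pi}" using f by blast
  have i1: "(f has_integral (integral {0..pi} f)) {0..pi}"
    by (intro integrable_integral integrable_on_subinterval[OF int]) auto
  have i2: "(f has_integral (integral {pi..2*pi} f)) {pi..2*pi}"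
    by (intro integrable_integral integrable_on_subinterval[OF int]) auto
  have "(f has_integral (integral {0..pi} f + integral {pi..2*pi} f)) {0..2*pi}"
    by (rule has_integral_combine[OF _ _ i1 i2]) auto
  then have I: "I = integral {0..pi} f + integral {pi..2*pi} f" using f has_integral_unique by blast
  have "((\<lambda>x. f (x + 2 * pi)) has_integral (integral {pi..2*pi} f)) {pi - 2 * pi..2 * pi - 2 * pi}"
    by (rule has_integral_shift_real_ivl[OF i2])
  then have "(f has_integral (integral {pi..2*pi} f)) {-pi..0}" by (simp add: per)
  from has_integral_combine[OF _ _ this i1] show ?thesis by (simp add: I add.commute)
qed

lemma circle_coefficient:
  assumes f: "f holomorphic_on ball 0 1" and F: "f has_fps_expansion F" and a: "0 < a"
  shows "((\<lambda>\<theta>. f (exp (- Complex a \<theta>)) * exp (of_nat N * Complex a \<theta>)) has_integral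
      (of_real (2 * pi) * fps_nth F N)) {-pi..pi}"
proof -
  define \<rho> where "\<rho> = exp (- a)"
  have \<rho>: "0 < \<rho>" "\<rho> < 1" using a by (auto simp: \<rho>_def)
  have sub: "cball 0 \<rho> \<subseteq> ball (0::complex) 1" using \<rho> by auto
  have "((\<lambda>u. f u / (u - 0) ^ Suc N) has_contour_integral (2 * pi * \<i> / fact N * (deriv ^^ N) f 0)) (circlepath 0 \<rho>)"
  proof (rule Cauchy_has_contour_integral_higher_derivative_circlepath)
    show "continuous_on (cball 0 \<rho>) f"
      by (rule continuous_on_subset[OF holomorphic_on_imp_continuous_on[OF f] sub])
    show "f holomorphic_on ball 0 \<rho>"
      by (rule holomorphic_on_subset[OF f]) (use \<rho> in auto)
  qed (use \<rho> in auto)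
  then have "((\<lambda>t. f (0 + of_real \<rho> * cis t) / (0 + of_real \<rho> * cis t - 0) ^ Suc N * of_real \<rho> * \<i> * cis t) has_integral
      (2 * pi * \<i> / fact N * (deriv ^^ N) f 0)) {0..2*pi}"
    unfolding circlepath_def by (subst (asm) has_contour_integral_part_circlepath_iff) auto
  then have "((\<lambda>t. f (0 + of_real \<rho> * cis t) / (0 + of_real \<rho> * cis t - 0) ^ Suc N * of_real \<rho> * \<i> * cis t * (- \<i>)) has_integral
      (2 * pi * \<i> / fact N * (deriv ^^ N) f 0 * (- \<i>))) {0..2*pi}"
    by (rule has_integral_mult_left)
  moreover have "f (0 + of_real \<rho> * cis t) / (0 + of_real \<rho> * cis t - 0) ^ Suc N * of_real \<rho> * \<i> * cis t * (- \<i>) =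
      f (of_real \<rho> * cis t) / (of_real \<rho> * cis t) ^ N" for t
    using \<rho> by (simp add: field_simps)
  moreover have "2 * pi * \<i> / fact N * (deriv ^^ N) f 0 * (- \<i>) = of_real (2 * pi) * fps_nth F N"
    using fps_nth_fps_expansion[OF F, of N] by (simp add: field_simps)
  ultimately have "((\<lambda>t. f (of_real \<rho> * cis t) / (of_real \<rho> * cis t) ^ N) has_integral (of_real (2 * pi) * fps_nth F N)) {0..2*pi}"
    by simp
  then have "((\<lambda>t. f (of_real \<rho> * cis t) / (of_real \<rho> * cis t) ^ N) has_integral (of_real (2 * pi) * fps_nth F N)) {-pi..pi}"
    by (rule has_integral_period_shift) (simp flip: cis_mult)
  \<comment> \<open>With \<open>q = exp (-t)\<close> the circle is traversed clockwise, hence the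
    reflection.\<close>
  then have "((\<lambda>t. f (of_real \<rho> * cis (- t)) / (of_real \<rho> * cis (- t)) ^ N) has_integral (of_real (2 * pi) * fps_nth F N)) {-pi..- (-pi)}"
    by (subst has_integral_reflect_real)
  moreover have "f (of_real \<rho> * cis (- t)) / (of_real \<rho> * cis (- t)) ^ N = f (exp (- Complex a t)) * exp (of_nat N * Complex a t)" for t
  proof -
    have e: "of_real \<rho> * cis (- t) = exp (- Complex a t)"
      by (simp add: \<rho>_def exp_eq_polar)
    have "exp (of_nat N * Complex a t) = 1 / exp (- Complex a t) ^ N"
      by (simp add: exp_of_nat_mult exp_minus power_inverse divide_inverse)
    then show ?thesis by (simp add: e)
  qed
  ultimately show ?thesis by simp
qed

text \<open>The recursion of \<open>weight_fps\<close> mirrors \<open>hsym_Suc_Suc\<close>, with the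
  factor \<open>1 / (q)_n^2\<close> built up step by step; each step preserves expansions at
  0.\<close>

lemma weight_fps_has_fps_expansion:
  assumes "Qf has_fps_expansion Q"
  shows "(\<lambda>q. Qf q / (qpoch n q)\<^sup>2 * hsym (lambert q) r n) has_fps_expansion weight_fps Q n r"
proof -
  have inv: "(\<lambda>q::complex. inverse ((1 - q ^ Suc n)\<^sup>2)) has_fps_expansion inverse ((1 - fps_X ^ Suc n)\<^sup>2)" for n
    unfolding power2_eq_square
    by (intro has_fps_expansion_inverse has_fps_expansion_mult has_fps_expansion_diff
        has_fps_expansion_1 has_fps_expansion_fps_X_power) simp
  have qpS: "qpoch (Suc m) q = qpoch m q * (1 - q ^ Suc m)" for m and q :: complex by (simp add: qpoch_def)
  show ?thesis using assms
  proof (induction Q n r rule: weight_fps.induct)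
    case (1 Q)
    then show ?case by (simp add: qpoch_def)
  next
    case (2 Q r)
    then show ?case by simp
  next
    case (3 Q n)
    have "(\<lambda>q. inverse ((1 - q ^ Suc n)\<^sup>2) * (Qf q / (qpoch n q)\<^sup>2 * hsym (lambert q) 0 n)) has_fps_expansion weight_fps Q (Suc n) 0"
      unfolding weight_fps.simps by (intro has_fps_expansion_mult inv 3)
    moreover have "inverse ((1 - q ^ Suc n)\<^sup>2) * (Qf q / (qpoch n q)\<^sup>2 * hsym (lambert q) 0 n) =
        Qf q / (qpoch (Suc n) q)\<^sup>2 * hsym (lambert q) 0 (Suc n)" for q
      unfolding qpS by (simp add: power_mult_distrib divide_inverse)
    ultimately show ?case by simp
  next
    case (4 Q n r)
    have "(\<lambda>q. inverse ((1 - q ^ Suc n)\<^sup>2) * (Qf q / (qpoch n q)\<^sup>2 * hsym (lambert q) (Suc r) n +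
        q ^ Suc n * (Qf q / (qpoch (Suc n) q)\<^sup>2 * hsym (lambert q) r (Suc n)))) has_fps_expansion weight_fps Q (Suc n) (Suc r)"
      unfolding weight_fps.simps
      by (intro has_fps_expansion_mult has_fps_expansion_add has_fps_expansion_fps_X_power inv 4)
    moreover have "inverse ((1 - q ^ Suc n)\<^sup>2) * (Qf q / (qpoch n q)\<^sup>2 * hsym (lambert q) (Suc r) n +
        q ^ Suc n * (Qf q / (qpoch (Suc n) q)\<^sup>2 * hsym (lambert q) r (Suc n))) =
        Qf q / (qpoch (Suc n) q)\<^sup>2 * hsym (lambert q) (Suc r) (Suc n)" for q
    proof -
      have ring: "i * (A * iB * g + x * (A * (iB * i) * h)) = A * (iB * i) * (g + x * i * h)"
        for i A iB x h g :: complex by (simp add: algebra_simps)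
      show ?thesis
        unfolding qpS hsym_Suc_Suc lambert_def [of q "Suc n"] divide_inverse power_mult_distrib inverse_mult_distrib
        by (rule ring)
    qed
    ultimately show ?case by simp
  qed
qed

lemma qpoch_double_quotient:
  fixes q :: complex
  assumes "norm q < 1"
  shows "(\<Prod>i<n. 1 - q ^ (2 * n - i)) = qpoch (2 * n) q / qpoch n q"
proof -
  have "(\<Prod>i<n. 1 - q ^ (2 * n - i)) = (\<Prod>j=Suc n..2*n. 1 - q ^ j)"
    by (rule prod.reindex_bij_witness[where i = "\<lambda>j. 2 * n - j" and j = "\<lambda>i. 2 * n - i"]) auto
  then show ?thesis using qpoch_split[of n "2 * n" q] qpoch_nonzero[OF assms] by simp
qed

section \<open>Coefficients as integrals over a circle\<close>

definition peak_term_fps :: "nat \<Rightarrow> nat \<Rightarrow> complex fps" where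
  "peak_term_fps r n = fps_X ^ n * weight_fps (\<Prod>i<n. 1 - fps_X ^ (2 * n - i)) n r"

lemma peak_term_has_fps_expansion: "peak_term r n has_fps_expansion peak_term_fps r n"
proof -
  have "(\<lambda>q::complex. \<Prod>i<n. 1 - q ^ (2 * n - i)) has_fps_expansion (\<Prod>i<n. 1 - fps_X ^ (2 * n - i))"
    by (intro has_fps_expansion_prod has_fps_expansion_diff has_fps_expansion_1 has_fps_expansion_fps_X_power)
  from has_fps_expansion_mult[OF has_fps_expansion_fps_X_power[of n] weight_fps_has_fps_expansion[OF this, of n r]]
  have "(\<lambda>q. q ^ n * ((\<Prod>i<n. 1 - q ^ (2 * n - i)) / (qpoch n q)\<^sup>2 * hsym (lambert q) r n)) has_fps_expansion peak_term_fps r n"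
    by (simp add: peak_term_fps_def)
  moreover have "eventually (\<lambda>q::complex. q \<in> ball 0 1) (nhds 0)"
    by (rule eventually_nhds_in_open) auto
  then have "eventually (\<lambda>q. q ^ n * ((\<Prod>i<n. 1 - q ^ (2 * n - i)) / (qpoch n q)\<^sup>2 * hsym (lambert q) r n) = peak_term r n q) (nhds 0)"
  proof eventually_elim
    case (elim q)
    then have "norm q < 1" by simp
    then show ?case unfolding peak_term_def qpoch_double_quotient[OF \<open>norm q < 1\<close>]
      by (simp add: power2_eq_square power3_eq_cube mult.assoc)
  qed
  from has_fps_expansion_cong[OF this refl] calculation show ?thesis by blast
qed

lemma peak_term_fps_nth:
  "fps_nth (peak_term_fps r n) N = (if N < n then 0 else fps_nth (weight_fps (\<Prod>i<n. 1 - fps_X ^ (2 * n - i)) n r) (N - n))"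
  by (simp add: peak_term_fps_def fps_X_power_mult_nth)

lemma mcoeff_eq_sum_peak_term_fps:
  assumes "N \<le> M"
  shows "mcoeff r N = (\<Sum>n<M. fps_nth (peak_term_fps r (Suc n)) N)"
proof -
  have "(\<Sum>n<M. fps_nth (peak_term_fps r (Suc n)) N) = (\<Sum>n=1..M. fps_nth (peak_term_fps r n) N)"
    by (simp add: sum.atLeast1_atMost_eq)
  also have "\<dots> = (\<Sum>n=1..N. fps_nth (peak_term_fps r n) N)"
    using assms by (intro sum.mono_neutral_right) (auto simp: peak_term_fps_nth)
  also have "\<dots> = mcoeff r N" unfolding mcoeff_def by (intro sum.cong refl) (simp add: peak_term_fps_nth)
  finally show ?thesis by simp
qed

lemma holomorphic_peak_term: "peak_term r n holomorphic_on ball 0 1"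
proof -
  have nz: "1 - q ^ j \<noteq> 0" if "q \<in> ball 0 1" "1 \<le> j" for q :: complex and j
    using one_minus_power_nonzero that by simp
  have X: "(\<lambda>q. lambert q j) holomorphic_on ball 0 1" if "1 \<le> j" for j
    unfolding lambert_def using nz that by (intro holomorphic_intros) auto
  have h: "(\<lambda>q. hsym (lambert q) r n) holomorphic_on ball 0 1" for n
  proof (induction r arbitrary: n)
    case (Suc r)
    show ?case unfolding hsym.simps by (intro holomorphic_on_sum holomorphic_on_mult X Suc) auto
  qed simp
  have qph: "(qpoch m) holomorphic_on ball 0 1" for m
    unfolding qpoch_def [abs_def] by (intro holomorphic_intros)
  show ?thesis unfolding peak_term_def [abs_def]
    by (intro holomorphic_intros qph h) (use qpoch_nonzero in auto)
qed

lemma continuous_on_Complex: "continuous_on S (\<lambda>\<theta>. Complex a \<theta>)"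
proof -
  have "(\<lambda>\<theta>. Complex a \<theta>) = (\<lambda>\<theta>. of_real a + \<i> * of_real \<theta>)" by (simp add: fun_eq_iff complex_eq_iff)
  then show ?thesis by (simp add: continuous_intros)
qed

text \<open>The majorant from \<open>norm_peak_term_le_simple\<close> does not depend on the angle,
  so the Weierstrass test applies.\<close>

lemma peak_sum_uniform_limit:
  assumes a: "0 < a"
  shows "uniform_limit S (\<lambda>M \<theta>. \<Sum>n<M. peak_term r (Suc n) (exp (- Complex a \<theta>)))
     (\<lambda>\<theta>. peak_sum r (exp (- Complex a \<theta>))) sequentially"
  unfolding peak_sum_def
proof (rule Weierstrass_m_test)
  define K where "K = (2 / a\<^sup>2) ^ r / (norm (euler (exp (- of_real a))))\<^sup>2"
  show "norm (peak_term r (Suc n) (exp (- Complex a \<theta>))) \<le> K * exp (- a) ^ Suc n" for n \<theta>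
    using norm_peak_term_le_simple[of "Complex a \<theta>" r "Suc n"] a unfolding K_def by simp
  show "summable (\<lambda>n. K * exp (- a) ^ Suc n)"
    using a by (intro summable_mult, subst summable_Suc_iff) (auto intro: summable_geometric)
qed

lemma continuous_on_peak_term_exp:
  assumes "0 < a"
  shows "continuous_on S (\<lambda>\<theta>. peak_term r n (exp (- Complex a \<theta>)))"
  by (rule continuous_on_compose2[OF holomorphic_on_imp_continuous_on[OF holomorphic_peak_term]])
     (use assms in \<open>auto intro!: continuous_intros continuous_on_Complex\<close>)

lemma continuous_on_peak_sum:
  assumes "0 < a"
  shows "continuous_on S (\<lambda>\<theta>. peak_sum r (exp (- Complex a \<theta>)))"
  by (rule uniform_limit_theorem[OF _ peak_sum_uniform_limit[OF assms]])
     (auto intro!: always_eventually continuous_on_sum continuous_on_peak_term_exp assms)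

text \<open>Uniform convergence exchanges sum and integral; since a sequence of size
  \<open>N\<close> has peak at most \<open>N\<close>, the integrals of the partial sums are constant
  from \<open>M = N\<close> on.\<close>

lemma mcoeff_integral:
  assumes a: "0 < a"
  shows "((\<lambda>\<theta>. peak_sum r (exp (- Complex a \<theta>)) * exp (of_nat N * Complex a \<theta>)) has_integral
     (of_real (2 * pi) * mcoeff r N)) {-pi..pi}"
proof -
  let ?f = "\<lambda>M \<theta>. (\<Sum>n<M. peak_term r (Suc n) (exp (- Complex a \<theta>))) * exp (of_nat N * Complex a \<theta>)"
  let ?g = "\<lambda>\<theta>. peak_sum r (exp (- Complex a \<theta>)) * exp (of_nat N * Complex a \<theta>)"
  have "uniform_limit {-pi..pi} ?f ?g sequentially"
  proof (rule uniform_lim_mult[OF peak_sum_uniform_limit[OF a] uniform_limit_const])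
    show "bounded ((\<lambda>\<theta>. peak_sum r (exp (- Complex a \<theta>))) ` {-pi..pi})"
      by (intro compact_imp_bounded compact_continuous_image continuous_on_peak_sum a) auto
    show "bounded ((\<lambda>\<theta>. exp (of_nat N * Complex a \<theta>)) ` {-pi..pi})"
      by (intro compact_imp_bounded compact_continuous_image continuous_intros continuous_on_Complex) auto
  qed
  then obtain I J where IJ: "\<And>M. (?f M has_integral I M) {-pi..pi}" "(?g has_integral J) {-pi..pi}" "I \<longlonglongrightarrow> J"
    by (rule uniform_limit_integral)
       (auto intro!: continuous_intros continuous_on_Complex continuous_on_peak_term_exp a)
  have f_eq: "?f M = (\<lambda>\<theta>. \<Sum>n<M. peak_term r (Suc n) (exp (- Complex a \<theta>)) * exp (of_nat N * Complex a \<theta>))" for M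
    by (rule ext) (rule sum_distrib_right)
  have int: "(?f M has_integral (\<Sum>n<M. of_real (2 * pi) * fps_nth (peak_term_fps r (Suc n)) N)) {-pi..pi}" for M
    unfolding f_eq
  proof (rule has_integral_sum)
    fix n assume "n \<in> {..<M}"
    show "((\<lambda>\<theta>. peak_term r (Suc n) (exp (- Complex a \<theta>)) * exp (of_nat N * Complex a \<theta>)) has_integral
       of_real (2 * pi) * fps_nth (peak_term_fps r (Suc n)) N) {-pi..pi}"
      by (rule circle_coefficient[OF holomorphic_peak_term peak_term_has_fps_expansion a])
  qed simp
  have I: "I M = of_real (2 * pi) * mcoeff r N" if "N \<le> M" for M
  proof -
    have "I M = (\<Sum>n<M. of_real (2 * pi) * fps_nth (peak_term_fps r (Suc n)) N)"
      by (rule has_integral_unique[OF IJ(1) int])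
    then show ?thesis by (simp only: mcoeff_eq_sum_peak_term_fps[OF that] sum_distrib_left)
  qed
  have "I \<longlonglongrightarrow> of_real (2 * pi) * mcoeff r N"
    by (rule tendsto_eventually) (use I in \<open>auto intro!: eventually_mono[OF eventually_ge_at_top[of N]]\<close>)
  then have "J = of_real (2 * pi) * mcoeff r N" using IJ(3) LIMSEQ_unique by blast
  then show ?thesis using IJ(2) by simp
qed

section \<open>The saddle point\<close>

lemma gaussian_integral:
  assumes "0 < a"
  shows "has_bochner_integral lborel (\<lambda>x::real. exp (- (a * x\<^sup>2))) (sqrt (pi / a))"
proof -
  define G where "G = (\<lambda>x::real. exp (- x\<^sup>2))"
  have "has_bochner_integral lborel G (2 *\<^sub>R (sqrt pi / 2))"
    unfolding G_def by (rule has_bochner_integral_even_function[OF gaussian_moment_0]) simp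
  then have G: "has_bochner_integral lborel G (sqrt pi)" by simp
  have sa: "sqrt a \<noteq> 0" using assms by simp
  have "has_bochner_integral lborel (\<lambda>x. G (0 + sqrt a * x)) (sqrt pi /\<^sub>R \<bar>sqrt a\<bar>)"
    by (rule iffD1[OF lborel_has_bochner_integral_real_affine_iff[OF sa] G])
  moreover have "sqrt pi /\<^sub>R \<bar>sqrt a\<bar> = sqrt (pi / a)"
    using assms by (simp add: real_sqrt_divide field_simps)
  moreover have "G (0 + sqrt a * x) = exp (- (a * x\<^sup>2))" for x
    using assms by (simp add: G_def power_mult_distrib)
  ultimately show ?thesis by simp
qed

text \<open>The size of the saddle contribution for \<open>N = pi^2/(3a^2)\<close>: \<open>a\<close>
  from the prefactor of \<open>1 / (euler q)^2\<close>, \<open>a^(3/2)\<close> from the width of the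
  saddle, \<open>a^(-2r)\<close> from the symmetric function, and the exponent
  \<open>pi^2/(3a)\<close> twice, from the Euler product and from \<open>q^(-N)\<close>.\<close>

definition gscale :: "nat \<Rightarrow> real \<Rightarrow> real" where
  "gscale r a = a powr (5/2) / a ^ (2 * r) * exp (2 * pi\<^sup>2 / (3 * a))"

definition normalized :: "nat \<Rightarrow> complex \<Rightarrow> complex" where
  "normalized r t = t ^ (2 * r) * peak_sum r (exp (- t)) / (t * exp (of_real (pi\<^sup>2) / (3 * t)))"

text \<open>Substitution \<open>theta = a^(3/2) v\<close>, so that \<open>t = a w\<close> with
  \<open>w\<close> close to 1. For \<open>N = pi^2/(3a^2)\<close> the exponent is exactly
  \<open>-(pi^2/3) v^2 / w\<close>, with no Taylor remainder to estimate.\<close>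

lemma rescaled_integrand:
  fixes a v :: real
  assumes a: "0 < a"
  defines "c \<equiv> a powr (3/2)"
  defines "t \<equiv> Complex a (c * v)" and "w \<equiv> Complex 1 (sqrt a * v)"
  shows "peak_sum r (exp (- t)) * exp (of_real (pi\<^sup>2 / (3 * a\<^sup>2)) * t) * of_real (c / gscale r a) =
    normalized r t * (w / w ^ (2 * r)) * exp (- (of_real (pi\<^sup>2 / 3 * v\<^sup>2) / w))"
proof -
  have c: "c = a * sqrt a"
  proof -
    have "c = a powr (1 + 1/2)" by (simp add: c_def)
    also have "\<dots> = a powr 1 * a powr (1/2)" by (rule powr_add)
    finally show ?thesis using a by (simp add: powr_half_sqrt)
  qed
  have tw: "t = of_real a * w" by (simp add: t_def w_def c complex_eq_iff)
  have w0: "w \<noteq> 0" by (simp add: w_def complex_eq_iff)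
  have t0: "t \<noteq> 0" using a w0 by (simp add: tw)
  define A where "A = complex_of_real (pi\<^sup>2 / 3)"
  have A1: "of_real (pi\<^sup>2) / (3 * t) = A / t" by (simp add: A_def)
  have D: "peak_sum r (exp (- t)) = normalized r t * (t / t ^ (2 * r)) * exp (A / t)"
    unfolding normalized_def A1 using t0 by simp
  have cs: "c / gscale r a = a ^ (2 * r) / a * exp (- (2 * (pi\<^sup>2 / 3) / a))"
  proof -
    have "a powr (5/2) = a powr (1 + 3/2)" by simp
    also have "\<dots> = a * c" unfolding powr_add c_def using a by simp
    finally have "a powr (5/2) = a * c" .
    moreover have "c \<noteq> 0" using a by (simp add: c_def)
    ultimately show ?thesis using a by (simp add: gscale_def exp_minus field_simps)
  qed
  have "exp (A / t) * exp (of_real (pi\<^sup>2 / (3 * a\<^sup>2)) * t) * of_real (exp (- (2 * (pi\<^sup>2 / 3) / a))) =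
     exp (A / t + of_real (pi\<^sup>2 / (3 * a\<^sup>2)) * t + of_real (- (2 * (pi\<^sup>2 / 3) / a)))"
    by (simp only: exp_add exp_of_real)
  \<comment> \<open>The choice of \<open>a\<close> as saddle completes the square:
    \<open>1/w + w - 2 = (w - 1)^2 / w\<close>.\<close>
  also have "A / t + of_real (pi\<^sup>2 / (3 * a\<^sup>2)) * t + of_real (- (2 * (pi\<^sup>2 / 3) / a)) = A * (w - 1)\<^sup>2 / (of_real a * w)"
    using a w0 by (simp add: tw A_def field_simps power2_eq_square)
  also have "(w - 1)\<^sup>2 = - of_real (a * v\<^sup>2)"
  proof -
    have "w - 1 = \<i> * of_real (sqrt a * v)" by (simp add: w_def complex_eq_iff)
    then have "(w - 1)\<^sup>2 = - of_real ((sqrt a * v)\<^sup>2)" by (simp add: power_mult_distrib)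
    also have "(sqrt a * v)\<^sup>2 = a * v\<^sup>2" using a by (simp add: power_mult_distrib)
    finally show ?thesis .
  qed
  also have "A * (- of_real (a * v\<^sup>2)) / (of_real a * w) = - (of_real (pi\<^sup>2 / 3 * v\<^sup>2) / w)"
    using a by (simp add: A_def)
  finally have E: "exp (A / t) * exp (of_real (pi\<^sup>2 / (3 * a\<^sup>2)) * t) * of_real (exp (- (2 * (pi\<^sup>2 / 3) / a))) =
     exp (- (of_real (pi\<^sup>2 / 3 * v\<^sup>2) / w))" .
  have P: "t / t ^ (2 * r) * of_real (a ^ (2 * r) / a) = w / w ^ (2 * r)"
    using a by (simp add: tw power_mult_distrib)
  have "peak_sum r (exp (- t)) * exp (of_real (pi\<^sup>2 / (3 * a\<^sup>2)) * t) * of_real (c / gscale r a) =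
      normalized r t * (t / t ^ (2 * r) * of_real (a ^ (2 * r) / a)) *
        (exp (A / t) * exp (of_real (pi\<^sup>2 / (3 * a\<^sup>2)) * t) * of_real (exp (- (2 * (pi\<^sup>2 / 3) / a))))"
    unfolding D cs of_real_mult by (simp only: mult_ac)
  then show ?thesis unfolding E P .
qed

text \<open>On the major arc \<open>|v| <= a^(-1/6)\<close>, so \<open>w = 1 + i sqrt a v\<close>
  stays bounded.\<close>

lemma powr_three_halves_mult_le:
  fixes a v :: real
  assumes "0 < a" "\<bar>a powr (3/2) * v\<bar> \<le> a powr (4/3)" "a < 1"
  shows "(sqrt a * v)\<^sup>2 \<le> 1"
proof -
  have "a powr (3/2) = a powr (4/3 + 1/6)" by simp
  also have "\<dots> = a powr (4/3) * a powr (1/6)" by (rule powr_add)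
  finally have "a powr (4/3) * (a powr (1/6) * \<bar>v\<bar>) \<le> a powr (4/3) * 1"
    using assms by (simp add: abs_mult mult.assoc)
  then have 1: "a powr (1/6) * \<bar>v\<bar> \<le> 1" using assms by (simp only: mult_le_cancel_left_pos powr_gt_zero)
  have "sqrt a * \<bar>v\<bar> \<le> a powr (1/6) * \<bar>v\<bar>"
  proof (rule mult_right_mono)
    have "sqrt a = a powr (1/2)" using assms by (simp add: powr_half_sqrt)
    also have "\<dots> \<le> a powr (1/6)" using assms by (intro powr_mono') auto
    finally show "sqrt a \<le> a powr (1/6)" .
  qed simp
  then have "\<bar>sqrt a * v\<bar> \<le> 1" using 1 assms by (simp add: abs_mult)
  then show ?thesis by (simp add: abs_square_le_1)
qed

text \<open>In the variable \<open>v\<close> the arc has length of order \<open>a^(-1/6)\<close> and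
  exhausts the line, so dominated convergence leads to a Gaussian integral.\<close>

lemma major_integral_tendsto:
  fixes al :: "nat \<Rightarrow> real"
  assumes pos: "\<And>i. 0 < al i" and lim: "al \<longlonglongrightarrow> 0"
  shows "(\<lambda>i. integral {-(al i powr (4/3))..al i powr (4/3)}
      (\<lambda>\<theta>. peak_sum r (exp (- Complex (al i) \<theta>)) * exp (of_real (pi\<^sup>2 / (3 * (al i)\<^sup>2)) * Complex (al i) \<theta>))
        / of_real (gscale r (al i)))
    \<longlonglongrightarrow> hsym_inf (\<lambda>j. 1 / of_nat j ^ 2) r / of_real (6 * pi) * of_real (sqrt (pi / (pi\<^sup>2 / 3)))"
proof -
  define A :: real where "A = pi\<^sup>2 / 3"
  have A: "0 < A" by (simp add: A_def)
  define L where "L = hsym_inf (\<lambda>j. 1 / of_nat j ^ 2) r / of_real (6 * pi)"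
  have norm_lim: "(normalized r \<longlongrightarrow> L) (at 0 within major_arc)"
    unfolding normalized_def [abs_def] L_def by (rule major_peak_sum_asymptotics)
  have "eventually (\<lambda>t. dist (normalized r t) L < 1) (at 0 within major_arc)"
    using norm_lim by (rule tendstoD) simp
  then obtain d where d0: "d > 0" "\<forall>t\<in>major_arc. t \<noteq> 0 \<and> dist t 0 < d \<longrightarrow> dist (normalized r t) L < 1"
    unfolding eventually_at by blast
  have d: "d > 0" "\<And>t. t \<in> major_arc \<Longrightarrow> norm t < d \<Longrightarrow> dist (normalized r t) L < 1"
  proof -
    fix t assume t: "t \<in> major_arc" "norm t < d"
    have "t \<noteq> 0" using t by (auto simp: major_arc_def)
    then show "dist (normalized r t) L < 1" using d0(2) t by simp
  qed (rule d0(1))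
  define C where "C = norm L + 1"
  have normC: "norm (normalized r t) \<le> C" if "t \<in> major_arc" "norm t < d" for t
    using d(2)[OF that] norm_triangle_ineq2[of "normalized r t" L] by (simp add: C_def dist_norm)
  have C0: "0 \<le> C" by (simp add: C_def)
  have "eventually (\<lambda>i. al i < min 1 (d / 2)) sequentially"
    using lim d(1) by (intro order_tendstoD(2)) auto
  then obtain N0 where N0: "\<And>i. i \<ge> N0 \<Longrightarrow> al i < min 1 (d / 2)"
    by (auto simp: eventually_sequentially)
  \<comment> \<open>Dominated convergence asks for its bounds at every index, so an initial segment
    of the sequence is dropped.\<close>
  define b where "b i = al (i + N0)" for i
  have b: "0 < b i" "b i < 1" "b i < d / 2" for i using N0[of "i + N0"] pos by (auto simp: b_def)
  have blim: "b \<longlonglongrightarrow> 0" unfolding b_def by (rule LIMSEQ_ignore_initial_segment[OF lim])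
  define g where "g a \<theta> = peak_sum r (exp (- Complex a \<theta>)) * exp (of_real (pi\<^sup>2 / (3 * a\<^sup>2)) * Complex a \<theta>)" for a \<theta>
  define S where "S i = {- (b i powr (4/3))..b i powr (4/3)}" for i
  define c where "c i = b i powr (3/2)" for i
  have c0: "0 < c i" for i using b[of i] by (simp add: c_def)
  define s where "s i v = indicator (S i) (c i * v) *\<^sub>R (g (b i) (c i * v) * of_real (c i / gscale r (b i)))" for i v
  define w where "w i v = Complex 1 (sqrt (b i) * v)" for i v
  have cont: "continuous_on X (g a)" if "0 < a" for a X
    unfolding g_def [abs_def] by (intro continuous_intros continuous_on_peak_sum continuous_on_Complex that)
  have gsc: "gscale r (b i) > 0" for i using b[of i] by (simp add: gscale_def)
  have int_eq: "integral (S i) (g (b i)) / of_real (gscale r (b i)) = (\<integral>v. s i v \<partial>lborel)" for i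
  proof -
    have si: "set_integrable lborel (S i) (g (b i))"
      unfolding S_def by (rule borel_integrable_atLeastAtMost'[OF cont[OF b(1)]])
    have "integral (S i) (g (b i)) = (\<integral>x. indicator (S i) x *\<^sub>R g (b i) x \<partial>lborel)"
      using set_borel_integral_eq_integral(2)[OF si] by (simp add: set_lebesgue_integral_def)
    also have "\<dots> = \<bar>c i\<bar> *\<^sub>R (\<integral>v. indicator (S i) (0 + c i * v) *\<^sub>R g (b i) (0 + c i * v) \<partial>lborel)"
      by (rule lborel_integral_real_affine) (use c0[of i] in simp)
    also have "\<dots> = of_real (c i) * (\<integral>v. indicator (S i) (c i * v) *\<^sub>R g (b i) (c i * v) \<partial>lborel)"
      using c0[of i] by (simp add: scaleR_conv_of_real)
    finally have "integral (S i) (g (b i)) / of_real (gscale r (b i)) =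
        (\<integral>v. indicator (S i) (c i * v) *\<^sub>R g (b i) (c i * v) \<partial>lborel) * of_real (c i / gscale r (b i))"
      by simp
    also have "\<dots> = (\<integral>v. (indicator (S i) (c i * v) *\<^sub>R g (b i) (c i * v)) * of_real (c i / gscale r (b i)) \<partial>lborel)"
      by (rule integral_mult_left_zero[symmetric])
    also have "\<dots> = (\<integral>v. s i v \<partial>lborel)" by (simp only: s_def mult_scaleR_left)
    finally show ?thesis .
  qed
  have s_eq: "s i v = indicator (S i) (c i * v) *\<^sub>R (normalized r (Complex (b i) (c i * v)) *
      (w i v / w i v ^ (2 * r)) * exp (- (of_real (A * v\<^sup>2) / w i v)))" for i v
    unfolding s_def g_def c_def w_def A_def rescaled_integrand[OF b(1)] ..
  have in_major: "Complex (b i) (c i * v) \<in> major_arc" "(sqrt (b i) * v)\<^sup>2 \<le> 1" if "c i * v \<in> S i" for i v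
  proof -
    have le: "\<bar>c i * v\<bar> \<le> b i powr (4/3)" using that by (auto simp: S_def abs_le_iff)
    show "Complex (b i) (c i * v) \<in> major_arc" using le b[of i] by (simp add: major_arc_def)
    show "(sqrt (b i) * v)\<^sup>2 \<le> 1"
      by (rule powr_three_halves_mult_le) (use le b[of i] in \<open>auto simp: c_def\<close>)
  qed
  have "(\<lambda>i. \<integral>v. s i v \<partial>lborel) \<longlonglongrightarrow> (\<integral>v. L * of_real (exp (- (A * v\<^sup>2))) \<partial>lborel)"
  proof (rule integral_dominated_convergence)
    show "(\<lambda>v. L * complex_of_real (exp (- (A * v\<^sup>2)))) \<in> borel_measurable lborel" by measurable
    show "integrable lborel (\<lambda>v. 2 * C * exp (- (A / 2 * v\<^sup>2)))"
      using gaussian_integral[of "A / 2"] A by (intro integrable_mult_right) (auto simp: has_bochner_integral_iff)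
    show "s i \<in> borel_measurable lborel" for i
    proof -
      have "(\<lambda>x. indicator (S i) x *\<^sub>R g (b i) x) \<in> borel_measurable borel"
        by (rule borel_measurable_continuous_on_indicator[OF _ cont[OF b(1)]]) (simp add: S_def)
      then have "(\<lambda>v. indicator (S i) (c i * v) *\<^sub>R g (b i) (c i * v)) \<in> borel_measurable borel"
        by (rule measurable_compose[rotated]) measurable
      then have "(\<lambda>v. (indicator (S i) (c i * v) *\<^sub>R g (b i) (c i * v)) * of_real (c i / gscale r (b i))) \<in> borel_measurable borel"
        by measurable
      then show ?thesis by (simp only: s_def [abs_def] mult_scaleR_left measurable_lborel2)
    qed
    show "AE v in lborel. norm (s i v) \<le> 2 * C * exp (- (A / 2 * v\<^sup>2))" for i
    proof (rule AE_I2)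
      fix v
      show "norm (s i v) \<le> 2 * C * exp (- (A / 2 * v\<^sup>2))"
      proof (cases "c i * v \<in> S i")
        case True
        define u where "u = sqrt (b i) * v"
        have u: "u\<^sup>2 \<le> 1" using in_major[OF True] by (simp add: u_def)
        have wu: "w i v = Complex 1 u" by (simp add: w_def u_def)
        have nw2: "norm (w i v) ^ 2 = 1 + u\<^sup>2" by (simp add: wu cmod_power2)
        have nw: "1 \<le> norm (w i v)" "norm (w i v) \<le> 2"
        proof -
          have "1\<^sup>2 \<le> norm (w i v) ^ 2" by (simp add: nw2)
          then show "1 \<le> norm (w i v)" by (rule power2_le_imp_le) simp
          have "norm (w i v) ^ 2 \<le> 2\<^sup>2" using u by (simp add: nw2)
          then show "norm (w i v) \<le> 2" by (rule power2_le_imp_le) simp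
        qed
        have t: "norm (Complex (b i) (c i * v)) < d"
          using sector_norm_le[of "Complex (b i) (c i * v)"] major_subset_sector in_major[OF True] b(3)[of i] by auto
        have n1: "norm (normalized r (Complex (b i) (c i * v))) \<le> C" by (rule normC[OF in_major(1)[OF True] t])
        have n2: "norm (w i v / w i v ^ (2 * r)) \<le> 2"
        proof -
          have "norm (w i v / w i v ^ (2 * r)) \<le> 2 / 1"
            unfolding norm_divide norm_power using nw by (intro frac_le one_le_power) auto
          then show ?thesis by simp
        qed
        \<comment> \<open>As \<open>u^2 <= 1\<close>, the division by \<open>w\<close> costs at most
          half of the Gaussian exponent.\<close>
        have "Re (of_real (A * v\<^sup>2) / w i v) = A * v\<^sup>2 / (1 + u\<^sup>2)"
          by (simp add: wu Re_divide)
        moreover have "A * v\<^sup>2 / (1 + u\<^sup>2) \<ge> A * v\<^sup>2 / 2"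
          using u A by (intro divide_left_mono mult_pos_pos) (auto simp: add_pos_nonneg)
        ultimately have n3: "norm (exp (- (of_real (A * v\<^sup>2) / w i v))) \<le> exp (- (A / 2 * v\<^sup>2))" by simp
        have "norm (s i v) = norm (normalized r (Complex (b i) (c i * v))) * norm (w i v / w i v ^ (2 * r)) *
            norm (exp (- (of_real (A * v\<^sup>2) / w i v)))"
        proof -
          have "indicator (S i) (c i * v) = (1::real)" using True by simp
          then show ?thesis by (simp only: s_eq scaleR_one norm_mult)
        qed
        also have "\<dots> \<le> C * 2 * exp (- (A / 2 * v\<^sup>2))"
          using n1 n2 n3 C0 by (intro mult_mono) auto
        finally show ?thesis by (simp add: mult_ac)
      next
        case False
        then show ?thesis using C0 by (simp add: s_def)
      qed
    qed
    show "AE v in lborel. (\<lambda>i. s i v) \<longlonglongrightarrow> L * of_real (exp (- (A * v\<^sup>2)))"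
    proof (rule AE_I2)
      fix v
      have ev: "eventually (\<lambda>i. c i * v \<in> S i) sequentially"
      proof -
        \<comment> \<open>The quotient is \<open>a^(1/6) |v|\<close>: a fixed \<open>v\<close>
          eventually lies in the rescaled arc.\<close>
        have "((\<lambda>a::real. a powr (3/2) * \<bar>v\<bar> / a powr (4/3)) \<longlongrightarrow> 0) (at_right 0)" by real_asymp
        then have "eventually (\<lambda>a::real. a powr (3/2) * \<bar>v\<bar> / a powr (4/3) < 1) (at_right 0)"
          by (rule order_tendstoD) simp
        moreover have "filterlim b (at_right 0) sequentially"
        proof -
          have "b i \<noteq> 0" for i using b(1)[of i] by simp
          then show ?thesis using blim b(1) by (simp add: filterlim_at)
        qed
        ultimately have "eventually (\<lambda>i. b i powr (3/2) * \<bar>v\<bar> / b i powr (4/3) < 1) sequentially"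
          by (rule eventually_compose_filterlim)
        then show ?thesis
        proof eventually_elim
          case (elim i)
          then have "c i * \<bar>v\<bar> < b i powr (4/3)" using b(1)[of i] by (simp add: c_def)
          then have "\<bar>c i * v\<bar> \<le> b i powr (4/3)" using c0[of i] by (simp add: abs_mult)
          then show ?case by (auto simp: S_def abs_le_iff)
        qed
      qed
      have t: "filterlim (\<lambda>i. Complex (b i) (c i * v)) (at 0 within major_arc) sequentially"
        unfolding filterlim_at
      proof
        show "eventually (\<lambda>i. Complex (b i) (c i * v) \<in> major_arc \<and> Complex (b i) (c i * v) \<noteq> 0) sequentially"
          using ev
        proof eventually_elim
          case (elim i)
          show ?case using in_major(1)[OF elim] b(1)[of i] by (simp add: complex_eq_iff)
        qed
        have "c \<longlonglongrightarrow> 0"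
        proof -
          have "(\<lambda>i. b i powr (3/2)) \<longlonglongrightarrow> 0 powr (3/2)"
            by (rule tendsto_powr2) (use blim b(1) in \<open>auto intro!: always_eventually less_imp_le\<close>)
          then show ?thesis by (simp add: c_def [abs_def])
        qed
        then have "(\<lambda>i. of_real (b i) + \<i> * of_real (c i * v)) \<longlonglongrightarrow> of_real 0 + \<i> * of_real (0 * v)"
          by (intro tendsto_intros blim)
        moreover have "of_real (b i) + \<i> * of_real (c i * v) = Complex (b i) (c i * v)" for i
          by (simp add: complex_eq_iff)
        ultimately show "(\<lambda>i. Complex (b i) (c i * v)) \<longlonglongrightarrow> 0" by simp
      qed
      have wl: "(\<lambda>i. w i v) \<longlonglongrightarrow> 1"
      proof -
        have "(\<lambda>i. 1 + \<i> * of_real (sqrt (b i) * v)) \<longlonglongrightarrow> 1 + \<i> * of_real (sqrt 0 * v)"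
          by (intro tendsto_intros blim)
        moreover have "1 + \<i> * of_real (sqrt (b i) * v) = w i v" for i by (simp add: w_def complex_eq_iff)
        ultimately show ?thesis by simp
      qed
      have "(\<lambda>i. normalized r (Complex (b i) (c i * v)) *
      (w i v / w i v ^ (2 * r)) * exp (- (of_real (A * v\<^sup>2) / w i v))) \<longlonglongrightarrow> L * (1 / 1 ^ (2 * r)) * exp (- (of_real (A * v\<^sup>2) / 1))"
        by (intro tendsto_intros filterlim_compose[OF norm_lim t] wl) auto
      also have "L * (1 / 1 ^ (2 * r)) * exp (- (of_real (A * v\<^sup>2) / 1)) = L * of_real (exp (- (A * v\<^sup>2)))"
        by (simp add: exp_of_real[symmetric])
      finally have "(\<lambda>i. normalized r (Complex (b i) (c i * v)) *
        (w i v / w i v ^ (2 * r)) * exp (- (of_real (A * v\<^sup>2) / w i v))) \<longlonglongrightarrow> L * of_real (exp (- (A * v\<^sup>2)))" .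
      moreover have "eventually (\<lambda>i. normalized r (Complex (b i) (c i * v)) *
        (w i v / w i v ^ (2 * r)) * exp (- (of_real (A * v\<^sup>2) / w i v)) = s i v) sequentially"
        using ev by eventually_elim (simp add: s_eq)
      ultimately show "(\<lambda>i. s i v) \<longlonglongrightarrow> L * of_real (exp (- (A * v\<^sup>2)))"
        by (rule Lim_transform_eventually)
    qed
  qed
  also have "(\<integral>v. L * of_real (exp (- (A * v\<^sup>2))) \<partial>lborel) = L * of_real (sqrt (pi / A))"
  proof -
    have "(\<integral>v. complex_of_real (exp (- (A * v\<^sup>2))) \<partial>lborel) = of_real (\<integral>v. exp (- (A * v\<^sup>2)) \<partial>lborel)"
      by (rule integral_complex_of_real)
    also have "(\<integral>v. exp (- (A * v\<^sup>2)) \<partial>lborel) = sqrt (pi / A)"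
      using gaussian_integral[OF A] by (simp add: has_bochner_integral_iff)
    finally show ?thesis by simp
  qed
  finally have "(\<lambda>i. integral (S i) (g (b i)) / of_real (gscale r (b i))) \<longlonglongrightarrow> L * of_real (sqrt (pi / A))"
    by (simp only: int_eq)
  then have "(\<lambda>i. (\<lambda>j. integral {-(al j powr (4/3))..al j powr (4/3)} (g (al j)) / of_real (gscale r (al j))) (i + N0)) \<longlonglongrightarrow> L * of_real (sqrt (pi / A))"
    by (simp only: S_def b_def)
  then have "(\<lambda>j. integral {-(al j powr (4/3))..al j powr (4/3)} (g (al j)) / of_real (gscale r (al j))) \<longlonglongrightarrow> L * of_real (sqrt (pi / A))"
    by (rule LIMSEQ_offset)
  then show ?thesis by (simp only: L_def A_def g_def [abs_def])
qed

text \<open>The limit has one factor from the peak sum on the major arc, one from the Gaussian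
  integral, and \<open>2 pi\<close> from Cauchy's formula.\<close>

lemma mcoeff_tendsto:
  "(\<lambda>N. mcoeff r N / of_real (gscale r (sqrt (pi\<^sup>2 / 3 / real N)))) \<longlonglongrightarrow>
     hsym_inf (\<lambda>j. 1 / of_nat j ^ 2) r / of_real (6 * pi) * of_real (sqrt (pi / (pi\<^sup>2 / 3))) / of_real (2 * pi)"
\<comment> \<open>The shift avoids \<open>N = 0\<close>, where the division by zero would give the
  value 0 for the saddle.\<close>
proof (rule LIMSEQ_imp_Suc)
  define al where "al i = sqrt (pi\<^sup>2 / 3 / real (Suc i))" for i
  have pos: "0 < al i" for i by (simp add: al_def)
  have lim: "al \<longlonglongrightarrow> 0"
  proof -
    have "(\<lambda>i. pi\<^sup>2 / 3 / real (Suc i)) \<longlonglongrightarrow> 0" by real_asymp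
    then have "(\<lambda>i. sqrt (pi\<^sup>2 / 3 / real (Suc i))) \<longlonglongrightarrow> sqrt 0" by (rule tendsto_real_sqrt)
    then show ?thesis by (simp add: al_def [abs_def])
  qed
  have al_r: "filterlim al (at_right 0) sequentially"
  proof -
    have "al i \<noteq> 0" for i using pos[of i] by simp
    then show ?thesis using lim pos by (simp add: filterlim_at)
  qed
  have N_eq: "pi\<^sup>2 / (3 * (al i)\<^sup>2) = real (Suc i)" for i
    by (simp add: al_def del: of_nat_Suc)
  define g where "g i \<theta> = peak_sum r (exp (- Complex (al i) \<theta>)) * exp (of_real (pi\<^sup>2 / (3 * (al i)\<^sup>2)) * Complex (al i) \<theta>)" for i \<theta>
  define be where "be i = al i powr (4/3)" for i
  \<comment> \<open>The bound for the minor arc relative to \<open>gscale\<close>: both exponentials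
    \<open>exp (pi^2/(3a))\<close> and the power \<open>a^(-2r)\<close> have cancelled.\<close>
  define err where "err a = 2 * pi * (2 ^ r * exp (- (a powr (-1/3) / 2304)) / a powr (5/2))" for a :: real
  have cont: "continuous_on X (g i)" for X i
    unfolding g_def [abs_def] by (intro continuous_intros continuous_on_peak_sum continuous_on_Complex pos)
  have int: "g i integrable_on {x..y}" for i x y
    by (rule integrable_continuous_real[OF cont])
  have main: "eventually (\<lambda>i. norm (of_real (2 * pi) * mcoeff r (Suc i) / of_real (gscale r (al i)) -
     integral {- be i..be i} (g i) / of_real (gscale r (al i))) \<le> err (al i)) sequentially"
  proof -
    have "eventually (\<lambda>i. al i < 1) sequentially" using lim by (rule order_tendstoD) simp
    moreover from eventually_compose_filterlim[OF minor_peak_sum_bound[of r] al_r]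
    have "eventually (\<lambda>i. \<forall>th. al i powr (4/3) \<le> \<bar>th\<bar> \<longrightarrow> \<bar>th\<bar> \<le> pi \<longrightarrow>
      norm (peak_sum r (exp (- Complex (al i) th))) \<le> (2 / (al i)\<^sup>2) ^ r * exp (pi\<^sup>2 / (3 * al i) - al i powr (-1/3) / 2304)) sequentially" .
    ultimately show ?thesis
    proof eventually_elim
      case (elim i)
      define a where "a = al i"
      have a: "0 < a" "a < 1" using pos elim by (auto simp: a_def)
      define B where "B = (2 / a\<^sup>2) ^ r * exp (pi\<^sup>2 / (3 * a) - a powr (-1/3) / 2304) * exp (pi\<^sup>2 / (3 * a))"
      have be: "0 < be i" "be i \<le> pi"
      proof -
        show "0 < be i" using a by (simp add: be_def a_def)
        have "be i \<le> 1" unfolding be_def a_def[symmetric] using a by (intro powr_le1) auto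
        then show "be i \<le> pi" using pi_gt3 by linarith
      qed
      have bnd: "norm (g i \<theta>) \<le> B" if "be i \<le> \<bar>\<theta>\<bar>" "\<bar>\<theta>\<bar> \<le> pi" for \<theta>
      proof -
        have "norm (exp (of_real (pi\<^sup>2 / (3 * (al i)\<^sup>2)) * Complex (al i) \<theta>)) = exp (pi\<^sup>2 / (3 * a\<^sup>2) * a)"
          by (simp add: a_def)
        also have "pi\<^sup>2 / (3 * a\<^sup>2) * a = pi\<^sup>2 / (3 * a)" using a by (simp add: power2_eq_square)
        finally have e: "norm (exp (of_real (pi\<^sup>2 / (3 * (al i)\<^sup>2)) * Complex (al i) \<theta>)) = exp (pi\<^sup>2 / (3 * a))" .
        have "norm (peak_sum r (exp (- Complex (al i) \<theta>))) \<le> (2 / a\<^sup>2) ^ r * exp (pi\<^sup>2 / (3 * a) - a powr (-1/3) / 2304)"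
          using elim(2) that by (simp add: a_def be_def)
        then show ?thesis unfolding g_def norm_mult e B_def by (rule mult_right_mono) simp
      qed
      have B0: "0 \<le> B" by (simp add: B_def)
      have e1: "norm (integral {-pi..- be i} (g i)) \<le> B * pi"
      proof -
        have "norm (integral {-pi..- be i} (g i)) \<le> B * (- be i - - pi)"
          using be by (intro integral_bound cont ballI bnd) auto
        also have "\<dots> \<le> B * pi" using be B0 by (intro mult_left_mono) auto
        finally show ?thesis .
      qed
      have e2: "norm (integral {be i..pi} (g i)) \<le> B * pi"
      proof -
        have "norm (integral {be i..pi} (g i)) \<le> B * (pi - be i)"
          using be by (intro integral_bound cont ballI bnd) auto
        also have "\<dots> \<le> B * pi" using be B0 by (intro mult_left_mono) auto
        finally show ?thesis .
      qed
      have "(g i has_integral (of_real (2 * pi) * mcoeff r (Suc i))) {-pi..pi}"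
        using mcoeff_integral[OF pos[of i], of r "Suc i"] unfolding g_def [abs_def] N_eq by simp
      then have "of_real (2 * pi) * mcoeff r (Suc i) = integral {-pi..pi} (g i)" by (simp add: integral_unique)
      also have "\<dots> = integral {-pi..- be i} (g i) + integral {- be i..pi} (g i)"
        using be by (intro Henstock_Kurzweil_Integration.integral_combine[symmetric] int) auto
      also have "integral {- be i..pi} (g i) = integral {- be i..be i} (g i) + integral {be i..pi} (g i)"
        using be by (intro Henstock_Kurzweil_Integration.integral_combine[symmetric] int) auto
      finally have eq: "of_real (2 * pi) * mcoeff r (Suc i) - integral {- be i..be i} (g i) =
         integral {-pi..- be i} (g i) + integral {be i..pi} (g i)" by simp
      have gs: "0 < gscale r a" using a by (simp add: gscale_def)
      have "norm (of_real (2 * pi) * mcoeff r (Suc i) / of_real (gscale r (al i)) -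
          integral {- be i..be i} (g i) / of_real (gscale r (al i))) =
          norm (of_real (2 * pi) * mcoeff r (Suc i) - integral {- be i..be i} (g i)) / gscale r a"
        using gs by (simp only: diff_divide_distrib[symmetric] norm_divide norm_of_real a_def abs_of_pos)
      also have "\<dots> \<le> (B * pi + B * pi) / gscale r a"
        unfolding eq using gs e1 e2 by (intro divide_right_mono norm_triangle_le add_mono) auto
      also have "\<dots> = err a"
      proof -
        have Beq: "B = 2 ^ r / a ^ (2 * r) * exp (- (a powr (-1/3) / 2304)) * exp (2 * pi\<^sup>2 / (3 * a))"
        proof -
          have "exp (pi\<^sup>2 / (3 * a) - a powr (-1/3) / 2304) * exp (pi\<^sup>2 / (3 * a)) =
             exp (- (a powr (-1/3) / 2304)) * exp (2 * pi\<^sup>2 / (3 * a))"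
            by (simp flip: exp_add)
          then show ?thesis by (simp add: B_def power_divide power_mult)
        qed
        show ?thesis unfolding err_def Beq gscale_def using a by (simp add: field_simps)
      qed
      finally show ?case by (simp add: a_def)
    qed
  qed
  have err0: "(\<lambda>i. err (al i)) \<longlonglongrightarrow> 0"
  proof (rule filterlim_compose[OF _ al_r])
    have "((\<lambda>a::real. exp (- (a powr (-1/3) / 2304)) / a powr (5/2)) \<longlongrightarrow> 0) (at_right 0)" by real_asymp
    from tendsto_mult_left[OF this, of "2 * pi * 2 ^ r"] show "(err \<longlongrightarrow> 0) (at_right 0)"
      by (simp add: err_def [abs_def] mult.assoc)
  qed
  define R where "R = hsym_inf (\<lambda>j. 1 / of_nat j ^ 2) r / of_real (6 * pi) * of_real (sqrt (pi / (pi\<^sup>2 / 3)))"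
  have "(\<lambda>i. (of_real (2 * pi) * mcoeff r (Suc i) / of_real (gscale r (al i)) - integral {- be i..be i} (g i) / of_real (gscale r (al i))) +
      integral {- be i..be i} (g i) / of_real (gscale r (al i))) \<longlonglongrightarrow> 0 + R"
    unfolding R_def g_def [abs_def] be_def
    by (intro tendsto_add major_integral_tendsto[OF pos lim] Lim_null_comparison[OF main[unfolded g_def [abs_def] be_def] err0])
  then have "(\<lambda>i. (of_real (2 * pi) * mcoeff r (Suc i) / of_real (gscale r (al i))) / of_real (2 * pi)) \<longlonglongrightarrow> R / of_real (2 * pi)"
    by (intro tendsto_divide) auto
  then show "(\<lambda>N. mcoeff r (Suc N) / of_real (gscale r (sqrt (pi\<^sup>2 / 3 / real (Suc N))))) \<longlonglongrightarrow>
     hsym_inf (\<lambda>j. 1 / of_nat j ^ 2) r / of_real (6 * pi) * of_real (sqrt (pi / (pi\<^sup>2 / 3))) / of_real (2 * pi)"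
    unfolding al_def R_def by simp
qed

section \<open>Bernoulli polynomials at 1/2\<close>

lemma norm_hsym_power_le:
  fixes X :: "nat \<Rightarrow> complex"
  assumes "\<And>j. 1 \<le> j \<Longrightarrow> norm (X j) \<le> 1 / real j ^ 2"
  shows "norm (hsym X r n * x ^ r) \<le> (2 * norm x) ^ r"
proof -
  have "norm (hsym X r n) \<le> (2 * 1) ^ r" by (rule norm_hsym_le) (use assms in auto)
  then have "norm (hsym X r n) * norm x ^ r \<le> 2 ^ r * norm x ^ r" by (intro mult_right_mono) auto
  then show ?thesis by (simp add: norm_mult norm_power power_mult_distrib)
qed

text \<open>The classical generating function, by induction on the number of variables:
  \<open>hsym_Suc_Suc\<close> relates the series \<open>A\<close> in \<open>Suc n\<close> and
  \<open>B\<close> in \<open>n\<close> variables by \<open>A * (1 - y) = B\<close>. The radius 1/2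
  comes from the bound \<open>(2 * norm x) ^ r\<close> for the terms.\<close>

lemma hsym_power_series:
  fixes X :: "nat \<Rightarrow> complex"
  assumes X: "\<And>j. 1 \<le> j \<Longrightarrow> norm (X j) \<le> 1 / real j ^ 2" and x: "norm x < 1 / 2"
  shows "(\<lambda>r. hsym X r n * x ^ r) sums (\<Prod>j=1..n. 1 / (1 - x * X j))"
proof -
  have summ: "summable (\<lambda>r. hsym X r n * x ^ r)" for n
    by (rule summable_comparison_test'[OF summable_geometric[of "2 * norm x"]]) (use x norm_hsym_power_le[OF X] in auto)
  show ?thesis
  proof (induction n)
    case 0
    have "hsym X r 0 * x ^ r = (if r = 0 then 1 else 0)" for r by (cases r) auto
    then show ?case using sums_single[of 0 "\<lambda>_. 1 :: complex"] by simp
  next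
    case (Suc n)
    define a where "a r = hsym X r (Suc n) * x ^ r" for r
    define b where "b r = hsym X r n * x ^ r" for r
    define A where "A = suminf a"
    define B where "B = suminf b"
    define y where "y = x * X (Suc n)"
    have sa: "summable a" and sb: "summable b" unfolding a_def [abs_def] b_def [abs_def] by (rule summ)+
    have rec: "a (Suc r) = b (Suc r) + y * a r" for r
      by (simp only: a_def b_def y_def hsym_Suc_Suc power_Suc) (simp add: algebra_simps)
    have "A - 1 = (\<Sum>r. a (Suc r))" using suminf_split_head[OF sa] by (simp add: A_def a_def)
    also have "\<dots> = (\<Sum>r. b (Suc r) + y * a r)" by (simp only: rec)
    also have "\<dots> = (\<Sum>r. b (Suc r)) + y * A"
      using sa sb by (simp add: suminf_add[symmetric] summable_Suc_iff summable_mult suminf_mult A_def)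
    also have "(\<Sum>r. b (Suc r)) = B - 1" using suminf_split_head[OF sb] by (simp add: B_def b_def)
    finally have AB: "A * (1 - y) = B" by (simp add: algebra_simps)
    have "norm y < 1"
    proof -
      have "norm (X (Suc n)) \<le> 1 / real (Suc n) ^ 2" by (rule X) simp
      also have "\<dots> \<le> 1" by simp
      finally have "norm x * norm (X (Suc n)) \<le> norm x * 1" by (intro mult_left_mono) auto
      then show ?thesis using x by (simp add: y_def norm_mult)
    qed
    then have "1 - y \<noteq> 0" by auto
    then have "A = B * (1 / (1 - y))" using AB by (simp add: field_simps)
    moreover have "B = (\<Prod>j=1..n. 1 / (1 - x * X j))" using Suc by (simp add: B_def b_def [abs_def] sums_iff)
    ultimately show ?case using sa by (simp add: sums_iff A_def a_def[abs_def] y_def)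
  qed
qed

text \<open>As the number of variables grows, the inverse of the product becomes Euler's product for
  the sine; Tannery's theorem justifies the limit inside the sum over \<open>r\<close>.\<close>

lemma hsym_inf_power_series:
  fixes w :: complex
  assumes w: "norm w < 1 / 2" "w \<noteq> 0"
  defines "X \<equiv> \<lambda>j. 1 / of_nat j ^ 2 :: complex"
  shows "(\<Sum>r. hsym_inf X r * (w\<^sup>2) ^ r) * sin (of_real pi * w) = of_real pi * w"
    and "summable (\<lambda>r. norm (hsym_inf X r * (w\<^sup>2) ^ r))"
proof -
  have X: "norm (X j) \<le> 1 / real j ^ 2" for j by (simp add: X_def norm_divide norm_power)
  have x: "norm (w\<^sup>2) < 1 / 2"
  proof -
    have "norm w ^ 2 \<le> norm w ^ 1" using w by (intro power_decreasing) auto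
    then show ?thesis using w by (simp add: norm_power)
  qed
  have "summable (\<lambda>r. norm (hsym_inf X r * (w\<^sup>2) ^ r)) \<and>
      (\<lambda>n. \<Sum>r. hsym X r n * (w\<^sup>2) ^ r) \<longlonglongrightarrow> (\<Sum>r. hsym_inf X r * (w\<^sup>2) ^ r)"
  proof (rule tannerys_theorem[THEN conjunct2])
    show "(\<lambda>n. hsym X r n * (w\<^sup>2) ^ r) \<longlonglongrightarrow> hsym_inf X r * (w\<^sup>2) ^ r" for r
      by (intro tendsto_mult tendsto_const hsym_LIMSEQ[where B = 1]) (use X in auto)
    show "summable (\<lambda>r. (2 * norm (w\<^sup>2)) ^ r)" using x by (intro summable_geometric) auto
    show "eventually (\<lambda>(r, n). norm (hsym X r n * (w\<^sup>2) ^ r) \<le> (2 * norm (w\<^sup>2)) ^ r) (sequentially \<times>\<^sub>F sequentially)"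
      using norm_hsym_power_le[of X, OF X] by (intro always_eventually) auto
  qed simp
  then have sm: "summable (\<lambda>r. norm (hsym_inf X r * (w\<^sup>2) ^ r))"
    and lim: "(\<lambda>n. \<Sum>r. hsym X r n * (w\<^sup>2) ^ r) \<longlonglongrightarrow> (\<Sum>r. hsym_inf X r * (w\<^sup>2) ^ r)" by auto
  show "summable (\<lambda>r. norm (hsym_inf X r * (w\<^sup>2) ^ r))" by (rule sm)
  have fin: "(\<Sum>r. hsym X r n * (w\<^sup>2) ^ r) = (\<Prod>j=1..n. 1 / (1 - w\<^sup>2 * X j))" for n
    using hsym_power_series[of X "w\<^sup>2" n] X x by (simp add: sums_iff)
  have nz: "1 - w\<^sup>2 * X j \<noteq> 0" if "1 \<le> j" for j
  proof -
    have "norm (X j) \<le> 1"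
    proof -
      have "1 / real j ^ 2 \<le> 1" using that by simp
      then show ?thesis using X[of j] by linarith
    qed
    then have "norm (w\<^sup>2) * norm (X j) \<le> norm (w\<^sup>2) * 1" by (intro mult_left_mono) auto
    then have "norm (w\<^sup>2 * X j) < 1" using x by (simp add: norm_mult)
    then show ?thesis by auto
  qed
  have sin_lim: "(\<lambda>n. of_real pi * w * (\<Prod>k=1..n. 1 - w ^ 2 / of_nat k ^ 2)) \<longlonglongrightarrow> sin (of_real pi * w)"
    by (rule sin_product_formula_complex)
  have "(\<lambda>n. (\<Sum>r. hsym X r n * (w\<^sup>2) ^ r) * (of_real pi * w * (\<Prod>k=1..n. 1 - w ^ 2 / of_nat k ^ 2)))
     \<longlonglongrightarrow> (\<Sum>r. hsym_inf X r * (w\<^sup>2) ^ r) * sin (of_real pi * w)"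
    by (intro tendsto_mult lim sin_lim)
  moreover have "(\<Sum>r. hsym X r n * (w\<^sup>2) ^ r) * (of_real pi * w * (\<Prod>k=1..n. 1 - w ^ 2 / of_nat k ^ 2)) = of_real pi * w" for n
  proof -
    have "(\<Prod>j=1..n. 1 / (1 - w\<^sup>2 * X j)) * (\<Prod>k=1..n. 1 - w ^ 2 / of_nat k ^ 2) = 1"
      unfolding prod.distrib[symmetric] by (rule prod.neutral) (use nz in \<open>auto simp: X_def\<close>)
    then show ?thesis unfolding fin by (simp add: mult_ac)
  qed
  ultimately have "(\<lambda>n. of_real pi * w) \<longlonglongrightarrow> (\<Sum>r. hsym_inf X r * (w\<^sup>2) ^ r) * sin (of_real pi * w)" by (simp only:)
  then show "(\<Sum>r. hsym_inf X r * (w\<^sup>2) ^ r) * sin (of_real pi * w) = of_real pi * w"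
    using LIMSEQ_unique tendsto_const by blast
qed

definition hsym_inf_fps :: "complex fps" where
  "hsym_inf_fps = Abs_fps (\<lambda>m. if even m then hsym_inf (\<lambda>j. 1 / of_nat j ^ 2) (m div 2) else 0)"

text \<open>Both sides expand functions that agree near 0; uniqueness of expansions makes this a
  formal identity.\<close>

lemma hsym_inf_fps_mult_sin: "hsym_inf_fps * fps_sin (of_real pi) = fps_const (of_real pi) * fps_X"
proof -
  let ?H = "hsym_inf (\<lambda>j. 1 / of_nat j ^ 2)"
  have sums_ev: "(\<lambda>m. fps_nth hsym_inf_fps m * w ^ m) sums (\<Sum>r. ?H r * (w\<^sup>2) ^ r)"
    if "norm w < 1 / 2" "w \<noteq> 0" for w :: complex
  proof -
    have "(\<lambda>r. ?H r * (w\<^sup>2) ^ r) sums (\<Sum>r. ?H r * (w\<^sup>2) ^ r)"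
      by (rule summable_sums[OF summable_norm_cancel[OF hsym_inf_power_series(2)[OF that]]])
    moreover have "(\<lambda>r. fps_nth hsym_inf_fps (2 * r) * w ^ (2 * r)) = (\<lambda>r. ?H r * (w\<^sup>2) ^ r)"
      by (simp add: hsym_inf_fps_def power_mult)
    moreover have "(\<lambda>r. fps_nth hsym_inf_fps (2 * r) * w ^ (2 * r)) sums c \<longleftrightarrow> (\<lambda>m. fps_nth hsym_inf_fps m * w ^ m) sums c" for c
      by (rule sums_mono_reindex) (auto simp: strict_mono_def hsym_inf_fps_def elim!: evenE)
    ultimately show ?thesis by simp
  qed
  have cr: "fps_conv_radius hsym_inf_fps > 0"
  proof -
    have "summable (\<lambda>m. fps_nth hsym_inf_fps m * (1/4) ^ m)"
      using sums_ev[of "1/4"] by (auto simp: sums_iff)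
    then have "fps_conv_radius hsym_inf_fps \<ge> norm (1/4 :: complex)"
      unfolding fps_conv_radius_def by (rule conv_radius_geI)
    then show ?thesis by (rule less_le_trans[rotated]) simp
  qed
  have "eval_fps hsym_inf_fps has_fps_expansion hsym_inf_fps" using cr by (rule eval_fps_has_fps_expansion)
  then have "(\<lambda>w. eval_fps hsym_inf_fps w * sin (of_real pi * w)) has_fps_expansion hsym_inf_fps * fps_sin (of_real pi)"
    by (intro has_fps_expansion_mult has_fps_expansion_sin)
  moreover have "eventually (\<lambda>w. eval_fps hsym_inf_fps w * sin (of_real pi * w) = of_real pi * w) (nhds 0)"
  proof -
    have "eventually (\<lambda>w::complex. w \<in> ball 0 (1/2)) (nhds 0)" by (rule eventually_nhds_in_open) auto
    then show ?thesis
    proof eventually_elim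
      case (elim w)
      show ?case
      proof (cases "w = 0")
        case False
        then show ?thesis using hsym_inf_power_series(1)[of w] sums_ev[of w] elim
          by (simp add: eval_fps_def sums_iff)
      qed simp
    qed
  qed
  ultimately have "(\<lambda>w. of_real pi * w) has_fps_expansion hsym_inf_fps * fps_sin (of_real pi)"
    by (subst (asm) has_fps_expansion_cong[OF _ refl])
  moreover have "(\<lambda>w::complex. of_real pi * w) has_fps_expansion fps_const (of_real pi) * fps_X"
    by (rule has_fps_expansion_cmult_left[OF has_fps_expansion_fps_X])
  ultimately show ?thesis by (rule fps_expansion_unique_complex)
qed

text \<open>The series \<open>f(c z)\<close>, with real coefficients regarded as complex. The
  imaginary value \<open>c = 2 pi i\<close> turns hyperbolic into trigonometric functions.\<close>

definition fps_scale :: "complex \<Rightarrow> real fps \<Rightarrow> complex fps" where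
  "fps_scale c f = Abs_fps (\<lambda>n. of_real (fps_nth f n) * c ^ n)"

lemma fps_scale_mult: "fps_scale c (f * g) = fps_scale c f * fps_scale c g"
proof (rule fps_ext)
  fix n
  have "(\<Sum>i=0..n. of_real (fps_nth f i * fps_nth g (n - i)) * c ^ n) =
     (\<Sum>i=0..n. (of_real (fps_nth f i) * c ^ i) * (of_real (fps_nth g (n - i)) * c ^ (n - i)))"
    by (intro sum.cong refl) (auto simp: mult_ac simp flip: power_add)
  then show "fps_nth (fps_scale c (f * g)) n = fps_nth (fps_scale c f * fps_scale c g) n"
    by (simp add: fps_scale_def fps_mult_nth sum_distrib_right)
qed

lemma fps_scale_diff: "fps_scale c (f - g) = fps_scale c f - fps_scale c g"
  by (rule fps_ext) (simp add: fps_scale_def algebra_simps)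

lemma fps_scale_exp: "fps_scale c (fps_exp a) = fps_exp (of_real a * c)"
  by (rule fps_ext) (simp add: fps_scale_def power_mult_distrib)

lemma fps_scale_X: "fps_scale c fps_X = fps_const c * fps_X"
  by (rule fps_ext) (simp add: fps_scale_def fps_X_def)

text \<open>At \<open>x = 1/2\<close> the generating function of the Bernoulli polynomials is
  \<open>t / (exp (t/2) - exp (-t/2))\<close>, which at \<open>t = 2 pi i w\<close> equals
  \<open>pi w / sin (pi w)\<close>.\<close>

lemma hsym_inf_inverse_squares_eq_bernoulli:
  "fact (2 * k) * hsym_inf (\<lambda>j. 1 / of_nat j ^ 2) k =
     complex_of_real ((-1) ^ k * (2 * pi) ^ (2 * k) * bernoulli_poly (2 * k) (1 / 2))"
proof -
  define E where "E = (fps_exp 1 - 1 :: real fps)"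
  define Bf where "Bf = fps_X * fps_exp (1 / 2) / E"
  \<comment> \<open>\<open>exp t - 1\<close> is not a unit among power series; the quotient is exact
    because its order 1 is matched by the factor \<open>t\<close> of the numerator.\<close>
  have E0: "E \<noteq> 0" and sd: "subdegree E = 1"
  proof -
    have n1: "fps_nth E 1 \<noteq> 0" "fps_nth E 0 = 0" by (simp_all add: E_def)
    then show "E \<noteq> 0" by auto
    show "subdegree E = 1" by (rule subdegreeI) (use n1 in auto)
  qed
  have "subdegree (fps_X * fps_exp (1 / 2) :: real fps) \<ge> 1"
    by (rule subdegree_geI) (auto simp: fps_eq_iff)
  then have "E dvd fps_X * fps_exp (1 / 2)" using E0 sd by (subst fps_dvd_iff) auto
  then have BE: "Bf * E = fps_X * fps_exp (1 / 2)" unfolding Bf_def by (rule dvd_div_mult_self)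
  have "Bf * (fps_exp (1 / 2) - fps_exp (- (1 / 2))) = fps_X"
  proof -
    have "E * fps_exp (- (1 / 2)) = fps_exp (1 / 2) - fps_exp (- (1 / 2))"
      by (simp add: E_def algebra_simps flip: fps_exp_add_mult)
    then have "Bf * (fps_exp (1 / 2) - fps_exp (- (1 / 2))) = (Bf * E) * fps_exp (- (1 / 2))"
      by (simp only: mult.assoc)
    also have "\<dots> = fps_X * (fps_exp (1 / 2) * fps_exp (- (1 / 2)))" by (simp only: BE mult.assoc)
    finally show ?thesis by (simp flip: fps_exp_add_mult)
  qed
  then have "fps_scale (2 * pi * \<i>) (Bf * (fps_exp (1 / 2) - fps_exp (- (1 / 2)))) = fps_scale (2 * pi * \<i>) fps_X" by simp
  then have 1: "fps_scale (2 * pi * \<i>) Bf * (fps_exp (pi * \<i>) - fps_exp (- (pi * \<i>))) = fps_const (2 * pi * \<i>) * fps_X"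
    by (simp add: fps_scale_mult fps_scale_diff fps_scale_exp fps_scale_X)
  have sin: "fps_exp (pi * \<i>) - fps_exp (- (pi * \<i>)) = fps_const (2 * \<i>) * fps_sin (complex_of_real pi)"
  proof -
    have "fps_sin (complex_of_real pi) = fps_const (1 / (2 * \<i>)) * (fps_exp (\<i> * pi) - fps_exp (- \<i> * pi))"
      by (rule fps_sin_fps_exp_ii[THEN trans]) (simp add: fps_divide_unit fps_const_inverse)
    then show ?thesis by (simp add: mult.assoc[symmetric] mult.commute)
  qed
  have "fps_const (2 * \<i>) * (fps_scale (2 * pi * \<i>) Bf * fps_sin (of_real pi)) = fps_const (2 * \<i>) * (fps_const (of_real pi) * fps_X)"
    using 1 unfolding sin by (simp add: mult_ac)
  then have "fps_scale (2 * pi * \<i>) Bf * fps_sin (of_real pi) = hsym_inf_fps * fps_sin (of_real pi)"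
    unfolding hsym_inf_fps_mult_sin by simp
  moreover have "fps_sin (complex_of_real pi) \<noteq> 0"
  proof
    assume "fps_sin (complex_of_real pi) = 0"
    then have "fps_nth (fps_sin (complex_of_real pi)) 1 = 0" by simp
    then show False by (simp add: fps_sin_def)
  qed
  ultimately have "fps_scale (2 * pi * \<i>) Bf = hsym_inf_fps" by simp
  then have "fps_nth (fps_scale (2 * pi * \<i>) Bf) (2 * k) = fps_nth hsym_inf_fps (2 * k)" by simp
  then have "hsym_inf (\<lambda>j. 1 / of_nat j ^ 2) k = of_real (fps_nth Bf (2 * k)) * (2 * pi * \<i>) ^ (2 * k)"
    by (simp add: fps_scale_def hsym_inf_fps_def)
  moreover have "(2 * pi * \<i>) ^ (2 * k) = of_real ((-1) ^ k * (2 * pi) ^ (2 * k))"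
  proof -
    have "(2 * pi * \<i>) ^ (2 * k) = ((2 * pi * \<i>)\<^sup>2) ^ k" by (rule power_mult)
    also have "(2 * pi * \<i>)\<^sup>2 = of_real (-1 * (2 * pi)\<^sup>2)" by (simp add: power_mult_distrib)
    also have "of_real (-1 * (2 * pi)\<^sup>2) ^ k = complex_of_real ((-1 * (2 * pi)\<^sup>2) ^ k)" by (rule of_real_power[symmetric])
    also have "(-1 * (2 * pi)\<^sup>2) ^ k = (-1) ^ k * (2 * pi) ^ (2 * k)" by (simp only: power_mult_distrib power_mult)
    finally show ?thesis .
  qed
  moreover have "bernoulli_poly (2 * k) (1 / 2) = fact (2 * k) * fps_nth Bf (2 * k)"
    by (simp add: bernoulli_poly_def Bf_def E_def)
  ultimately show ?thesis by simp
qed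

text \<open>All monomials are nonnegative and the power of the first variable, which is 1, is among
  them, so the limit has modulus at least 1. This allows division by the limiting constant.\<close>

lemma hsym_inf_inverse_squares_nonzero: "hsym_inf (\<lambda>j. 1 / of_nat j ^ 2) k \<noteq> 0"
proof -
  let ?X = "\<lambda>j. 1 / of_nat j ^ 2 :: complex"
  define Y where "Y = (\<lambda>j. 1 / real j ^ 2)"
  have re: "hsym ?X r n = of_real (hsym Y r n)" for r n
    by (induction r arbitrary: n) (simp_all add: Y_def)
  have pos: "1 \<le> hsym Y r n" if "1 \<le> n" for r n
    using that
  proof (induction r arbitrary: n)
    case (Suc r)
    have nonneg: "0 \<le> hsym Y r j" for j
      by (induction r arbitrary: j) (auto simp: Y_def intro!: sum_nonneg)
    have "1 \<le> Y 1 * hsym Y r 1" using Suc.IH[of 1] by (simp add: Y_def)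
    also have "\<dots> \<le> (\<Sum>j=1..n. Y j * hsym Y r j)"
      using Suc.prems nonneg by (intro member_le_sum) (auto simp: Y_def)
    finally show ?case by simp
  qed simp
  have "(\<lambda>n. hsym ?X k n) \<longlonglongrightarrow> hsym_inf ?X k"
    by (rule hsym_LIMSEQ[where B = 1]) (auto simp: norm_divide norm_power)
  then have "(\<lambda>n. norm (hsym ?X k n)) \<longlonglongrightarrow> norm (hsym_inf ?X k)" by (rule tendsto_norm)
  moreover have "eventually (\<lambda>n. 1 \<le> norm (hsym ?X k n)) sequentially"
    using eventually_ge_at_top[of 1] by eventually_elim (use pos in \<open>simp add: re abs_of_nonneg order_trans[OF zero_le_one]\<close>)
  ultimately have "1 \<le> norm (hsym_inf ?X k)" by (rule tendsto_lowerbound) simp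
  then show ?thesis by auto
qed

section \<open>Asymptotics of the moments\<close>

text \<open>The stationary point of \<open>pi^2/(3a) + N a\<close>.\<close>

definition saddle :: "nat \<Rightarrow> real" where
  "saddle N = sqrt (pi\<^sup>2 / 3 / real N)"

lemma saddle_tendsto_0: "saddle \<longlonglongrightarrow> 0"
proof -
  have "(\<lambda>N. pi\<^sup>2 / 3 / real N) \<longlonglongrightarrow> 0" by real_asymp
  then have "(\<lambda>N. sqrt (pi\<^sup>2 / 3 / real N)) \<longlonglongrightarrow> sqrt 0" by (rule tendsto_real_sqrt)
  then show ?thesis by (simp add: saddle_def [abs_def])
qed

definition mcoeff_limit :: "nat \<Rightarrow> complex" where
  "mcoeff_limit r = hsym_inf (\<lambda>j. 1 / of_nat j ^ 2) r / of_real (6 * pi) * of_real (sqrt (pi / (pi\<^sup>2 / 3))) / of_real (2 * pi)"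

text \<open>In \<open>durfee_moment_even\<close> a term with \<open>r < k\<close> is smaller than
  the main one by the order \<open>saddle N ^ (2 * (k - r))\<close>.\<close>

lemma durfee_moment_tendsto:
  "(\<lambda>N. complex_of_real (durfee_moment (2 * k) N / gscale k (saddle N))) \<longlonglongrightarrow> fact (2 * k) * mcoeff_limit k"
proof -
  have low: "(\<lambda>N. mcoeff r N / of_real (gscale k (saddle N))) \<longlonglongrightarrow> 0" if r: "r < k" for r
  proof -
    have "(\<lambda>N. mcoeff r N / of_real (gscale r (saddle N)) * of_real (saddle N ^ (2 * (k - r)))) \<longlonglongrightarrow>
        mcoeff_limit r * of_real (0 ^ (2 * (k - r)))"
      unfolding mcoeff_limit_def saddle_def
      by (intro tendsto_mult mcoeff_tendsto tendsto_of_real tendsto_power saddle_tendsto_0[unfolded saddle_def [abs_def]])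
    then have "(\<lambda>N. mcoeff r N / of_real (gscale r (saddle N)) * of_real (saddle N ^ (2 * (k - r)))) \<longlonglongrightarrow> 0"
      using r by (simp add: power_0_left)
    moreover have "eventually (\<lambda>N. mcoeff r N / of_real (gscale r (saddle N)) * of_real (saddle N ^ (2 * (k - r))) =
        mcoeff r N / of_real (gscale k (saddle N))) sequentially"
      using eventually_gt_at_top[of 0]
    proof eventually_elim
      case (elim N)
      define a where "a = saddle N"
      have a: "0 < a" using elim by (simp add: a_def saddle_def)
      have "a ^ (2 * k) = a ^ (2 * r) * a ^ (2 * (k - r))"
      proof -
        have "2 * k = 2 * r + 2 * (k - r)" using r by simp
        then show ?thesis by (simp only: power_add)
      qed
      then have "gscale r a = gscale k a * a ^ (2 * (k - r))" using a by (simp add: gscale_def)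
      then show ?case using a by (simp add: a_def[symmetric])
    qed
    ultimately show ?thesis by (rule Lim_transform_eventually)
  qed
  let ?s = "fps_exp 1 + fps_exp (-1) - 2 :: complex fps"
  have "(\<lambda>N. fact (2 * k) * (mcoeff k N / of_real (gscale k (saddle N)) +
      (\<Sum>r<k. fps_nth (?s ^ r) (2 * k) * (mcoeff r N / of_real (gscale k (saddle N)))))) \<longlonglongrightarrow>
      fact (2 * k) * (mcoeff_limit k + (\<Sum>r<k. fps_nth (?s ^ r) (2 * k) * 0))"
    by (intro tendsto_mult tendsto_add tendsto_sum tendsto_const low mcoeff_tendsto[folded saddle_def mcoeff_limit_def]) simp
  moreover have "fact (2 * k) * (mcoeff k N / of_real (gscale k (saddle N)) +
      (\<Sum>r<k. fps_nth (?s ^ r) (2 * k) * (mcoeff r N / of_real (gscale k (saddle N))))) =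
      complex_of_real (durfee_moment (2 * k) N / gscale k (saddle N))" for N
    by (simp only: of_real_divide durfee_moment_even times_divide_eq_right add_divide_distrib[symmetric]
        sum_divide_distrib[symmetric])
  ultimately show ?thesis by (simp only: sum.neutral_const mult_zero_right add_0_right)
qed

text \<open>As \<open>saddle N = pi / sqrt (3N)\<close>, its exponent \<open>5/2 - 2k\<close>
  becomes the exponent \<open>k - 5/4\<close> of \<open>3N\<close>.\<close>

lemma gscale_saddle:
  assumes N: "0 < N"
  shows "gscale k (saddle N) = pi powr (5/2 - 2 * real k) * 3 powr (real k - 5/4) * real N powr (real k - 5/4) * exp (2 * pi * sqrt (real N / 3))"
proof -
  define a where "a = saddle N"
  have a_eq: "a = pi / sqrt (3 * real N)"
    by (simp add: a_def saddle_def real_sqrt_divide real_sqrt_mult)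
  have a: "0 < a" using N by (simp add: a_eq)
  have "a powr (5/2) / a ^ (2 * k) = a powr (5/2 - 2 * real k)"
  proof -
    have "a ^ (2 * k) = a powr (2 * real k)" using a powr_realpow[of a "2 * k"] by simp
    then show ?thesis by (simp add: powr_diff)
  qed
  also have "\<dots> = pi powr (5/2 - 2 * real k) / sqrt (3 * real N) powr (5/2 - 2 * real k)"
    unfolding a_eq by (rule powr_divide)
  also have "sqrt (3 * real N) powr (5/2 - 2 * real k) = (3 * real N) powr (5/4 - real k)"
  proof -
    have "sqrt (3 * real N) = (3 * real N) powr (1/2)" by (simp add: powr_half_sqrt)
    then show ?thesis by (simp only: powr_powr) (simp add: algebra_simps)
  qed
  also have "pi powr (5/2 - 2 * real k) / (3 * real N) powr (5/4 - real k) = pi powr (5/2 - 2 * real k) * (3 * real N) powr (real k - 5/4)"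
    using powr_minus_divide[of "3 * real N" "5/4 - real k"] by simp
  also have "(3 * real N) powr (real k - 5/4) = 3 powr (real k - 5/4) * real N powr (real k - 5/4)"
    by (rule powr_mult)
  finally have 1: "a powr (5/2) / a ^ (2 * k) = pi powr (5/2 - 2 * real k) * (3 powr (real k - 5/4) * real N powr (real k - 5/4))" .
  have 2: "2 * pi\<^sup>2 / (3 * a) = 2 * pi * sqrt (real N / 3)"
  proof -
    have "2 * pi\<^sup>2 / (3 * a) = 2 * pi * (sqrt 3 * sqrt (real N) / 3)"
      using N by (simp add: a_eq power2_eq_square real_sqrt_mult)
    also have "sqrt 3 * sqrt (real N) / 3 = sqrt (real N) / sqrt 3" by (simp add: field_simps)
    finally show ?thesis by (simp add: real_sqrt_divide)
  qed
  show ?thesis unfolding gscale_def a_def[symmetric] 1 2 by (simp only: mult_ac)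
qed

text \<open>Two factors \<open>2 pi\<close> in the denominator, from the Euler product and from
  Cauchy's formula, lower the powers of 2 and \<open>pi\<close>. The Gaussian integral contributes
  \<open>sqrt 3 / sqrt pi\<close> and the telescoping sum 1/3, whence
  \<open>3^(-1/2)\<close>.\<close>

lemma mcoeff_limit_bernoulli:
  "fact (2 * k) * mcoeff_limit k = complex_of_real ((-1) ^ k * 2 powr (2 * real k - 2) * 3 powr (- (1/2)) *
     pi powr (2 * real k - 5/2) * bernoulli_poly (2 * k) (1 / 2))"
proof -
  define B where "B = bernoulli_poly (2 * k) (1 / 2)"
  have "fact (2 * k) * mcoeff_limit k = complex_of_real ((-1) ^ k * (2 * pi) ^ (2 * k) * B * (sqrt (pi / (pi\<^sup>2 / 3)) / (6 * pi) / (2 * pi)))"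
    using hsym_inf_inverse_squares_eq_bernoulli[of k] unfolding mcoeff_limit_def B_def
    by (simp only: of_real_mult of_real_divide) (simp add: field_simps)
  also have "(-1) ^ k * (2 * pi) ^ (2 * k) * B * (sqrt (pi / (pi\<^sup>2 / 3)) / (6 * pi) / (2 * pi)) =
      (-1) ^ k * 2 powr (2 * real k - 2) * 3 powr (- (1/2)) * pi powr (2 * real k - 5/2) * B"
  proof -
    have p2: "(2::real) ^ (2 * k) = 2 powr (2 * real k - 2) * 4"
      using powr_realpow[of "2::real" "2 * k"] by (simp add: powr_diff powr_numeral)
    have ppi: "pi ^ (2 * k) = pi powr (2 * real k - 5/2) * (pi\<^sup>2 * sqrt pi)"
    proof -
      have "pi ^ (2 * k) = pi powr (2 * real k)" using powr_realpow[of pi "2 * k"] by simp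
      also have "\<dots> = pi powr ((2 * real k - 5/2) + (2 + 1/2))" by simp
      also have "\<dots> = pi powr (2 * real k - 5/2) * (pi powr 2 * pi powr (1/2))" by (simp only: powr_add)
      finally show ?thesis by (simp add: powr_half_sqrt powr_numeral)
    qed
    have s: "sqrt (pi / (pi\<^sup>2 / 3)) = sqrt 3 / sqrt pi"
      by (simp add: power2_eq_square real_sqrt_divide)
    have "3 powr (- (1/2)) = 1 / sqrt (3::real)" using powr_minus_divide[of "3::real" "1/2"] by (simp add: powr_half_sqrt)
    also have "\<dots> = sqrt 3 / 3" by (simp add: field_simps)
    finally have t: "3 powr (- (1/2)) = sqrt 3 / (3::real)" .
    show ?thesis unfolding power_mult_distrib p2 ppi s t by (simp add: field_simps power2_eq_square)
  qed
  finally show ?thesis by (simp add: B_def)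
qed

theorem theorem1p1:
  fixes k :: nat
  shows "durfee_moment (2 * k) \<sim>[at_top]
    (\<lambda>n. (-1) ^ k * 2 powr (2 * real k - 2) * 3 powr (real k - 7 / 4) * bernoulli_poly (2 * k) (1 / 2)
         * real n powr (real k - 5 / 4) * exp (2 * pi * sqrt (real n / 3)))"
proof (rule asymp_equivI')
  define B where "B = bernoulli_poly (2 * k) (1 / 2)"
  define K where "K = (-1) ^ k * 2 powr (2 * real k - 2) * 3 powr (- (1/2)) * pi powr (2 * real k - 5/2) * B"
  have K: "fact (2 * k) * mcoeff_limit k = complex_of_real K" unfolding K_def B_def by (rule mcoeff_limit_bernoulli)
  \<comment> \<open>A nonzero constant allows the limit to be normalised to 1, as the asymptotic
    equivalence demands.\<close>
  have "mcoeff_limit k \<noteq> 0" using hsym_inf_inverse_squares_nonzero[of k] by (simp add: mcoeff_limit_def)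
  then have K0: "K \<noteq> 0" using K by auto
  have "(\<lambda>N. Re (complex_of_real (durfee_moment (2 * k) N / gscale k (saddle N)))) \<longlonglongrightarrow> Re (complex_of_real K)"
    using durfee_moment_tendsto[of k] unfolding K by (rule tendsto_Re)
  then have "(\<lambda>N. durfee_moment (2 * k) N / gscale k (saddle N) / K) \<longlonglongrightarrow> K / K"
    using K0 by (intro tendsto_divide tendsto_const) auto
  then have lim: "(\<lambda>N. durfee_moment (2 * k) N / gscale k (saddle N) / K) \<longlonglongrightarrow> 1" using K0 by simp
  have "eventually (\<lambda>N. durfee_moment (2 * k) N / gscale k (saddle N) / K = durfee_moment (2 * k) N /
     ((-1) ^ k * 2 powr (2 * real k - 2) * 3 powr (real k - 7 / 4) * B * real N powr (real k - 5 / 4) * exp (2 * pi * sqrt (real N / 3)))) at_top"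
    using eventually_gt_at_top[of 0]
  proof eventually_elim
    case (elim N)
    have "pi powr (5/2 - 2 * real k) * pi powr (2 * real k - 5/2) = 1" by (simp flip: powr_add)
    moreover have "3 powr (real k - 5/4) * 3 powr (- (1/2)) = (3::real) powr (real k - 7/4)" by (simp flip: powr_add)
    moreover have "gscale k (saddle N) * K = (-1) ^ k * 2 powr (2 * real k - 2) * (3 powr (real k - 5/4) * 3 powr (- (1/2))) *
        B * real N powr (real k - 5/4) * exp (2 * pi * sqrt (real N / 3)) * (pi powr (5/2 - 2 * real k) * pi powr (2 * real k - 5/2))"
      unfolding gscale_saddle[OF elim] K_def by (simp only: mult_ac)
    ultimately have "gscale k (saddle N) * K = (-1) ^ k * 2 powr (2 * real k - 2) * 3 powr (real k - 7 / 4) * B *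
        real N powr (real k - 5 / 4) * exp (2 * pi * sqrt (real N / 3))" by (simp only: mult_1_right)
    then show ?case by (simp only: divide_divide_eq_left)
  qed
  from Lim_transform_eventually[OF lim this]
  show "(\<lambda>n. durfee_moment (2 * k) n / ((-1) ^ k * 2 powr (2 * real k - 2) * 3 powr (real k - 7 / 4) * bernoulli_poly (2 * k) (1 / 2)
         * real n powr (real k - 5 / 4) * exp (2 * pi * sqrt (real n / 3)))) \<longlonglongrightarrow> 1"
    by (simp only: B_def)
qed

end
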